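(* For each $p$ let $X\in\mathbb{R}^{n\times p}$ be orthogonal, i.e. $X^TX=I$ (with $n=n(p)\ge p$), and let $y\in\mathbb{R}^n$ be drawn from the model $y=X\beta^*+\varepsilon$, $\varepsilon\sim N(0,\sigma^2 I)$, where $\sigma^2>0$ is fixed and the true coefficient vector $\beta^*\in\mathbb{R}^p$ has exactly $k_0$ nonzero components, $k_0$ being fixed as $p\to\infty$. Let $A^*=\operatorname{supp}(\beta^* )$ and assume that $$\min_{j\in A^*}|\beta^*_j|-\sigma\sqrt{2\log p}\to\infty\quad\text{as }p\to\infty.$$ Let $U_j=X_j^Ty$, $j=1,\ldots,p$, and let $B$ be the event $$B=\Big\{\min_{j\in A^*}|U_j|>\max_{j\notin A^*}|U_j|\Big\},$$ i.e. the event that the first $k_0$ variables entering the model along the lasso path are those in $A^*$. Then $\mathbb{P}(B)\to1$ as $p\to\infty$, and for each fixed $d\ge0$ the covariance test statistics satisfy $$(T_{k_0+1},T_{k_0+2},\ldots,T_{k_0+d})\ \stackrel{d}{\to}\ \big(\mathrm{Exp}(1),\mathrm{Exp}(1/2),\ldots,\mathrm{Exp}(1/d)\big)\quad\text{as }p\to\infty,$$ where the limiting distribution has independent components. The same convergence in distribution holds conditionally on $B$.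
   Context: $\mathrm{Exp}(\alpha)$ is the exponential distribution with scale parameter (mean) $\alpha$. $X_j$ is the $j$th column of $X$ and $X_A$ is the submatrix of columns indexed by $A$. Lasso path: for $\lambda>0$ let $\hat\beta(\lambda)=\operatorname{argmin}_{\beta\in\mathbb{R}^p}\frac12\|y-X\beta\|_2^2+\lambda\|\beta\|_1$ (unique here). The map $\lambda\mapsto\hat\beta(\lambda)$ is continuous and piecewise linear, with $\hat\beta(\lambda)=0$ for large $\lambda$; its knots (changes of slope) $\lambda_1\ge\lambda_2\ge\cdots\ge\lambda_r\ge0$ are the values at which, as $\lambda$ decreases from $\infty$, a variable enters or leaves the active set $\operatorname{supp}(\hat\beta(\lambda))$. The $k$th step of the path refers to the knot $\lambda_k$. Covariance test statistic at step $k$: let $A$ be the active set just before $\lambda_k$ (i.e. for $\lambda$ slightly larger than $\lambda_k$; $A=\emptyset$ for $k=1$), where some variable $j$ enters at $\lambda_k$. Let $\tilde\beta_A(\lambda_{k+1})=\operatorname{argmin}_{\beta_A\in\mathbb{R}^{|A|}}\frac12\|y-X_A\beta_A\|_2^2+\lambda_{k+1}\|\beta_A\|_1$. Then $$T_k=\big(\langle y,X\hat\beta(\lambda_{k+1})\rangle-\langle y,X_A\tilde\beta_A(\lambda_{k+1})\rangle\big)/\sigma^2.$$ *)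

theory Defs
  imports "HOL-Probability.Probability"
begin

text \<open>
  The dimensions n and p vary inside the statement, so vectors are functions on nat and matrices
  are functions of a row and a column index; only rows i < n and columns j < p matter.
  For a set A of column indices, \<open>A \<rightarrow>\<^sub>E UNIV\<close> plays the role of the space of
  coefficient vectors indexed by A, and a sum over A uses only the columns of X in A.
\<close>

definition dotp :: "nat \<Rightarrow> (nat \<Rightarrow> real) \<Rightarrow> (nat \<Rightarrow> real) \<Rightarrow> real" where
  "dotp n u v = (\<Sum>i<n. u i * v i)"

definition mat_vec :: "(nat \<Rightarrow> nat \<Rightarrow> real) \<Rightarrow> nat set \<Rightarrow> (nat \<Rightarrow> real) \<Rightarrow> nat \<Rightarrow> real" where
  "mat_vec X A b i = (\<Sum>j\<in>A. X i j * b j)"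

definition mat_col :: "(nat \<Rightarrow> nat \<Rightarrow> real) \<Rightarrow> nat \<Rightarrow> nat \<Rightarrow> real" where
  "mat_col X j = (\<lambda>i. X i j)"

definition orthogonal_design :: "nat \<Rightarrow> nat \<Rightarrow> (nat \<Rightarrow> nat \<Rightarrow> real) \<Rightarrow> bool" where
  "orthogonal_design n p X \<longleftrightarrow>
     (\<forall>j<p. \<forall>k<p. dotp n (mat_col X j) (mat_col X k) = (if j = k then 1 else 0))"

definition supp :: "nat \<Rightarrow> (nat \<Rightarrow> real) \<Rightarrow> nat set" where
  "supp p b = {j. j < p \<and> b j \<noteq> 0}"

definition lasso_objective ::
    "nat \<Rightarrow> (nat \<Rightarrow> nat \<Rightarrow> real) \<Rightarrow> (nat \<Rightarrow> real) \<Rightarrow> nat set \<Rightarrow> real \<Rightarrow> (nat \<Rightarrow> real) \<Rightarrow> real" where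
  "lasso_objective n X y A l b =
     1 / 2 * (\<Sum>i<n. (y i - mat_vec X A b i)\<^sup>2) + l * (\<Sum>j\<in>A. \<bar>b j\<bar>)"

definition lasso ::
    "nat \<Rightarrow> (nat \<Rightarrow> nat \<Rightarrow> real) \<Rightarrow> (nat \<Rightarrow> real) \<Rightarrow> nat set \<Rightarrow> real \<Rightarrow> nat \<Rightarrow> real" where
  "lasso n X y A l = arg_min_on (lasso_objective n X y A l) (A \<rightarrow>\<^sub>E UNIV)"

definition active_set ::
    "nat \<Rightarrow> nat \<Rightarrow> (nat \<Rightarrow> nat \<Rightarrow> real) \<Rightarrow> (nat \<Rightarrow> real) \<Rightarrow> real \<Rightarrow> nat set" where
  "active_set n p X y l = supp p (lasso n X y {..<p} l)"

text \<open>The path is followed with decreasing parameter: before l means to the right of l.\<close>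

definition enters_at ::
    "nat \<Rightarrow> nat \<Rightarrow> (nat \<Rightarrow> nat \<Rightarrow> real) \<Rightarrow> (nat \<Rightarrow> real) \<Rightarrow> nat \<Rightarrow> real \<Rightarrow> bool" where
  "enters_at n p X y j l \<longleftrightarrow>
     (\<forall>\<^sub>F t in at_right l. j \<notin> active_set n p X y t) \<and>
     (\<forall>\<^sub>F t in at_left l. j \<in> active_set n p X y t)"

definition leaves_at ::
    "nat \<Rightarrow> nat \<Rightarrow> (nat \<Rightarrow> nat \<Rightarrow> real) \<Rightarrow> (nat \<Rightarrow> real) \<Rightarrow> nat \<Rightarrow> real \<Rightarrow> bool" where
  "leaves_at n p X y j l \<longleftrightarrow>
     (\<forall>\<^sub>F t in at_right l. j \<in> active_set n p X y t) \<and>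
     (\<forall>\<^sub>F t in at_left l. j \<notin> active_set n p X y t)"

definition path_events ::
    "nat \<Rightarrow> nat \<Rightarrow> (nat \<Rightarrow> nat \<Rightarrow> real) \<Rightarrow> (nat \<Rightarrow> real) \<Rightarrow> (nat \<times> real) set" where
  "path_events n p X y =
     {(j, l). j < p \<and> 0 < l \<and> (enters_at n p X y j l \<or> leaves_at n p X y j l)}"

text \<open>
  The knots in decreasing order; a value at which several variables enter or leave is repeated
  accordingly. Knots are numbered from 1, and the path ends at 0: beyond the last knot,
  \<open>knot\<close> is 0.
\<close>

definition knots ::
    "nat \<Rightarrow> nat \<Rightarrow> (nat \<Rightarrow> nat \<Rightarrow> real) \<Rightarrow> (nat \<Rightarrow> real) \<Rightarrow> real list" where
  "knots n p X y =
     rev (sorted_list_of_multiset (image_mset snd (mset_set (path_events n p X y))))"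

definition knot ::
    "nat \<Rightarrow> nat \<Rightarrow> (nat \<Rightarrow> nat \<Rightarrow> real) \<Rightarrow> (nat \<Rightarrow> real) \<Rightarrow> nat \<Rightarrow> real" where
  "knot n p X y k =
     (if 1 \<le> k \<and> k \<le> length (knots n p X y) then knots n p X y ! (k - 1) else 0)"

definition active_before ::
    "nat \<Rightarrow> nat \<Rightarrow> (nat \<Rightarrow> nat \<Rightarrow> real) \<Rightarrow> (nat \<Rightarrow> real) \<Rightarrow> real \<Rightarrow> nat set" where
  "active_before n p X y l = (THE A. \<forall>\<^sub>F t in at_right l. active_set n p X y t = A)"

definition covariance_test ::
    "nat \<Rightarrow> nat \<Rightarrow> (nat \<Rightarrow> nat \<Rightarrow> real) \<Rightarrow> (nat \<Rightarrow> real) \<Rightarrow> real \<Rightarrow> nat \<Rightarrow> real" where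
  "covariance_test n p X y \<sigma> k =
     (let A = active_before n p X y (knot n p X y k);
          l = knot n p X y (k + 1)
      in (dotp n y (mat_vec X {..<p} (lasso n X y {..<p} l)) -
          dotp n y (mat_vec X A (lasso n X y A l))) / \<sigma>\<^sup>2)"

text \<open>e is an n-dimensional random vector with distribution N(0, \<open>\<sigma>\<^sup>2\<close> I).\<close>

definition gaussian_noise :: "'a measure \<Rightarrow> nat \<Rightarrow> real \<Rightarrow> ('a \<Rightarrow> nat \<Rightarrow> real) \<Rightarrow> bool" where
  "gaussian_noise M n \<sigma> e \<longleftrightarrow>
     prob_space.indep_vars M (\<lambda>_. borel) (\<lambda>i \<omega>. e \<omega> i) {..<n} \<and>
     (\<forall>i<n. distributed M lborel (\<lambda>\<omega>. e \<omega> i) (normal_density 0 \<sigma>))"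

text \<open>
  Minimum and maximum are taken in the extended reals, so that the minimum over the empty set is
  \<open>\<infinity>\<close> and the maximum over the empty set is \<open>-\<infinity>\<close>.
\<close>

definition separation_event ::
    "'a measure \<Rightarrow> nat \<Rightarrow> nat set \<Rightarrow> ('a \<Rightarrow> nat \<Rightarrow> real) \<Rightarrow> 'a set" where
  "separation_event M p A U =
     {\<omega> \<in> space M. (INF j\<in>A. ereal \<bar>U \<omega> j\<bar>) > (SUP j\<in>{..<p} - A. ereal \<bar>U \<omega> j\<bar>)}"

text \<open>The parameter of \<open>Exp_dist\<close> is the mean, that of \<open>exponential_density\<close> is the rate.\<close>

definition Exp_dist :: "real \<Rightarrow> real measure" where
  "Exp_dist \<alpha> = density lborel (exponential_density (1 / \<alpha>))"

text \<open>Weak convergence of laws on the finite-dimensional space of real vectors indexed by I.\<close>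

definition weak_conv_vec ::
    "'i set \<Rightarrow> (nat \<Rightarrow> ('i \<Rightarrow> real) measure) \<Rightarrow> ('i \<Rightarrow> real) measure \<Rightarrow> bool" where
  "weak_conv_vec I \<mu> \<nu> \<longleftrightarrow>
     (\<forall>f. continuous_map (powertop_real I) euclideanreal f \<and> bounded (f ` (I \<rightarrow>\<^sub>E UNIV)) \<longrightarrow>
        (\<lambda>m. \<integral>x. f x \<partial>\<mu> m) \<longlonglongrightarrow> (\<integral>x. f x \<partial>\<nu>))"

end

theory Submission
  imports Defs "HOL-Real_Asymp.Real_Asymp"
begin

text \<open>
  For an orthogonal design the lasso soft-thresholds \<open>U j\<close>, so the knots are the order statistics
  \<open>V 1 \<ge> V 2 \<ge> \<dots>\<close> of \<open>\<bar>U j\<bar>\<close> and, without ties, \<open>T k = V k * (V k - V (k + 1)) / \<sigma>\<^sup>2\<close>. The variables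
  \<open>(U j - \<beta> j) / \<sigma>\<close> are independent standard normal; on \<open>B\<close> the knots after step \<open>k0\<close> are the order statistics
  of the null variables, \<open>V (k0 + i) = \<sigma> * Q i\<close>.
  Let \<open>H = - ln P(\<bar>N\<bar> > x)\<close> for a standard normal \<open>N\<close>. Then \<open>H\<close> turns the null variables into independent
  Exp(1) variables, whose top spacings \<open>H (Q i) - H (Q (i + 1))\<close> are exactly independent with law
  Exp(1/i) (Renyi). Mills' ratio gives \<open>x \<le> H' x \<le> x + 1/x\<close>, so \<open>Q i * (Q i - Q (i + 1))\<close> differs
  from the i-th spacing \<open>D\<close> by at most \<open>(D + D\<^sup>2) / (Q (i + 1))\<^sup>2\<close>, which tends to 0 in probability.
\<close>

section \<open>Order statistics\<close>

text \<open>The gaps between consecutive knots shrink like the reciprocal of the knots, so limits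
  for the single knots would have to be sharper than that. The hazard transform removes this
  obstacle: the spacings have the limiting law exactly for every \<open>p\<close> with enough null
  variables, and asymptotics enter only through a pointwise comparison. It succeeds for three
  reasons. \<open>B\<close> fails with small probability by a union bound. Any fixed level is
  exceeded by as many null variables as desired once their number is large, so the relevant order
  statistics are large. Ties have probability 0, since the spacings are almost surely positive. No
  conditional law is computed: conditioning on an event of probability near 1 changes bounded
  expectations little. Independence of the transformed noise is obtained from characteristic
  functions using only the one-dimensional uniqueness theorem.\<close>

definition kth_largest :: "'i set \<Rightarrow> ('i \<Rightarrow> real) \<Rightarrow> nat \<Rightarrow> real" where
  "kth_largest S u k = rev (sorted_list_of_multiset (image_mset u (mset_set S))) ! (k - 1)"

text \<open>In a descending list the entries above \<open>t\<close> form a prefix, and the filter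
  returns exactly that prefix.\<close>

lemma sorted_desc_nth_greater_iff:
  fixes xs :: "real list"
  assumes "sorted_wrt (\<ge>) xs" "1 \<le> k" "k \<le> length xs"
  shows "xs ! (k - 1) > t \<longleftrightarrow> k \<le> length (filter (\<lambda>x. x > t) xs)"
  using assms
proof (induction xs arbitrary: k)
  case Nil
  then show ?case by simp
next
  case (Cons x xs)
  show ?case
  proof (cases "x > t")
    case False
    then have "y \<le> t" if "y \<in> set (x # xs)" for y using that Cons.prems by force
    then have "filter (\<lambda>x. x > t) (x # xs) = []" by (force simp: filter_empty_conv)
    moreover have "(x # xs) ! (k - 1) \<in> set (x # xs)" using Cons.prems by (intro nth_mem) auto
    ultimately show ?thesis
      using \<open>\<And>y. y \<in> set (x # xs) \<Longrightarrow> y \<le> t\<close> Cons.prems by (metis leD le_zero_eq list.size(3) not_one_le_zero)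
  next
    case True
    show ?thesis
    proof (cases "k = 1")
      case False
      then obtain k' where k: "k = Suc k'" "1 \<le> k'" using Cons.prems by (cases k) auto
      then obtain k'' where k': "k' = Suc k''" by (cases k') auto
      have "xs ! (k' - 1) > t \<longleftrightarrow> k' \<le> length (filter (\<lambda>x. x > t) xs)"
        using Cons k by auto
      then show ?thesis using k k' True by simp
    qed (use True in auto)
  qed
qed

lemma length_filter_sorted_list_of_image_mset:
  assumes "finite S"
  shows "length (filter P (rev (sorted_list_of_multiset (image_mset u (mset_set S))))) = card {j\<in>S. P (u j)}"
proof -
  have "length (filter P (rev (sorted_list_of_multiset (image_mset u (mset_set S)))))
     = size (filter_mset P (image_mset u (mset_set S)))"
    by (metis mset_filter mset_rev mset_sorted_list_of_multiset size_mset)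
  also have "\<dots> = size (mset_set {j\<in>S. P (u j)})"
    by (simp add: filter_mset_image_mset filter_mset_mset_set assms)
  finally show ?thesis by simp
qed

lemma sorted_desc_rev_sorted_list_of_multiset:
  "sorted_wrt (\<ge>) (rev (sorted_list_of_multiset (M :: real multiset)))"
  by (simp add: sorted_wrt_rev)

text \<open>Counting exceedances is the form in which order statistics are handled below: it is
  insensitive to the order of tied entries, and it determines the value, since a real number is
  known once the reals below it are.\<close>

lemma kth_largest_greater_iff:
  assumes "finite S" "1 \<le> k" "k \<le> card S"
  shows "kth_largest S u k > t \<longleftrightarrow> k \<le> card {j\<in>S. u j > t}"
proof -
  have "length (rev (sorted_list_of_multiset (image_mset u (mset_set S)))) = card S"
    using length_filter_sorted_list_of_image_mset[OF assms(1), of "\<lambda>_. True" u] by simp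
  then show ?thesis
    unfolding kth_largest_def
    using sorted_desc_nth_greater_iff[OF sorted_desc_rev_sorted_list_of_multiset assms(2), of "image_mset u (mset_set S)" t]
      length_filter_sorted_list_of_image_mset[OF assms(1), of "\<lambda>x. x > t" u] assms by simp
qed

lemma kth_largest_eqI:
  assumes "finite S" "1 \<le> k" "k \<le> card S"
    and "\<And>t. v > t \<longleftrightarrow> k \<le> card {j\<in>S. u j > t}"
  shows "kth_largest S u k = v"
proof -
  have "v > t \<longleftrightarrow> kth_largest S u k > t" for t
    using assms kth_largest_greater_iff by metis
  then show ?thesis by (metis less_irrefl linorder_neqE_linordered_idom)
qed

lemma kth_largest_antimono:
  assumes "finite S" "1 \<le> k" "k \<le> l" "l \<le> card S"
  shows "kth_largest S u l \<le> kth_largest S u k"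
proof (rule ccontr)
  assume "\<not> ?thesis"
  then have "kth_largest S u l > kth_largest S u k" by simp
  then have "l \<le> card {j\<in>S. u j > kth_largest S u k}"
    using kth_largest_greater_iff[of S l _ u] assms by simp
  then have "kth_largest S u k > kth_largest S u k"
    using kth_largest_greater_iff[of S k "kth_largest S u k" u] assms by simp
  then show False by simp
qed

lemma kth_largest_mem:
  assumes "finite S" "1 \<le> k" "k \<le> card S"
  shows "\<exists>i\<in>S. kth_largest S u k = u i"
proof -
  let ?xs = "rev (sorted_list_of_multiset (image_mset u (mset_set S)))"
  have "length ?xs = card S"
    using length_filter_sorted_list_of_image_mset[OF assms(1), of "\<lambda>_. True" u] by simp
  then have "?xs ! (k - 1) \<in> set ?xs" using assms by (intro nth_mem) auto
  then show ?thesis using assms by (auto simp: kth_largest_def)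
qed

lemma kth_largest_cong:
  assumes "\<And>j. j \<in> S \<Longrightarrow> u j = v j"
  shows "kth_largest S u k = kth_largest S v k"
proof -
  have "image_mset u (mset_set S) = image_mset v (mset_set S)"
    by (cases "finite S") (auto intro!: image_mset_cong assms)
  then show ?thesis by (simp add: kth_largest_def)
qed

text \<open>\<open>h\<close> need not map onto an interval, so the counting criterion cannot be
  transferred for arbitrary thresholds. It is compared only at attained values
  \<open>h (u i)\<close>, which suffices because both order statistics are attained.\<close>

lemma kth_largest_strict_mono_on:
  assumes "finite S" "1 \<le> k" "k \<le> card S" "strict_mono_on I h" "\<And>j. j \<in> S \<Longrightarrow> u j \<in> I"
  shows "kth_largest S (\<lambda>j. h (u j)) k = h (kth_largest S u k)"
proof -
  have lt: "h (u i) > h (u j) \<longleftrightarrow> u i > u j" if "i \<in> S" "j \<in> S" for i j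
    using assms that by (metis linorder_less_linear order_less_asym strict_mono_onD)
  have *: "kth_largest S (\<lambda>j. h (u j)) k > h (u i) \<longleftrightarrow> kth_largest S u k > u i" if "i \<in> S" for i
  proof -
    have "{j\<in>S. h (u j) > h (u i)} = {j\<in>S. u j > u i}" using lt that by auto
    then show ?thesis using kth_largest_greater_iff[OF assms(1-3)] by metis
  qed
  obtain a b where ab: "a \<in> S" "b \<in> S" "kth_largest S u k = u a" "kth_largest S (\<lambda>j. h (u j)) k = h (u b)"
    using kth_largest_mem[OF assms(1-3)] by metis
  then have "\<not> h (u b) > h (u a)" "\<not> u a > u b" using * by force+
  then show ?thesis using ab lt[of a b] by (metis assms(4) assms(5) linorder_less_linear strict_mono_onD)
qed

lemma ex_argmax:
  fixes u :: "'i \<Rightarrow> real"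
  assumes "finite S" "S \<noteq> {}"
  obtains j where "j \<in> S" "\<And>i. i \<in> S \<Longrightarrow> u i \<le> u j"
proof -
  have "Max (u ` S) \<in> u ` S" using assms by (intro Max_in) auto
  then obtain j where "j \<in> S" "Max (u ` S) = u j" by auto
  then show ?thesis using that[of j] assms(1) by (metis Max_ge finite_imageI imageI)
qed

text \<open>This recursion drives the induction on spacings: once a maximiser is deleted, all ranks
  drop by one. With several maximisers any of them may be deleted, since entries are counted with
  multiplicity.\<close>

lemma kth_largest_remove_argmax:
  assumes "finite S" "j \<in> S" "\<And>i. i \<in> S \<Longrightarrow> u i \<le> u j"
  shows "kth_largest S u 1 = u j"
    and "1 \<le> k \<Longrightarrow> Suc k \<le> card S \<Longrightarrow> kth_largest S u (Suc k) = kth_largest (S - {j}) u k"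
proof -
  have S: "1 \<le> card S" using assms by (metis One_nat_def Suc_leI card_gt_0_iff empty_iff)
  have eq: "{i\<in>S. u i > t} = (if u j > t then insert j {i\<in>S - {j}. u i > t} else {})" for t
    using assms by force
  have eq': "{i\<in>S - {j}. u i > t} = {}" if "\<not> u j > t" for t
    using assms that by force
  have cd: "card {i\<in>S. u i > t} = (if u j > t then Suc (card {i\<in>S - {j}. u i > t}) else 0)" for t
    using assms(1) by (subst eq) auto
  show "kth_largest S u 1 = u j"
    using S assms by (intro kth_largest_eqI) (auto simp: cd)
  assume k: "1 \<le> k" "Suc k \<le> card S"
  show "kth_largest S u (Suc k) = kth_largest (S - {j}) u k"
  proof (intro kth_largest_eqI)
    fix t
    have "kth_largest (S - {j}) u k > t \<longleftrightarrow> k \<le> card {i\<in>S - {j}. u i > t}"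
      using k assms by (intro kth_largest_greater_iff) auto
    moreover have "k \<noteq> 0" using k by simp
    ultimately show "kth_largest (S - {j}) u k > t \<longleftrightarrow> Suc k \<le> card {i\<in>S. u i > t}"
      unfolding cd using eq'[of t] by (cases "u j > t") (simp_all del: Collect_empty_eq)
  qed (use k assms in auto)
qed

text \<open>Written as a condition on a sum of indicators, the event is visibly measurable.\<close>

lemma kth_largest_greater_iff_of_bool:
  assumes "finite S" "1 \<le> k" "k \<le> card S"
  shows "kth_largest S u k > t \<longleftrightarrow> real k \<le> (\<Sum>j\<in>S. of_bool (u j > t))"
proof -
  have "real (card {j\<in>S. u j > t}) = (\<Sum>j\<in>S. of_bool (u j > t))"
    using assms(1) by (simp add: of_bool_def sum.If_cases Int_def)
  then show ?thesis using kth_largest_greater_iff[OF assms] by (metis of_nat_le_iff)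
qed

lemma measurable_kth_largest:
  assumes "finite S" "1 \<le> k" "k \<le> card S" "\<And>j. j \<in> S \<Longrightarrow> (\<lambda>\<omega>. u \<omega> j) \<in> borel_measurable M"
  shows "(\<lambda>\<omega>. kth_largest S (u \<omega>) k) \<in> borel_measurable M"
proof (subst borel_measurable_iff_greater, intro allI)
  fix t :: real
  have [measurable]: "(\<lambda>\<omega>. \<Sum>j\<in>S. of_bool (u \<omega> j > t) :: real) \<in> borel_measurable M"
    using assms(4) by (intro borel_measurable_sum) measurable
  show "{\<omega> \<in> space M. t < kth_largest S (u \<omega>) k} \<in> sets M"
    unfolding kth_largest_greater_iff_of_bool[OF assms(1-3)] by measurable
qed

text \<open>If some element of \<open>S\<close> exceeds \<open>t\<close> then all of
  \<open>C\<close> does, which shifts the count by \<open>card C\<close>; otherwise fewer than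
  \<open>card C + k\<close> elements exceed \<open>t\<close>. On the separation event this strips
  off the true variables.\<close>

lemma kth_largest_union:
  assumes "finite C" "finite S" "C \<inter> S = {}" "\<And>i j. i \<in> C \<Longrightarrow> j \<in> S \<Longrightarrow> u i > u j"
    and "1 \<le> k" "k \<le> card S"
  shows "kth_largest (C \<union> S) u (card C + k) = kth_largest S u k"
proof (intro kth_largest_eqI)
  fix t
  have split: "card {j\<in>C \<union> S. u j > t} = card {j\<in>C. u j > t} + card {j\<in>S. u j > t}"
  proof -
    have "{j\<in>C \<union> S. u j > t} = {j\<in>C. u j > t} \<union> {j\<in>S. u j > t}" by auto
    then show ?thesis using assms by (simp add: card_Un_disjoint disjoint_iff)
  qed
  have "card C + k \<le> card {j\<in>C \<union> S. u j > t} \<longleftrightarrow> k \<le> card {j\<in>S. u j > t}"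
  proof (cases "\<exists>j\<in>S. u j > t")
    case True
    then have "{j\<in>C. u j > t} = C" using assms(4) by force
    then show ?thesis using split by simp
  next
    case False
    then have "{j\<in>S. u j > t} = {}" by auto
    moreover have "card {j\<in>C. u j > t} \<le> card C" using assms by (intro card_mono) auto
    ultimately show ?thesis using split assms(5) by (auto simp del: Collect_empty_eq)
  qed
  then show "kth_largest S u k > t \<longleftrightarrow> card C + k \<le> card {j\<in>C \<union> S. u j > t}"
    using kth_largest_greater_iff[OF assms(2,5,6)] by simp
qed (use assms in \<open>auto simp: card_Un_disjoint\<close>)

section \<open>The lasso path for an orthogonal design\<close>

text \<open>The soft-thresholding operator, the proximal map of \<open>l\<close> times the absolute
  value.\<close>

definition soft :: "real \<Rightarrow> real \<Rightarrow> real" where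
  "soft l u = (if u > l then u - l else if u < - l then u + l else 0)"

text \<open>The scalar objective is strongly convex with modulus 1, hence the extra quadratic term.
  It delivers existence and uniqueness of the minimiser at once.\<close>

lemma soft_minimizes:
  assumes "l \<ge> 0"
  shows "b\<^sup>2 / 2 - u * b + l * \<bar>b\<bar> \<ge> (soft l u)\<^sup>2 / 2 - u * soft l u + l * \<bar>soft l u\<bar> + (b - soft l u)\<^sup>2 / 2"
proof -
  have 1: "l * \<bar>b\<bar> \<ge> l * b" "l * \<bar>b\<bar> \<ge> - (l * b)"
    using assms mult_left_mono[of b "\<bar>b\<bar>" l] mult_left_mono[of "- b" "\<bar>b\<bar>" l] by auto
  have 2: "l * \<bar>b\<bar> \<ge> u * b" if "\<bar>u\<bar> \<le> l"
    using that by (metis abs_ge_self abs_ge_zero abs_mult mult_right_mono order_trans)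
  consider "u > l" | "u < - l" | "\<bar>u\<bar> \<le> l" by linarith
  then show ?thesis
    by cases (use 1 2 assms in \<open>auto simp: soft_def power2_eq_square field_simps\<close>)
qed

lemma mult_soft:
  assumes "l \<ge> 0"
  shows "u * soft l u = \<bar>u\<bar> * max 0 (\<bar>u\<bar> - l)"
proof -
  consider "u > l" | "u < - l" | "\<bar>u\<bar> \<le> l" by linarith
  then show ?thesis
    by cases (use assms in \<open>auto simp: soft_def algebra_simps\<close>)
qed

lemma dotp_mat_vec:
  "dotp n y (mat_vec X C b) = (\<Sum>j\<in>C. dotp n (mat_col X j) y * b j)"
proof -
  have "dotp n y (mat_vec X C b) = (\<Sum>i<n. \<Sum>j\<in>C. X i j * y i * b j)"
    by (simp add: dotp_def mat_vec_def sum_distrib_left algebra_simps)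
  also have "\<dots> = (\<Sum>j\<in>C. \<Sum>i<n. X i j * y i * b j)" by (rule sum.swap)
  finally show ?thesis by (simp add: dotp_def mat_col_def sum_distrib_right)
qed

lemma dotp_mat_col_mat_vec:
  assumes "orthogonal_design n p X" "C \<subseteq> {..<p}" "j < p"
  shows "dotp n (mat_col X j) (mat_vec X C b) = (if j \<in> C then b j else 0)"
proof -
  have fin: "finite C" using assms(2) finite_subset by blast
  have "dotp n (mat_col X j) (mat_vec X C b) = (\<Sum>k\<in>C. dotp n (mat_col X k) (mat_col X j) * b k)"
    by (rule dotp_mat_vec)
  also have "\<dots> = (\<Sum>k\<in>C. (if k = j then 1 else 0) * b k)"
    using assms unfolding orthogonal_design_def by (intro sum.cong) auto
  finally show ?thesis using fin by (simp add: if_distrib[of "\<lambda>x. x * _"] sum.delta cong: if_cong)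
qed

lemma sum_mat_vec_squared:
  assumes "orthogonal_design n p X" "C \<subseteq> {..<p}"
  shows "(\<Sum>i<n. (mat_vec X C b i)\<^sup>2) = (\<Sum>j\<in>C. (b j)\<^sup>2)"
proof -
  have "(\<Sum>i<n. (mat_vec X C b i)\<^sup>2) = dotp n (mat_vec X C b) (mat_vec X C b)"
    by (simp add: dotp_def power2_eq_square)
  also have "\<dots> = (\<Sum>j\<in>C. dotp n (mat_col X j) (mat_vec X C b) * b j)" by (rule dotp_mat_vec)
  also have "\<dots> = (\<Sum>j\<in>C. (b j)\<^sup>2)"
    using assms(2) by (intro sum.cong) (auto simp: dotp_mat_col_mat_vec[OF assms] power2_eq_square)
  finally show ?thesis .
qed

text \<open>Orthonormal columns turn the quadratic form into a sum of squares, so the objective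
  decouples into one scalar problem for each column.\<close>

lemma lasso_objective_orthogonal:
  assumes "orthogonal_design n p X" "C \<subseteq> {..<p}"
  shows "lasso_objective n X y C l b = (\<Sum>i<n. (y i)\<^sup>2) / 2 +
    (\<Sum>j\<in>C. (b j)\<^sup>2 / 2 - dotp n (mat_col X j) y * b j + l * \<bar>b j\<bar>)"
proof -
  have "(\<Sum>i<n. (y i - mat_vec X C b i)\<^sup>2)
     = (\<Sum>i<n. (y i)\<^sup>2) + (\<Sum>i<n. (mat_vec X C b i)\<^sup>2) - 2 * dotp n y (mat_vec X C b)"
    by (simp add: power2_diff sum.distrib sum_subtractf dotp_def sum_distrib_left mult.assoc)
  then show ?thesis
    by (simp add: lasso_objective_def sum_mat_vec_squared[OF assms] dotp_mat_vec sum.distrib sum_subtractf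
        flip: sum_divide_distrib sum_distrib_left)
qed

lemma lasso_orthogonal:
  assumes "orthogonal_design n p X" "C \<subseteq> {..<p}" "l \<ge> 0"
  shows "lasso n X y C l = (\<lambda>j\<in>C. soft l (dotp n (mat_col X j) y))"
proof -
  let ?f = "lasso_objective n X y C l" and ?s = "\<lambda>j\<in>C. soft l (dotp n (mat_col X j) y)"
  have fin: "finite C" using assms(2) finite_subset by blast
  have gap: "?f b \<ge> ?f ?s + (\<Sum>j\<in>C. (b j - ?s j)\<^sup>2 / 2)" for b
  proof -
    have "(\<Sum>j\<in>C. (?s j)\<^sup>2 / 2 - dotp n (mat_col X j) y * ?s j + l * \<bar>?s j\<bar>) + (\<Sum>j\<in>C. (b j - ?s j)\<^sup>2 / 2)
      \<le> (\<Sum>j\<in>C. (b j)\<^sup>2 / 2 - dotp n (mat_col X j) y * b j + l * \<bar>b j\<bar>)"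
      unfolding sum.distrib[symmetric]
    proof (intro sum_mono)
      fix j assume "j \<in> C"
      then show "(?s j)\<^sup>2 / 2 - dotp n (mat_col X j) y * ?s j + l * \<bar>?s j\<bar> + (b j - ?s j)\<^sup>2 / 2
        \<le> (b j)\<^sup>2 / 2 - dotp n (mat_col X j) y * b j + l * \<bar>b j\<bar>"
        using soft_minimizes[OF assms(3), of "dotp n (mat_col X j) y" "b j"] by simp
    qed
    then show ?thesis unfolding lasso_objective_orthogonal[OF assms(1,2)] by linarith
  qed
  have pos: "0 \<le> (\<Sum>j\<in>C. (b j - ?s j)\<^sup>2 / 2)" for b
    by (simp add: sum_nonneg)
  have uniq: "b = ?s" if "b \<in> C \<rightarrow>\<^sub>E UNIV" "?f b \<le> ?f ?s" for b
  proof -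
    have "(\<Sum>j\<in>C. (b j - ?s j)\<^sup>2 / 2) = 0" using gap[of b] pos[of b] that(2) by linarith
    then have "\<forall>j\<in>C. (b j - ?s j)\<^sup>2 / 2 = 0" using fin by (simp add: sum_nonneg_eq_0_iff)
    then have "b j = ?s j" if "j \<in> C" for j using that by simp
    then show ?thesis by (intro PiE_ext[OF that(1), of ?s]) auto
  qed
  have "?f b \<ge> ?f ?s" for b using gap[of b] pos[of b] by linarith
  \<comment> \<open>The minimiser in \<open>lasso\<close> is a choice, so some minimiser is
    exhibited first; \<open>uniq\<close> then identifies the chosen one. Uniqueness is among
    functions that are undefined outside \<open>C\<close>.\<close>
  then have "is_arg_min ?f (\<lambda>b. b \<in> C \<rightarrow>\<^sub>E UNIV) ?s"
    unfolding is_arg_min_def by (auto simp: not_less)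
  then have "is_arg_min ?f (\<lambda>b. b \<in> C \<rightarrow>\<^sub>E UNIV) (lasso n X y C l)"
    unfolding lasso_def arg_min_on_def arg_min_def
    by (rule someI[of "is_arg_min ?f (\<lambda>b. b \<in> C \<rightarrow>\<^sub>E UNIV)"])
  then show ?thesis
    using uniq \<open>is_arg_min ?f (\<lambda>b. b \<in> C \<rightarrow>\<^sub>E UNIV) ?s\<close> unfolding is_arg_min_def
    by (meson not_less)
qed

section \<open>Active sets, entry times and knots\<close>

lemma active_set_orthogonal:
  assumes "orthogonal_design n p X" "l > 0"
  shows "active_set n p X y l = {j. j < p \<and> \<bar>dotp n (mat_col X j) y\<bar> > l}"
proof -
  have "l \<ge> 0" using assms(2) by simp
  note lasso_orthogonal[OF assms(1) order_refl this]
  then show ?thesis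
    unfolding active_set_def supp_def using assms(2) by (auto simp: soft_def)
qed

context
  fixes n p :: nat and X :: "nat \<Rightarrow> nat \<Rightarrow> real" and y u :: "nat \<Rightarrow> real"
  assumes orth: "orthogonal_design n p X"
    and u: "\<And>j. u j = \<bar>dotp n (mat_col X j) y\<bar>"
begin

text \<open>The active set at \<open>t > 0\<close> is \<open>{j. j < p \<and> u j > t}\<close>.
  Approaching \<open>l\<close> from the right keeps the inequality strict, approaching from the left
  weakens it to \<open>u j \<ge> l\<close>; the two differ exactly when \<open>u j = l\<close>,
  which is an entry. A departure would need the strict inequality together with the failure of the
  weak one, so there is none.\<close>

lemma eventually_at_right_active_set_iff:
  assumes "l \<ge> 0" "j < p"
  shows "\<forall>\<^sub>F t in at_right l. j \<in> active_set n p X y t \<longleftrightarrow> u j > l"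
proof (cases "u j > l")
  case True
  then have "\<forall>\<^sub>F t in at_right l. t < u j \<and> l < t"
    by (intro eventually_conj eventually_at_right_less) (auto simp: eventually_at_right_field intro!: exI[of _ "u j"])
  then show ?thesis
    by eventually_elim (use True assms in \<open>auto simp: active_set_orthogonal[OF orth] u\<close>)
next
  case False
  have "\<forall>\<^sub>F t in at_right l. l < t" by (rule eventually_at_right_less)
  then show ?thesis
    by eventually_elim (use False assms in \<open>auto simp: active_set_orthogonal[OF orth] u\<close>)
qed

lemma eventually_at_left_active_set_iff:
  assumes "l > 0" "j < p"
  shows "\<forall>\<^sub>F t in at_left l. j \<in> active_set n p X y t \<longleftrightarrow> u j \<ge> l"
proof -
  \<comment> \<open>The \<open>max 0\<close> keeps \<open>t\<close> positive, where the description
    of the active set is valid.\<close>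
  have ev: "\<forall>\<^sub>F t in at_left l. max 0 (if u j < l then u j else 0) < t \<and> t < l"
    using assms by (intro eventually_conj)
      (auto simp: eventually_at_left_field intro!: exI[of _ "max 0 (if u j < l then u j else 0)"])
  then show ?thesis
    by eventually_elim (use assms in \<open>auto simp: active_set_orthogonal[OF orth] u split: if_splits\<close>)
qed

lemma enters_at_iff:
  assumes "l > 0" "j < p"
  shows "enters_at n p X y j l \<longleftrightarrow> u j = l"
proof -
  have "(\<forall>\<^sub>F t in at_right l. j \<notin> active_set n p X y t) \<longleftrightarrow> (\<forall>\<^sub>F t in at_right l. \<not> u j > l)"
    using assms eventually_at_right_active_set_iff[of l j]
    by (intro eventually_cong[of "\<lambda>t. j \<in> active_set n p X y t \<longleftrightarrow> u j > l"]) auto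
  moreover have "(\<forall>\<^sub>F t in at_left l. j \<in> active_set n p X y t) \<longleftrightarrow> (\<forall>\<^sub>F t in at_left l. u j \<ge> l)"
    using assms eventually_at_left_active_set_iff[of l j]
    by (intro eventually_cong[of "\<lambda>t. j \<in> active_set n p X y t \<longleftrightarrow> u j \<ge> l"]) auto
  ultimately show ?thesis by (auto simp: enters_at_def eventually_const_iff trivial_limit_at_right_real trivial_limit_at_left_real)
qed

lemma not_leaves_at:
  assumes "l > 0" "j < p"
  shows "\<not> leaves_at n p X y j l"
proof -
  have "(\<forall>\<^sub>F t in at_right l. j \<in> active_set n p X y t) \<longleftrightarrow> (\<forall>\<^sub>F t in at_right l. u j > l)"
    using assms eventually_at_right_active_set_iff[of l j]
    by (intro eventually_cong[of "\<lambda>t. j \<in> active_set n p X y t \<longleftrightarrow> u j > l"]) auto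
  moreover have "(\<forall>\<^sub>F t in at_left l. j \<notin> active_set n p X y t) \<longleftrightarrow> (\<forall>\<^sub>F t in at_left l. \<not> u j \<ge> l)"
    using assms eventually_at_left_active_set_iff[of l j]
    by (intro eventually_cong[of "\<lambda>t. j \<in> active_set n p X y t \<longleftrightarrow> u j \<ge> l"]) auto
  ultimately show ?thesis by (auto simp: leaves_at_def eventually_const_iff trivial_limit_at_right_real trivial_limit_at_left_real)
qed

lemma active_before_orthogonal:
  assumes "l \<ge> 0"
  shows "active_before n p X y l = {j. j < p \<and> u j > l}"
proof -
  have "\<forall>\<^sub>F t in at_right l. \<forall>j\<in>{..<p}. j \<in> active_set n p X y t \<longleftrightarrow> u j > l"
    using eventually_at_right_active_set_iff assms by (intro eventually_ball_finite) auto
  then have *: "\<forall>\<^sub>F t in at_right l. active_set n p X y t = {j. j < p \<and> u j > l}"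
    by eventually_elim (auto simp: active_set_def supp_def)
  show ?thesis
    unfolding active_before_def
  proof (rule the_equality)
    show "\<forall>\<^sub>F t in at_right l. active_set n p X y t = {j. j < p \<and> u j > l}" by (fact *)
  next
    fix C assume "\<forall>\<^sub>F t in at_right l. active_set n p X y t = C"
    with * have "\<forall>\<^sub>F t in at_right l. C = {j. j < p \<and> u j > l}" by eventually_elim auto
    then show "C = {j. j < p \<and> u j > l}" by (simp add: eventually_const_iff trivial_limit_at_right_real)
  qed
qed

lemma path_events_orthogonal: "path_events n p X y = (\<lambda>j. (j, u j)) ` {j. j < p \<and> u j \<noteq> 0}"
proof -
  have "(j, l) \<in> path_events n p X y \<longleftrightarrow> j < p \<and> 0 < l \<and> u j = l" for j l
    using enters_at_iff[of l j] not_leaves_at[of l j] by (auto simp: path_events_def)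
  moreover have "0 < u j \<longleftrightarrow> u j \<noteq> 0" for j using u[of j] by simp
  ultimately show ?thesis by (auto simp: image_iff)
qed

lemma knots_orthogonal:
  "knots n p X y = rev (sorted_list_of_multiset (image_mset u (mset_set {j. j < p \<and> u j \<noteq> 0})))"
proof -
  have "mset_set (path_events n p X y) = image_mset (\<lambda>j. (j, u j)) (mset_set {j. j < p \<and> u j \<noteq> 0})"
    unfolding path_events_orthogonal by (rule image_mset_mset_set[symmetric]) (auto intro: inj_onI)
  then show ?thesis by (simp add: knots_def multiset.map_comp o_def)
qed

text \<open>Variables with \<open>u j = 0\<close> never enter at a positive parameter, so they are
  missing from \<open>knots\<close>; the value 0 of \<open>knot\<close> beyond the end of the list
  supplies precisely these zeros.\<close>

lemma knot_orthogonal: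
  assumes "1 \<le> k" "k \<le> p"
  shows "knot n p X y k = kth_largest {..<p} u k"
proof -
  let ?S = "{j. j < p \<and> u j \<noteq> 0}"
  have fin: "finite ?S" by auto
  have len: "length (knots n p X y) = card ?S"
    using length_filter_sorted_list_of_image_mset[OF fin, of "\<lambda>_. True" u] by (simp add: knots_orthogonal)
  have gt: "knot n p X y k > t \<longleftrightarrow> k \<le> card {j\<in>{..<p}. u j > t}" for t
  proof (cases "t < 0")
    case True
    have "u j > t" for j using True by (simp add: u less_le_trans)
    then have "k \<le> card {j\<in>{..<p}. u j > t}" using assms by simp
    moreover have "knot n p X y k \<ge> 0"
    proof (cases "k \<le> length (knots n p X y)")
      case True
      then have "knots n p X y ! (k - 1) \<in> set (knots n p X y)" using assms by (intro nth_mem) auto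
      then show ?thesis using True assms fin unfolding knots_orthogonal knot_def by (auto simp: u)
    qed (simp add: knot_def)
    ultimately show ?thesis using True by auto
  next
    case False
    have eq: "{j\<in>{..<p}. u j > t} = {j\<in>?S. u j > t}" using False by auto
    show ?thesis
    proof (cases "k \<le> card ?S")
      case True
      then show ?thesis
        using kth_largest_greater_iff[OF fin assms(1), of t u] assms len unfolding eq
        by (simp add: knot_def knots_orthogonal kth_largest_def)
    next
      case k: False
      have "card {j\<in>?S. u j > t} \<le> card ?S" by (intro card_mono) auto
      then show ?thesis using k False len unfolding eq by (auto simp: knot_def)
    qed
  qed
  show ?thesis using assms by (intro kth_largest_eqI[symmetric] gt) auto
qed

text \<open>Both fits use the same parameter and soft-thresholding acts on each column separately,
  so the columns of the earlier active set contribute equally to both and cancel. The formula also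
  covers ties and is the basis for measurability of the statistic.\<close>

lemma covariance_test_orthogonal:
  assumes "1 \<le> k" "k < p"
  shows "covariance_test n p X y \<sigma> k =
    (\<Sum>j<p. of_bool (u j \<le> kth_largest {..<p} u k) * (u j * max 0 (u j - kth_largest {..<p} u (Suc k)))) / \<sigma>\<^sup>2"
proof -
  let ?V = "kth_largest {..<p} u"
  have nonneg: "?V k \<ge> 0" if "1 \<le> k" "k \<le> p" for k
    using kth_largest_mem[of "{..<p}" k u] that u by auto
  have l: "?V (Suc k) \<ge> 0" "?V k \<ge> 0" using nonneg assms by auto
  have dotp: "dotp n y (mat_vec X C (lasso n X y C (?V (Suc k)))) = (\<Sum>j\<in>C. u j * max 0 (u j - ?V (Suc k)))"
    if "C \<subseteq> {..<p}" for C
    unfolding dotp_mat_vec lasso_orthogonal[OF orth that l(1)]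
    by (intro sum.cong) (auto simp: mult_soft[OF l(1)] u)
  have un: "{..<p} = {j. j < p \<and> u j > ?V k} \<union> {j. j < p \<and> u j \<le> ?V k}" by auto
  have split: "(\<Sum>j<p. u j * max 0 (u j - ?V (Suc k))) =
      (\<Sum>j | j < p \<and> u j > ?V k. u j * max 0 (u j - ?V (Suc k))) +
      (\<Sum>j | j < p \<and> u j \<le> ?V k. u j * max 0 (u j - ?V (Suc k)))"
    by (subst un, rule sum.union_disjoint) auto
  have "(\<Sum>j | j < p \<and> u j \<le> ?V k. u j * max 0 (u j - ?V (Suc k))) =
    (\<Sum>j<p. of_bool (u j \<le> ?V k) * (u j * max 0 (u j - ?V (Suc k))))"
    by (rule sum.mono_neutral_cong_left) auto
  then show ?thesis
    using assms l split dotp[OF order_refl] dotp[of "{j. j < p \<and> u j > ?V k}"] unfolding covariance_test_def Let_def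
    by (simp add: knot_orthogonal active_before_orthogonal subset_eq)
qed

text \<open>
  The three knots around \<open>k\<close> being separated, exactly one variable contributes to the sum in
  \<open>covariance_test_orthogonal\<close>.
\<close>

lemma covariance_test_no_ties:
  assumes "1 \<le> k" "k < p" "kth_largest {..<p} u k > kth_largest {..<p} u (Suc k)"
    and "k - 1 \<le> card {j. j < p \<and> u j > kth_largest {..<p} u k}"
  shows "covariance_test n p X y \<sigma> k =
    kth_largest {..<p} u k * (kth_largest {..<p} u k - kth_largest {..<p} u (Suc k)) / \<sigma>\<^sup>2"
proof -
  let ?V = "kth_largest {..<p} u"
  have "\<exists>i\<in>{..<p}. ?V k = u i" using assms by (intro kth_largest_mem) auto
  then obtain i where i: "i < p" "?V k = u i" by auto
  \<comment> \<open>A second contributing index \<open>j\<close>, together with \<open>i\<close> and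
    the \<open>k - 1\<close> indices strictly above the knot \<open>k\<close>, would give
    \<open>Suc k\<close> indices above the next knot.\<close>
  have uniq: "j = i" if "j < p" "u j \<le> ?V k" "u j > ?V (Suc k)" for j
  proof (rule ccontr)
    assume "j \<noteq> i"
    let ?G = "{j. j < p \<and> u j > ?V k}"
    have "card (?G \<union> {i, j}) = card ?G + card {i, j}"
      using i that by (intro card_Un_disjoint) auto
    moreover have "card (?G \<union> {i, j}) \<le> card {j\<in>{..<p}. u j > ?V (Suc k)}"
      using i that assms(3) by (intro card_mono) auto
    ultimately have "Suc k \<le> card {j\<in>{..<p}. u j > ?V (Suc k)}"
      using \<open>j \<noteq> i\<close> assms(1,4) by simp
    then show False using kth_largest_greater_iff[of "{..<p}" "Suc k" "?V (Suc k)" u] assms by simp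
  qed
  have "(\<Sum>j<p. of_bool (u j \<le> ?V k) * (u j * max 0 (u j - ?V (Suc k)))) =
    (\<Sum>j<p. if j = i then ?V k * (?V k - ?V (Suc k)) else 0)"
    using uniq i assms(3) by (intro sum.cong refl) (auto simp: max_def not_le)
  then show ?thesis using i assms by (simp add: covariance_test_orthogonal)
qed

end

section \<open>Orthogonal transforms of Gaussian noise\<close>

text \<open>
  The law of \<open>Z\<close> under the probability with density proportional to \<open>2 + W\<close> has the characteristic
  function of \<open>N\<close>, hence equals \<open>N\<close>.
\<close>

lemma (in prob_space) expectation_indicator_mult_real:
  fixes Z W :: "'a \<Rightarrow> real"
  assumes N: "real_distribution N"
    and Z[measurable]: "Z \<in> borel_measurable M" and W[measurable]: "W \<in> borel_measurable M"
    and bound: "\<And>\<omega>. \<bar>W \<omega>\<bar> \<le> 1"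
    and char_Z: "\<And>s. (\<integral>\<omega>. iexp (s * Z \<omega>) \<partial>M) = char N s"
    and char_W: "\<And>s. (\<integral>\<omega>. iexp (s * Z \<omega>) * complex_of_real (W \<omega>) \<partial>M) = char N s * complex_of_real (\<integral>\<omega>. W \<omega> \<partial>M)"
    and C[measurable]: "C \<in> sets borel"
  shows "(\<integral>\<omega>. indicator C (Z \<omega>) * W \<omega> \<partial>M) = measure N C * (\<integral>\<omega>. W \<omega> \<partial>M)"
proof -
  \<comment> \<open>\<open>W\<close> may change sign or have mean 0, but it is bounded by 1; the
    shift by 2 makes \<open>2 + W\<close> at least 1, and hence \<open>c\<close> at least 1.\<close>
  define c where "c = 2 + (\<integral>\<omega>. W \<omega> \<partial>M)"
  define M' where "M' = density M (\<lambda>\<omega>. ennreal ((2 + W \<omega>) / c))"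
  have intW: "integrable M W" using bound by (intro integrable_const_bound[of _ 1]) auto
  have intZW: "integrable M (\<lambda>\<omega>. iexp (s * Z \<omega>) * complex_of_real (W \<omega>))" for s
    using bound by (intro integrable_const_bound[of _ 1]) (auto simp: norm_mult)
  have intZ: "integrable M (\<lambda>\<omega>. iexp (s * Z \<omega>))" for s
    by (intro integrable_const_bound[of _ 1]) auto
  have "(\<integral>\<omega>. W \<omega> \<partial>M) \<ge> (\<integral>\<omega>. - 1 \<partial>M)"
    using bound intW by (intro integral_mono) (auto simp: abs_le_iff minus_le_iff)
  then have c: "c \<ge> 1" by (simp add: c_def prob_space)
  have nonneg: "0 \<le> (2 + W \<omega>) / c" for \<omega> using c bound[of \<omega>] by (auto simp: abs_le_iff)
  have M': "prob_space M'"
  proof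
    have "emeasure M' (space M') = (\<integral>\<^sup>+\<omega>. ennreal ((2 + W \<omega>) / c) \<partial>M)"
      by (simp add: M'_def emeasure_density cong: nn_integral_cong)
    also have "\<dots> = ennreal (\<integral>\<omega>. (2 + W \<omega>) / c \<partial>M)"
      using nonneg intW by (intro nn_integral_eq_integral) auto
    also have "(\<integral>\<omega>. (2 + W \<omega>) / c \<partial>M) = 1"
      using intW c by (simp add: c_def prob_space)
    finally show "emeasure M' (space M') = 1" by simp
  qed
  then interpret M': prob_space M' .
  have [measurable]: "Z \<in> borel_measurable M'" by (simp add: M'_def)
  have "char (distr M' borel Z) s = char N s" for s
  proof -
    have "char (distr M' borel Z) s = (\<integral>\<omega>. iexp (s * Z \<omega>) \<partial>M')"
      unfolding char_def by (subst integral_distr) auto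
    also have "\<dots> = (\<integral>\<omega>. ((2 + W \<omega>) / c) *\<^sub>R iexp (s * Z \<omega>) \<partial>M)"
      unfolding M'_def by (subst integral_density) (auto simp: nonneg)
    also have "\<dots> = (\<integral>\<omega>. (2 * iexp (s * Z \<omega>) + iexp (s * Z \<omega>) * complex_of_real (W \<omega>)) / complex_of_real c \<partial>M)"
      by (intro Bochner_Integration.integral_cong) (auto simp: scaleR_conv_of_real field_simps)
    also have "\<dots> = (2 * char N s + char N s * complex_of_real (\<integral>\<omega>. W \<omega> \<partial>M)) / complex_of_real c"
      using intZ intZW char_Z[of s] char_W[of s] by simp
    also have "\<dots> = char N s * complex_of_real c / complex_of_real c"
      by (simp add: c_def algebra_simps)
    finally show ?thesis using c by simp
  qed
  then have "distr M' borel Z = N"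
    by (intro Levy_uniqueness ext M'.real_distribution_distr N) auto
  moreover have "char (distr M borel Z) s = char N s" for s
  proof -
    have "char (distr M borel Z) s = (\<integral>\<omega>. iexp (s * Z \<omega>) \<partial>M)"
      unfolding char_def by (subst integral_distr) auto
    then show ?thesis by (simp only: char_Z)
  qed
  then have "distr M borel Z = N"
    by (intro Levy_uniqueness ext real_distribution_distr N) auto
  ultimately have eq: "measure M' (Z -` C \<inter> space M) = measure N C" "measure M (Z -` C \<inter> space M) = measure N C"
    by (auto simp: measure_distr M'_def dest!: arg_cong[where f="\<lambda>N. measure N C"])
  have int: "integrable M (\<lambda>\<omega>. indicator C (Z \<omega>) * W \<omega>)" "integrable M (\<lambda>\<omega>. indicator C (Z \<omega>) :: real)"
    using bound by (auto intro!: integrable_const_bound[of _ 1] simp: indicator_def)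
  have PC: "(\<integral>\<omega>. indicator C (Z \<omega>) \<partial>M) = measure N C"
  proof -
    have "(\<integral>\<omega>. indicator C (Z \<omega>) \<partial>M) = (\<integral>\<omega>. indicator (Z -` C \<inter> space M) \<omega> \<partial>M :: real)"
      by (intro Bochner_Integration.integral_cong) (auto simp: indicator_def)
    then show ?thesis using eq(2) by simp
  qed
  \<comment> \<open>The event has probability \<open>measure N C\<close> under both measures.
    Expanding the density, the contribution of the summand 2 cancels and the claim for
    \<open>W\<close> remains.\<close>
  have "measure N C = (\<integral>\<omega>. indicator (Z -` C \<inter> space M) \<omega> \<partial>M')"
    using eq(1) by (simp add: M'_def)
  also have "\<dots> = (\<integral>\<omega>. ((2 + W \<omega>) / c) *\<^sub>R indicator (Z -` C \<inter> space M) \<omega> \<partial>M)"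
    unfolding M'_def by (subst integral_density) (auto simp: nonneg)
  also have "\<dots> = (\<integral>\<omega>. (2 * indicator C (Z \<omega>) + indicator C (Z \<omega>) * W \<omega>) / c \<partial>M)"
    by (intro Bochner_Integration.integral_cong) (auto simp: indicator_def)
  also have "\<dots> = (2 * measure N C + (\<integral>\<omega>. indicator C (Z \<omega>) * W \<omega> \<partial>M)) / c"
    using int PC by simp
  finally show ?thesis using c by (simp add: c_def field_simps)
qed

text \<open>The density argument requires real weights, so \<open>G\<close> is split into real and
  imaginary part. Both are combinations of \<open>G\<close> and \<open>cnj G\<close>, and the
  identity for \<open>cnj G\<close> comes from conjugating the one for \<open>G\<close> at
  \<open>- s\<close>.\<close>

lemma (in prob_space) expectation_indicator_mult:
  fixes Z :: "'a \<Rightarrow> real" and G :: "'a \<Rightarrow> complex"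
  assumes N: "real_distribution N"
    and Z[measurable]: "Z \<in> borel_measurable M" and G[measurable]: "G \<in> borel_measurable M"
    and bound: "\<And>\<omega>. cmod (G \<omega>) \<le> 1"
    and char_Z: "\<And>s. (\<integral>\<omega>. iexp (s * Z \<omega>) \<partial>M) = char N s"
    and char_G: "\<And>s. (\<integral>\<omega>. iexp (s * Z \<omega>) * G \<omega> \<partial>M) = char N s * (\<integral>\<omega>. G \<omega> \<partial>M)"
    and C[measurable]: "C \<in> sets borel"
  shows "(\<integral>\<omega>. indicator C (Z \<omega>) * G \<omega> \<partial>M) = measure N C * (\<integral>\<omega>. G \<omega> \<partial>M)"
proof -
  interpret N: real_distribution N by fact
  have intG: "integrable M G" using bound by (intro integrable_const_bound[of _ 1]) auto
  have intZG: "integrable M (\<lambda>\<omega>. iexp (s * Z \<omega>) * G \<omega>)" for s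
    using bound by (intro integrable_const_bound[of _ 1]) (auto simp: norm_mult)
  have intCG: "integrable M (\<lambda>\<omega>. indicator C (Z \<omega>) * G \<omega>)"
    using bound by (intro integrable_const_bound[of _ 1]) (auto simp: norm_mult indicator_def)
  have [measurable]: "cnj \<in> borel_measurable borel"
    by (intro borel_measurable_continuous_onI continuous_intros)
  have intZG': "integrable M (\<lambda>\<omega>. iexp (s * Z \<omega>) * cnj (G \<omega>))" for s
    using bound by (intro integrable_const_bound[of _ 1]) (auto simp: norm_mult)
  have char_uminus: "char N (- s) = cnj (char N s)" for s
  proof -
    have "char N (- s) = (\<integral>x. cnj (iexp (s * x)) \<partial>N)"
      unfolding char_def by (simp add: exp_cnj)
    then show ?thesis by (simp only: char_def Bochner_Integration.integral_cnj)
  qed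
  have cnj_G: "(\<integral>\<omega>. iexp (s * Z \<omega>) * cnj (G \<omega>) \<partial>M) = char N s * cnj (\<integral>\<omega>. G \<omega> \<partial>M)" for s
  proof -
    have "(\<integral>\<omega>. iexp (s * Z \<omega>) * cnj (G \<omega>) \<partial>M) = cnj (\<integral>\<omega>. iexp (- s * Z \<omega>) * G \<omega> \<partial>M)"
    proof -
      have "(\<integral>\<omega>. iexp (s * Z \<omega>) * cnj (G \<omega>) \<partial>M) = (\<integral>\<omega>. cnj (iexp (- s * Z \<omega>) * G \<omega>) \<partial>M)"
        by (simp add: exp_cnj)
      then show ?thesis by (simp only: Bochner_Integration.integral_cnj)
    qed
    also have "\<dots> = char N s * cnj (\<integral>\<omega>. G \<omega> \<partial>M)"
      unfolding char_G[of "- s"] by (simp add: char_uminus)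
    finally show ?thesis .
  qed
  have Re: "(\<integral>\<omega>. indicator C (Z \<omega>) * Re (G \<omega>) \<partial>M) = measure N C * (\<integral>\<omega>. Re (G \<omega>) \<partial>M)"
  proof (intro expectation_indicator_mult_real N Z C char_Z)
    fix s
    have "(\<integral>\<omega>. iexp (s * Z \<omega>) * complex_of_real (Re (G \<omega>)) \<partial>M) =
      (\<integral>\<omega>. (iexp (s * Z \<omega>) * G \<omega> + iexp (s * Z \<omega>) * cnj (G \<omega>)) / 2 \<partial>M)"
      by (intro Bochner_Integration.integral_cong refl) (simp add: complex_add_cnj flip: distrib_left)
    also have "\<dots> = (char N s * (\<integral>\<omega>. G \<omega> \<partial>M) + char N s * cnj (\<integral>\<omega>. G \<omega> \<partial>M)) / 2"
      using intZG intZG' char_G[of s] cnj_G[of s] by simp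
    also have "\<dots> = char N s * complex_of_real (Re (\<integral>\<omega>. G \<omega> \<partial>M))"
      by (simp add: complex_add_cnj flip: distrib_left)
    finally show "(\<integral>\<omega>. iexp (s * Z \<omega>) * complex_of_real (Re (G \<omega>)) \<partial>M) =
        char N s * complex_of_real (\<integral>\<omega>. Re (G \<omega>) \<partial>M)"
      using intG by simp
  qed (use bound in \<open>auto intro: order_trans[OF abs_Re_le_cmod]\<close>)
  have im: "(z * g - z * cnj g) / (2 * \<i>) = z * complex_of_real (Im g)" for z g
    by (simp only: right_diff_distrib[symmetric] complex_diff_cnj) (simp add: complex_eq_iff)
  have Im: "(\<integral>\<omega>. indicator C (Z \<omega>) * Im (G \<omega>) \<partial>M) = measure N C * (\<integral>\<omega>. Im (G \<omega>) \<partial>M)"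
  proof (intro expectation_indicator_mult_real N Z C char_Z)
    fix s
    have "(\<integral>\<omega>. iexp (s * Z \<omega>) * complex_of_real (Im (G \<omega>)) \<partial>M) =
      (\<integral>\<omega>. (iexp (s * Z \<omega>) * G \<omega> - iexp (s * Z \<omega>) * cnj (G \<omega>)) / (2 * \<i>) \<partial>M)"
      by (simp only: im)
    also have "\<dots> = (char N s * (\<integral>\<omega>. G \<omega> \<partial>M) - char N s * cnj (\<integral>\<omega>. G \<omega> \<partial>M)) / (2 * \<i>)"
      using intZG intZG' char_G[of s] cnj_G[of s] by simp
    also have "\<dots> = char N s * complex_of_real (Im (\<integral>\<omega>. G \<omega> \<partial>M))"
      by (simp only: im)
    finally show "(\<integral>\<omega>. iexp (s * Z \<omega>) * complex_of_real (Im (G \<omega>)) \<partial>M) =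
        char N s * complex_of_real (\<integral>\<omega>. Im (G \<omega>) \<partial>M)"
      using intG by simp
  qed (use bound in \<open>auto intro: order_trans[OF abs_Im_le_cmod]\<close>)
  have ind: "Re (indicator C x) = indicator C x" "Im (indicator C x) = 0" for x
    by (auto simp: indicator_def)
  show ?thesis
  proof (rule complex_eqI)
    show "Re (\<integral>\<omega>. indicator C (Z \<omega>) * G \<omega> \<partial>M) = Re (measure N C * (\<integral>\<omega>. G \<omega> \<partial>M))"
      using Re intG intCG by (simp add: ind flip: integral_Re)
    show "Im (\<integral>\<omega>. indicator C (Z \<omega>) * G \<omega> \<partial>M) = Im (measure N C * (\<integral>\<omega>. G \<omega> \<partial>M))"
      using Im intG intCG by (simp add: ind flip: integral_Im)
  qed
qed

text \<open>Exponentials are traded for indicators one coordinate at a time.\<close>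

lemma (in prob_space) indep_vars_if_char_factorizes:
  fixes Z :: "nat \<Rightarrow> 'a \<Rightarrow> real"
  assumes N: "real_distribution N" and "p > 0"
    and Z[measurable]: "\<And>j. j < p \<Longrightarrow> Z j \<in> borel_measurable M"
    and char: "\<And>t. (\<integral>\<omega>. (\<Prod>j<p. iexp (t j * Z j \<omega>)) \<partial>M) = (\<Prod>j<p. char N (t j))"
  shows "indep_vars (\<lambda>_. borel) Z {..<p}" and "\<And>j. j < p \<Longrightarrow> distr M borel (Z j) = N"
proof -
  interpret N: real_distribution N by fact
  have marg: "(\<integral>\<omega>. iexp (s * Z k \<omega>) \<partial>M) = char N s" if "k < p" for k s
  proof -
    have "(\<Prod>j<p. iexp ((if j = k then s else 0) * Z j \<omega>)) = iexp (s * Z k \<omega>)" for \<omega>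
      using that by (subst prod.remove[of _ k]) auto
    moreover have "(\<Prod>j<p. char N (if j = k then s else 0)) = char N s"
      using that by (subst prod.remove[of _ k]) (auto simp: N.char_zero)
    ultimately show ?thesis using char[of "\<lambda>j. if j = k then s else 0"] by simp
  qed
  then have "char (distr M borel (Z k)) s = char N s" if "k < p" for k s
    unfolding char_def using that by (subst integral_distr) (auto simp: char_def)
  then show distr: "distr M borel (Z j) = N" if "j < p" for j
    using that by (intro Levy_uniqueness ext real_distribution_distr N) auto
  \<comment> \<open>Hybrid expectation: indicators in the first \<open>k\<close> coordinates,
    exponentials in the others. The vector \<open>t\<close> stays arbitrary because the induction
    step needs all frequencies of coordinate \<open>k\<close>.\<close>
  have step: "(\<integral>\<omega>. (\<Prod>j<k. indicator (C j) (Z j \<omega>)) * (\<Prod>j=k..<p. iexp (t j * Z j \<omega>)) \<partial>M) =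
      (\<Prod>j<k. complex_of_real (measure N (C j))) * (\<Prod>j=k..<p. char N (t j))"
    if C: "\<And>j. C j \<in> sets borel" and k: "k \<le> p" for C t k
    using k
  proof (induction k arbitrary: t)
    case 0
    then show ?case using char by (simp add: lessThan_atLeast0)
  next
    case (Suc k)
    define G where "G \<omega> = (\<Prod>j<k. indicator (C j) (Z j \<omega>)) * (\<Prod>j=Suc k..<p. iexp (t j * Z j \<omega>))" for \<omega>
    define g where "g = (\<Prod>j<k. complex_of_real (measure N (C j))) * (\<Prod>j=Suc k..<p. char N (t j))"
    have split: "{k..<p} = insert k {Suc k..<p}" using Suc.prems by auto
    have IH: "(\<integral>\<omega>. iexp (s * Z k \<omega>) * G \<omega> \<partial>M) = char N s * g" for s
    proof -
      have "(\<Prod>j<k. indicator (C j) (Z j \<omega>)) * (\<Prod>j=k..<p. iexp ((t(k := s)) j * Z j \<omega>))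
          = iexp (s * Z k \<omega>) * G \<omega>" for \<omega>
        unfolding split G_def by simp
      moreover have "(\<Prod>j<k. complex_of_real (measure N (C j))) * (\<Prod>j=k..<p. char N ((t(k := s)) j)) = char N s * g"
        unfolding split g_def by simp
      ultimately show ?thesis using Suc.IH[of "t(k := s)"] Suc.prems by simp
    qed
    \<comment> \<open>At frequency 0 the exponential of coordinate \<open>k\<close> disappears,
      which identifies the mean of \<open>G\<close>.\<close>
    have EG: "(\<integral>\<omega>. G \<omega> \<partial>M) = g" using IH[of 0] by (simp add: N.char_zero)
    have "(\<integral>\<omega>. indicator (C k) (Z k \<omega>) * G \<omega> \<partial>M) = measure N (C k) * (\<integral>\<omega>. G \<omega> \<partial>M)"
    proof (intro expectation_indicator_mult N C)
      show "Z k \<in> borel_measurable M" using Suc.prems by simp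
      show "G \<in> borel_measurable M"
        unfolding G_def using Suc.prems C by (intro borel_measurable_times borel_measurable_prod) auto
      show "cmod (G \<omega>) \<le> 1" for \<omega>
        unfolding G_def norm_mult prod_norm[symmetric]
        by (intro mult_le_one prod_le_1 prod_nonneg) (auto simp: indicator_def)
      show "(\<integral>\<omega>. iexp (s * Z k \<omega>) \<partial>M) = char N s" for s using marg Suc.prems by simp
      show "(\<integral>\<omega>. iexp (s * Z k \<omega>) * G \<omega> \<partial>M) = char N s * (\<integral>\<omega>. G \<omega> \<partial>M)" for s
        using IH EG by simp
    qed
    moreover have eq: "(\<lambda>\<omega>. (\<Prod>j<Suc k. indicator (C j) (Z j \<omega>)) * (\<Prod>j=Suc k..<p. iexp (t j * Z j \<omega>)))
        = (\<lambda>\<omega>. indicator (C k) (Z k \<omega>) * G \<omega>)"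
      unfolding G_def by (simp add: mult_ac)
    ultimately show ?case unfolding eq EG g_def by simp
  qed
  show "indep_vars (\<lambda>_. borel) Z {..<p}"
  proof (subst indep_vars_finite[where E="\<lambda>_. sets borel"])
    show "\<forall>C\<in>{..<p} \<rightarrow> sets borel. prob (\<Inter>j<p. Z j -` C j \<inter> space M) = (\<Prod>j<p. prob (Z j -` C j \<inter> space M))"
    proof
      fix C :: "nat \<Rightarrow> real set" assume C: "C \<in> {..<p} \<rightarrow> sets borel"
      \<comment> \<open>\<open>step\<close> asks for Borel sets at every index, so the family is
        extended by \<open>UNIV\<close> outside the range.\<close>
      define C' where "C' j = (if j < p then C j else UNIV)" for j
      have C': "C' j \<in> sets borel" for j using C by (auto simp: C'_def Pi_iff)
      have "complex_of_real (\<Prod>j<p. measure N (C' j)) = (\<integral>\<omega>. (\<Prod>j<p. indicator (C' j) (Z j \<omega>)) \<partial>M)"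
        using step[of C' p] C' by simp
      also have "\<dots> = (\<integral>\<omega>. complex_of_real (indicator (\<Inter>j<p. Z j -` C j \<inter> space M) \<omega>) \<partial>M)"
        using \<open>p > 0\<close> by (intro Bochner_Integration.integral_cong refl)
          (auto simp: indicator_def C'_def prod_eq_1_iff intro!: prod_zero)
      also have "\<dots> = complex_of_real (prob (\<Inter>j<p. Z j -` C j \<inter> space M))"
      proof -
        have "(\<Inter>j<p. Z j -` C j \<inter> space M) \<inter> space M = (\<Inter>j<p. Z j -` C j \<inter> space M)"
          using \<open>p > 0\<close> by auto
        then show ?thesis by (simp only: integral_complex_of_real Bochner_Integration.integral_indicator)
      qed
      finally have "(\<Prod>j<p. measure N (C' j)) = prob (\<Inter>j<p. Z j -` C j \<inter> space M)"
        by (simp only: of_real_eq_iff)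
      moreover have "prob (Z j -` C j \<inter> space M) = measure N (C' j)" if "j < p" for j
        using measure_distr[OF Z[OF that] C'[of j]] that by (simp add: distr C'_def)
      ultimately show "prob (\<Inter>j<p. Z j -` C j \<inter> space M) = (\<Prod>j<p. prob (Z j -` C j \<inter> space M))"
        by simp
    qed
  qed (use \<open>p > 0\<close> in \<open>auto simp: sets.sigma_sets_eq[of borel, simplified] Int_stable_def\<close>)
qed

text \<open>The combination of the \<open>Z j\<close> with coefficients \<open>t\<close> equals the
  combination of the scaled noise entries with coefficients \<open>mat_vec X {..<p} t\<close>.
  Orthonormal columns preserve the squared norm of \<open>t\<close>, and the Gaussian characteristic
  function depends on that norm only, so it factorises over \<open>j\<close> although
  \<open>X\<close> need not be square.\<close>

lemma (in prob_space) orthogonal_transform_std_normal: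
  assumes orth: "orthogonal_design n p X" and "p > 0" "\<sigma> > 0"
    and noise: "gaussian_noise M n \<sigma> e"
  defines "Z \<equiv> \<lambda>j \<omega>. dotp n (mat_col X j) (e \<omega>) / \<sigma>"
  shows "indep_vars (\<lambda>_. borel) Z {..<p}"
    and "\<And>j. j < p \<Longrightarrow> distr M borel (Z j) = std_normal_distribution"
proof -
  have e: "indep_vars (\<lambda>_. borel) (\<lambda>i \<omega>. e \<omega> i) {..<n}"
    and d: "\<And>i. i < n \<Longrightarrow> distributed M lborel (\<lambda>\<omega>. e \<omega> i) (normal_density 0 \<sigma>)"
    using noise by (auto simp: gaussian_noise_def)
  have [measurable]: "(\<lambda>\<omega>. e \<omega> i) \<in> borel_measurable M" if "i < n" for i
    using d[OF that] by (simp add: distributed_def)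
  have distr_e: "distr M borel (\<lambda>\<omega>. e \<omega> i / \<sigma>) = std_normal_distribution" if "i < n" for i
  proof -
    have "distributed M lborel (\<lambda>\<omega>. e \<omega> i / \<sigma>) std_normal_density"
      using d[OF that] normal_standard_normal_convert[OF \<open>\<sigma> > 0\<close>, of "\<lambda>\<omega>. e \<omega> i" 0] by simp
    then have "distr M lborel (\<lambda>\<omega>. e \<omega> i / \<sigma>) = std_normal_distribution"
      by (simp add: distributed_def)
    then show ?thesis by (metis distr_cong sets_lborel)
  qed
  have [measurable]: "Z j \<in> borel_measurable M" for j
    unfolding Z_def dotp_def by measurable
  have "(\<integral>\<omega>. (\<Prod>j<p. iexp (t j * Z j \<omega>)) \<partial>M) = (\<Prod>j<p. char std_normal_distribution (t j))" for t
  proof -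
    let ?v = "mat_vec X {..<p} t"
    have "(\<Prod>j<p. iexp (t j * Z j \<omega>)) = (\<Prod>i<n. iexp (?v i * (e \<omega> i / \<sigma>)))" for \<omega>
    proof -
      have "(\<Sum>j<p. t j * Z j \<omega>) = dotp n (e \<omega>) ?v / \<sigma>"
        unfolding dotp_mat_vec by (simp add: Z_def sum_divide_distrib mult.commute)
      also have "\<dots> = (\<Sum>i<n. ?v i * (e \<omega> i / \<sigma>))"
        by (simp add: dotp_def sum_divide_distrib mult.commute)
      finally have "iexp (\<Sum>j<p. t j * Z j \<omega>) = iexp (\<Sum>i<n. ?v i * (e \<omega> i / \<sigma>))" by simp
      then show ?thesis by (simp add: exp_sum sum_distrib_left)
    qed
    then have "(\<integral>\<omega>. (\<Prod>j<p. iexp (t j * Z j \<omega>)) \<partial>M) = (\<integral>\<omega>. (\<Prod>i<n. iexp (?v i * (e \<omega> i / \<sigma>))) \<partial>M)"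
      by simp
    also have "\<dots> = (\<Prod>i<n. \<integral>\<omega>. iexp (?v i * (e \<omega> i / \<sigma>)) \<partial>M)"
    proof (intro indep_vars_lebesgue_integral)
      show "indep_vars (\<lambda>_. borel) (\<lambda>i \<omega>. iexp (?v i * (e \<omega> i / \<sigma>))) {..<n}"
        by (rule indep_vars_compose2[OF e, where Y="\<lambda>i x. iexp (?v i * (x / \<sigma>))"]) measurable
      show "integrable M (\<lambda>\<omega>. iexp (?v i * (e \<omega> i / \<sigma>)))" if "i \<in> {..<n}" for i
        using that by (intro integrable_const_bound[of _ 1]) auto
    qed simp
    also have "\<dots> = (\<Prod>i<n. char std_normal_distribution (?v i))"
    proof (intro prod.cong refl)
      fix i assume "i \<in> {..<n}"
      then have i: "i < n" by simp
      have [measurable]: "(\<lambda>\<omega>. e \<omega> i / \<sigma>) \<in> borel_measurable M" using i by measurable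
      show "(\<integral>\<omega>. iexp (?v i * (e \<omega> i / \<sigma>)) \<partial>M) = char std_normal_distribution (?v i)"
        unfolding distr_e[OF i, symmetric] char_def by (subst integral_distr) auto
    qed
    also have "\<dots> = complex_of_real (exp (\<Sum>i<n. - (?v i)\<^sup>2 / 2))"
      by (simp add: char_std_normal_distribution exp_sum flip: of_real_prod)
    also have "(\<Sum>i<n. - (?v i)\<^sup>2 / 2) = (\<Sum>j<p. - (t j)\<^sup>2 / 2)"
      using sum_mat_vec_squared[OF orth order_refl, of t]
      by (simp add: sum_negf flip: sum_divide_distrib)
    also have "complex_of_real (exp (\<Sum>j<p. - (t j)\<^sup>2 / 2)) = (\<Prod>j<p. char std_normal_distribution (t j))"
      by (simp add: char_std_normal_distribution exp_sum flip: of_real_prod)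
    finally show ?thesis .
  qed
  from indep_vars_if_char_factorizes[OF real_dist_normal_dist \<open>p > 0\<close> _ this]
  show "indep_vars (\<lambda>_. borel) Z {..<p}" "\<And>j. j < p \<Longrightarrow> distr M borel (Z j) = std_normal_distribution"
    by auto
qed

section \<open>Mills' ratio and the cumulative hazard of a half-normal variable\<close>

definition normal_tail :: "real \<Rightarrow> real" where
  "normal_tail x = measure std_normal_distribution {z. \<bar>z\<bar> > x}"

text \<open>For \<open>x \<ge> 0\<close> this is the probability that a standard normal variable
  lies between 0 and \<open>x\<close>; the distribution function of its absolute value is twice
  this.\<close>

definition half_normal_cdf :: "real \<Rightarrow> real" where
  "half_normal_cdf x = integral {0..x} std_normal_density"

lemma continuous_on_std_normal_density: "continuous_on S std_normal_density"
  unfolding normal_density_def by (intro continuous_intros) auto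

lemma normal_tail_eq:
  assumes "x \<ge> 0"
  shows "normal_tail x = 1 - 2 * half_normal_cdf x"
proof -
  interpret N: real_distribution std_normal_distribution by (rule real_dist_normal_dist)
  have int: "std_normal_density integrable_on {a..b}" for a b
    by (intro integrable_continuous_interval continuous_on_std_normal_density)
  have "integral {- x..x} std_normal_density = integral {- x..0} std_normal_density + half_normal_cdf x"
    unfolding half_normal_cdf_def using assms int
    by (intro Henstock_Kurzweil_Integration.integral_combine[symmetric]) auto
  also have "integral {- x..0} std_normal_density = half_normal_cdf x"
  proof -
    have "std_normal_density (- z) = std_normal_density z" for z by (simp add: normal_density_def)
    then show ?thesis
      using Henstock_Kurzweil_Integration.integral_reflect_real[of x 0 std_normal_density]
      by (simp add: half_normal_cdf_def)
  qed
  finally have I: "(std_normal_density has_integral 2 * half_normal_cdf x) {- x..x}"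
    using int[of "- x" x] by (simp add: has_integral_integral)
  have "emeasure std_normal_distribution {- x..x} = (\<integral>\<^sup>+z. ennreal (indicator {- x..x} z * std_normal_density z) \<partial>lborel)"
    by (subst emeasure_density) (auto intro!: nn_integral_cong simp: indicator_def)
  also have "\<dots> = ennreal (2 * half_normal_cdf x)"
  proof (rule nn_integral_has_integral_lborel)
    have "(\<lambda>z. indicator {- x..x} z * std_normal_density z) = (\<lambda>z. if z \<in> {- x..x} then std_normal_density z else 0)"
      by (auto simp: indicator_def)
    then show "((\<lambda>z. indicator {- x..x} z * std_normal_density z) has_integral 2 * half_normal_cdf x) UNIV"
      using I by (simp only: has_integral_restrict_UNIV)
  qed auto
  finally have "measure std_normal_distribution {- x..x} = 2 * half_normal_cdf x"
    using has_integral_nonneg[OF I] by (simp add: measure_def)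
  moreover have "{z. \<bar>z\<bar> > x} = space std_normal_distribution - {- x..x}" by auto
  ultimately show ?thesis
    unfolding normal_tail_def using N.prob_compl[of "{- x..x}"] by simp
qed

lemma half_normal_cdf_DERIV:
  assumes "x > 0"
  shows "(half_normal_cdf has_real_derivative std_normal_density x) (at x)"
proof -
  have "((\<lambda>x. integral {0..x} std_normal_density) has_real_derivative std_normal_density x) (at x within {0..x + 1})"
    using assms by (intro integral_has_real_derivative continuous_on_std_normal_density) auto
  then show ?thesis
    using assms by (simp add: half_normal_cdf_def[abs_def] at_within_Icc_at)
qed

lemma normal_tail_DERIV:
  assumes "x > 0"
  shows "(normal_tail has_real_derivative - 2 * std_normal_density x) (at x)"
proof (rule has_field_derivative_transform_within_open)
  show "((\<lambda>x. 1 - 2 * half_normal_cdf x) has_real_derivative - 2 * std_normal_density x) (at x)"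
    using assms by (auto intro!: derivative_eq_intros half_normal_cdf_DERIV)
  show "open {0::real<..}" "x \<in> {0<..}" using assms by auto
qed (auto simp: normal_tail_eq)

lemma continuous_on_normal_tail: "continuous_on {0..} normal_tail"
proof -
  have "continuous_on {0..c} half_normal_cdf" for c
    unfolding half_normal_cdf_def
    by (intro indefinite_integral_continuous_1 integrable_continuous_interval continuous_on_std_normal_density)
  then have "continuous_on {0..c} (\<lambda>x. 1 - 2 * half_normal_cdf x)" for c
    by (intro continuous_intros)
  then have "continuous_on {0..c} normal_tail" for c
    by (subst continuous_on_cong[OF refl normal_tail_eq]) auto
  then show ?thesis
    unfolding continuous_on_eq_continuous_within
  proof (intro ballI)
    fix x :: real assume *: "\<And>c. \<forall>x\<in>{0..c}. continuous (at x within {0..c}) normal_tail" and "x \<in> {0..}"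
    have "continuous (at x within {0..x + 1}) normal_tail" using * \<open>x \<in> {0..}\<close> by auto
    \<comment> \<open>Near \<open>x\<close> the sets \<open>{0..x + 1}\<close> and
      \<open>{0..}\<close> coincide, so continuity on bounded intervals is enough.\<close>
    moreover have "at x within {0..x + 1} = at x within {0..}"
      by (rule at_within_nhd[of _ "{x - 1<..<x + 1}"]) auto
    ultimately show "continuous (at x within {0..}) normal_tail" by simp
  qed
qed

lemma normal_tail_0: "normal_tail 0 = 1"
  by (simp add: normal_tail_eq half_normal_cdf_def)

lemma normal_tail_strict_antimono:
  assumes "0 \<le> a" "a < b"
  shows "normal_tail b < normal_tail a"
proof -
  have "continuous_on {a..b} normal_tail"
    using assms by (intro continuous_on_subset[OF continuous_on_normal_tail]) auto
  moreover have "\<exists>y. (normal_tail has_real_derivative y) (at x) \<and> y < 0" if "a < x" "x < b" for x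
    using that assms normal_tail_DERIV[of x] normal_density_pos[of 1 0 x] by (intro exI conjI) auto
  ultimately show ?thesis using DERIV_neg_imp_decreasing_open[OF assms(2)] by blast
qed

lemma normal_tail_tendsto_0: "(normal_tail \<longlongrightarrow> 0) at_top"
proof -
  interpret N: real_distribution std_normal_distribution by (rule real_dist_normal_dist)
  let ?F = "cdf std_normal_distribution"
  have "((\<lambda>x. 1 - ?F x + ?F (- x)) \<longlongrightarrow> 1 - 1 + 0) at_top"
    by (intro tendsto_intros N.cdf_lim_at_top_prob filterlim_compose[OF N.cdf_lim_at_bot filterlim_uminus_at_bot_at_top])
  then have "((\<lambda>x. 1 - ?F x + ?F (- x)) \<longlongrightarrow> 0) at_top" by simp
  moreover have "normal_tail x \<le> 1 - ?F x + ?F (- x)" for x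
  proof -
    have "normal_tail x \<le> measure std_normal_distribution ({x<..} \<union> {..- x})"
      unfolding normal_tail_def by (intro N.finite_measure_mono) auto
    also have "\<dots> \<le> measure std_normal_distribution {x<..} + ?F (- x)"
      unfolding cdf_def by (intro measure_Un_le) auto
    also have "measure std_normal_distribution {x<..} = 1 - ?F x"
      using N.prob_compl[of "{..x}"] by (simp add: cdf_def Compl_eq_Diff_UNIV[symmetric])
    finally show ?thesis by simp
  qed
  ultimately show ?thesis
    by (intro tendsto_sandwich[of "\<lambda>_. 0" normal_tail at_top "\<lambda>x. 1 - ?F x + ?F (- x)" 0])
      (auto simp: normal_tail_def)
qed

lemma normal_tail_pos:
  assumes "x \<ge> 0"
  shows "normal_tail x > 0"
proof -
  have "normal_tail (x + 1) < normal_tail x" using assms by (intro normal_tail_strict_antimono) auto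
  then show ?thesis using measure_nonneg[of std_normal_distribution] unfolding normal_tail_def
    by (meson le_less_trans)
qed

section \<open>Mills' ratio: two-sided bounds for the normal tail\<close>

lemma std_normal_density_DERIV:
  "(std_normal_density has_real_derivative - x * std_normal_density x) (at x)"
proof -
  have eq: "std_normal_density = (\<lambda>x. 1 / sqrt (2 * pi) * exp (- x\<^sup>2 / 2))"
    by (auto simp: normal_density_def)
  show ?thesis unfolding eq by (rule derivative_eq_intros refl | simp)+
qed

lemma std_normal_density_tendsto_0: "(std_normal_density \<longlongrightarrow> 0) at_top"
  unfolding normal_density_def by real_asymp

text \<open>The bound minus the tail has the negative derivative
  \<open>- 2 * std_normal_density z / z\<^sup>2\<close> and tends to 0 at infinity, so it decreases
  to 0 and is positive.\<close>

lemma mills_upper: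
  assumes "x > 0"
  shows "normal_tail x < 2 * std_normal_density x / x"
proof -
  have "0 < 2 * std_normal_density x / x - normal_tail x"
  proof (rule DERIV_neg_imp_decreasing_at_top[where f="\<lambda>x. 2 * std_normal_density x / x - normal_tail x"])
    show "\<exists>y. ((\<lambda>x. 2 * std_normal_density x / x - normal_tail x) has_real_derivative y) (at z) \<and> y < 0" if "z \<ge> x" for z
    proof (intro exI conjI)
      show "((\<lambda>x. 2 * std_normal_density x / x - normal_tail x) has_real_derivative
          - 2 * std_normal_density z / z\<^sup>2) (at z)"
        using that assms
        by (auto intro!: derivative_eq_intros std_normal_density_DERIV normal_tail_DERIV simp: field_simps power2_eq_square)
      show "- 2 * std_normal_density z / z\<^sup>2 < 0"
        using that assms normal_density_pos[of 1 0 z] by (auto simp: field_simps)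
    qed
    have "((\<lambda>x. 2 * std_normal_density x * inverse x - normal_tail x) \<longlongrightarrow> 2 * 0 * 0 - 0) at_top"
      by (intro tendsto_intros std_normal_density_tendsto_0 normal_tail_tendsto_0 tendsto_inverse_0_at_top filterlim_ident)
    then show "((\<lambda>x. 2 * std_normal_density x / x - normal_tail x) \<longlongrightarrow> 0) at_top"
      by (simp add: divide_inverse)
  qed
  then show ?thesis by simp
qed

text \<open>The same monotonicity argument, now for the tail minus the bound. The factor
  \<open>x / (1 + x\<^sup>2)\<close> makes the derivative collapse to the single negative term
  \<open>- 4 * std_normal_density x / (1 + x\<^sup>2)\<^sup>2\<close>.\<close>

lemma mills_lower:
  assumes "x > 0"
  shows "2 * std_normal_density x * x / (1 + x\<^sup>2) < normal_tail x"
proof -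
  have "0 < normal_tail x - 2 * std_normal_density x * (x / (1 + x\<^sup>2))"
  proof (rule DERIV_neg_imp_decreasing_at_top[where f="\<lambda>x. normal_tail x - 2 * std_normal_density x * (x / (1 + x\<^sup>2))"])
    show "\<exists>y. ((\<lambda>x. normal_tail x - 2 * std_normal_density x * (x / (1 + x\<^sup>2))) has_real_derivative y) (at z) \<and> y < 0" if "z \<ge> x" for z
    proof (intro exI conjI)
      have nz: "1 + z\<^sup>2 \<noteq> 0" by (metis add_pos_nonneg less_irrefl zero_le_power2 zero_less_one)
      show "((\<lambda>x. normal_tail x - 2 * std_normal_density x * (x / (1 + x\<^sup>2))) has_real_derivative
          - 4 * std_normal_density z / (1 + z\<^sup>2)\<^sup>2) (at z)"
      proof (rule DERIV_cong)
        show "((\<lambda>x. normal_tail x - 2 * std_normal_density x * (x / (1 + x\<^sup>2))) has_real_derivative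
          - 2 * std_normal_density z - (2 * (- z * std_normal_density z) * (z / (1 + z\<^sup>2)) +
            (1 * (1 + z\<^sup>2) - z * (2 * z)) / ((1 + z\<^sup>2) * (1 + z\<^sup>2)) * (2 * std_normal_density z))) (at z)"
          using that assms nz
          by (intro DERIV_diff DERIV_mult DERIV_cmult DERIV_divide normal_tail_DERIV std_normal_density_DERIV)
             (auto intro!: derivative_eq_intros)
        \<comment> \<open>In terms of \<open>w\<close> the identity is rational and linear in the
          density, and \<open>z\<close> enters only through \<open>z * z = w - 1\<close>.\<close>
        define w where "w = 1 + z\<^sup>2"
        have z: "z * z = w - 1" by (simp add: w_def power2_eq_square)
        have "- 2 * f - (2 * (- z * f) * (z / w) + (1 * w - z * (2 * z)) / (w * w) * (2 * f)) = - 4 * f / (w * w)"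
          if "w \<noteq> 0" for f :: real
        proof -
          have e1: "2 * (- z * f) * (z / w) = - 2 * f * (w - 1) / w" unfolding z[symmetric] by simp
          have e2: "1 * w - z * (2 * z) = 2 - w" using z by simp
          show ?thesis unfolding e1 e2 using that by (simp add: field_simps)
        qed
        then show "- 2 * std_normal_density z - (2 * (- z * std_normal_density z) * (z / (1 + z\<^sup>2)) +
            (1 * (1 + z\<^sup>2) - z * (2 * z)) / ((1 + z\<^sup>2) * (1 + z\<^sup>2)) * (2 * std_normal_density z)) =
            - 4 * std_normal_density z / (1 + z\<^sup>2)\<^sup>2"
          using nz unfolding w_def[symmetric] power2_eq_square[of w] by blast
      qed
      show "- 4 * std_normal_density z / (1 + z\<^sup>2)\<^sup>2 < 0"
        using that assms normal_density_pos[of 1 0 z] nz by (auto simp: divide_neg_pos)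
    qed
    have "((\<lambda>x::real. x / (1 + x\<^sup>2)) \<longlongrightarrow> 0) at_top" by real_asymp
    then have "((\<lambda>x. normal_tail x - 2 * std_normal_density x * (x / (1 + x\<^sup>2))) \<longlongrightarrow> 0 - 2 * 0 * 0) at_top"
      by (intro tendsto_intros std_normal_density_tendsto_0 normal_tail_tendsto_0)
    then show "((\<lambda>x. normal_tail x - 2 * std_normal_density x * (x / (1 + x\<^sup>2))) \<longlongrightarrow> 0) at_top"
      by simp
  qed
  then show ?thesis by simp
qed

section \<open>The cumulative hazard and its exponential law\<close>

definition cum_hazard :: "real \<Rightarrow> real" where
  "cum_hazard x = - ln (normal_tail x)"

lemma cum_hazard_strict_mono: "strict_mono_on {0..} cum_hazard"
proof (rule strict_mono_onI)
  fix a b :: real assume "a \<in> {0..}" "b \<in> {0..}" "a < b"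
  then show "cum_hazard a < cum_hazard b"
    using normal_tail_strict_antimono[of a b] normal_tail_pos[of a] normal_tail_pos[of b]
    by (simp add: cum_hazard_def)
qed

text \<open>Mean value theorem: the derivative at an intermediate \<open>z\<close> is the hazard
  rate, which Mills' ratio places between \<open>z\<close> and \<open>z + 1 / z\<close>; these are
  then bounded by \<open>a\<close> and \<open>b + 1 / a\<close>.\<close>

lemma cum_hazard_diff_bounds:
  assumes "0 < a" "a < b"
  shows "a * (b - a) \<le> cum_hazard b - cum_hazard a"
    and "cum_hazard b - cum_hazard a \<le> (b + 1 / a) * (b - a)"
proof -
  have "\<exists>z>a. z < b \<and> cum_hazard b - cum_hazard a = (b - a) * (2 * std_normal_density z / normal_tail z)"
  proof (rule MVT2[OF assms(2)])
    fix z assume "a \<le> z" "z \<le> b"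
    then have z: "z > 0" "normal_tail z > 0" using assms normal_tail_pos[of z] by auto
    show "(cum_hazard has_real_derivative 2 * std_normal_density z / normal_tail z) (at z)"
      unfolding cum_hazard_def[abs_def] using z
      by (auto intro!: derivative_eq_intros normal_tail_DERIV)
  qed
  then obtain z where z: "a < z" "z < b"
    and eq: "cum_hazard b - cum_hazard a = (b - a) * (2 * std_normal_density z / normal_tail z)" by auto
  have pos: "normal_tail z > 0" using normal_tail_pos[of z] z assms by simp
  have "z \<le> 2 * std_normal_density z / normal_tail z"
    using mills_upper[of z] pos z assms by (simp add: field_simps)
  then have lower: "a \<le> 2 * std_normal_density z / normal_tail z" using z by simp
  have nz: "1 + z\<^sup>2 > 0" by (metis add_pos_nonneg zero_le_power2 zero_less_one)
  have "2 * std_normal_density z * z \<le> normal_tail z * (1 + z\<^sup>2)"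
    using mills_lower[of z] nz z assms by (simp add: field_simps)
  then have "2 * std_normal_density z / normal_tail z \<le> (1 + z\<^sup>2) / z"
    using pos z assms by (simp add: field_simps)
  also have "(1 + z\<^sup>2) / z = z + 1 / z" using z assms by (simp add: field_simps power2_eq_square)
  also have "\<dots> \<le> b + 1 / a" using z assms by (intro add_mono frac_le) auto
  finally have upper: "2 * std_normal_density z / normal_tail z \<le> b + 1 / a" .
  show "a * (b - a) \<le> cum_hazard b - cum_hazard a"
    using mult_left_mono[OF lower, of "b - a"] assms unfolding eq by (simp add: mult.commute)
  show "cum_hazard b - cum_hazard a \<le> (b + 1 / a) * (b - a)"
    using mult_left_mono[OF upper, of "b - a"] assms unfolding eq by (simp add: mult.commute)
qed

text \<open>With \<open>w = b - a\<close> the product \<open>b * (b - a)\<close> is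
  \<open>a * w + w\<^sup>2\<close>, while the hazard bounds put \<open>D\<close> between
  \<open>a * w\<close> and \<open>a * w + w\<^sup>2 + w / a\<close>. So the product exceeds
  \<open>D\<close> by at most \<open>w\<^sup>2\<close> and falls short by at most
  \<open>w / a\<close>; \<open>w \<le> D / a\<close> turns these into
  \<open>D\<^sup>2 / a\<^sup>2\<close> and \<open>D / a\<^sup>2\<close>.\<close>

lemma spacing_approx:
  assumes "0 < a" "a < b"
  defines "D \<equiv> cum_hazard b - cum_hazard a"
  shows "\<bar>b * (b - a) - D\<bar> \<le> (D + D\<^sup>2) / a\<^sup>2"
proof -
  define w where "w = b - a"
  have b: "b = a + w" and w: "w > 0" using assms by (auto simp: w_def)
  have lo: "a * w \<le> D" and up: "D \<le> (a + w + 1 / a) * w"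
    using cum_hazard_diff_bounds[OF assms(1,2)] by (auto simp: D_def w_def)
  have D: "D \<ge> 0" using lo assms w by (meson less_imp_le mult_nonneg_nonneg order_trans)
  have w_le: "w \<le> D / a" using lo assms by (simp add: field_simps)
  have "w\<^sup>2 \<le> (D / a)\<^sup>2" using w_le w by (intro power_mono) auto
  then have "w\<^sup>2 \<le> D\<^sup>2 / a\<^sup>2" by (simp add: power_divide)
  moreover have "w / a \<le> D / a\<^sup>2" using w_le assms by (simp add: field_simps power2_eq_square)
  moreover have "0 \<le> D / a\<^sup>2" "0 \<le> D\<^sup>2 / a\<^sup>2" using D by auto
  moreover have "b * (b - a) = a * w + w\<^sup>2" unfolding b by (simp add: algebra_simps power2_eq_square)
  moreover have "(a + w + 1 / a) * w = a * w + w\<^sup>2 + w / a" using assms by (simp add: field_simps power2_eq_square)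
  ultimately show ?thesis using lo up unfolding abs_le_iff add_divide_distrib by linarith
qed

lemma normal_tail_surj:
  assumes "t \<ge> 0"
  shows "\<exists>c\<ge>0. normal_tail c = exp (- t)"
proof -
  have "\<forall>\<^sub>F x in at_top. normal_tail x < exp (- t)"
    using order_tendstoD(2)[OF normal_tail_tendsto_0, of "exp (- t)"] by simp
  then have "\<forall>\<^sub>F x in at_top. normal_tail x < exp (- t) \<and> x \<ge> 0"
    by (intro eventually_conj eventually_ge_at_top)
  then obtain x where x: "normal_tail x < exp (- t)" "x \<ge> 0"
    using eventually_happens by fastforce
  have "\<exists>c\<ge>0. c \<le> x \<and> normal_tail c = exp (- t)"
    using x assms by (intro IVT2' continuous_on_subset[OF continuous_on_normal_tail]) (auto simp: normal_tail_0)
  then show ?thesis by auto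
qed

text \<open>Probability integral transform: the hazard exceeds \<open>t\<close> exactly when
  \<open>\<bar>Z \<omega>\<bar>\<close> exceeds the quantile \<open>c\<close> with tail
  \<open>exp (- t)\<close>.\<close>

lemma (in prob_space) distributed_cum_hazard:
  assumes [measurable]: "Z \<in> borel_measurable M" and Z: "distr M borel Z = std_normal_distribution"
  shows "distributed M lborel (\<lambda>\<omega>. cum_hazard \<bar>Z \<omega>\<bar>) (exponential_density 1)"
proof (subst exponential_distributed_iff, simp, intro conjI allI impI)
  \<comment> \<open>Continuity of the tail was proved on \<open>{0..}\<close>, where
    \<open>\<bar>Z \<omega>\<bar>\<close> takes its values, so measurability is stated for the
    restricted space.\<close>
  have [measurable]: "cum_hazard \<in> borel_measurable (restrict_space borel {0..})"
    unfolding cum_hazard_def[abs_def]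
    by (intro borel_measurable_uminus borel_measurable_ln borel_measurable_continuous_on_restrict continuous_on_normal_tail)
  show "(\<lambda>\<omega>. cum_hazard \<bar>Z \<omega>\<bar>) \<in> borel_measurable M"
    by (rule measurable_compose[where N="restrict_space borel {0..}"]) (auto intro!: measurable_restrict_space2)
  fix t :: real assume t: "0 \<le> t"
  then obtain c where c: "c \<ge> 0" "normal_tail c = exp (- t)" using normal_tail_surj by auto
  have iff: "cum_hazard \<bar>z\<bar> \<le> t \<longleftrightarrow> \<not> \<bar>z\<bar> > c" for z
  proof -
    have "t = cum_hazard c" using c by (simp add: cum_hazard_def)
    moreover have "cum_hazard \<bar>z\<bar> > cum_hazard c \<longleftrightarrow> \<bar>z\<bar> > c"
      using strict_mono_on_less[OF cum_hazard_strict_mono, of c "\<bar>z\<bar>"] c by simp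
    ultimately show ?thesis by auto
  qed
  have "\<P>(\<omega> in M. cum_hazard \<bar>Z \<omega>\<bar> \<le> t) = 1 - \<P>(\<omega> in M. \<bar>Z \<omega>\<bar> > c)"
    unfolding iff by (rule prob_neg) measurable
  also have "\<P>(\<omega> in M. \<bar>Z \<omega>\<bar> > c) = measure (distr M borel Z) {z. \<bar>z\<bar> > c}"
    by (subst measure_distr) (auto intro!: arg_cong[where f=prob])
  finally show "\<P>(\<omega> in M. cum_hazard \<bar>Z \<omega>\<bar> \<le> t) = 1 - exp (- t * 1)"
    unfolding Z using c by (simp add: normal_tail_def)
qed

section \<open>Spacings of exponential order statistics\<close>

text \<open>The thresholds form a list with the top gap first, so that deleting the largest value of
  \<open>x\<close> corresponds to dropping the head.\<close>

definition gaps_exceed :: "'i set \<Rightarrow> real list \<Rightarrow> ('i \<Rightarrow> real) \<Rightarrow> bool" where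
  "gaps_exceed S ts x \<longleftrightarrow>
     (\<forall>l<length ts. kth_largest S x (Suc l) - kth_largest S x (Suc (Suc l)) > ts ! l)"

lemma gaps_exceed_cong:
  assumes "\<And>j. j \<in> S \<Longrightarrow> x j = z j"
  shows "gaps_exceed S ts x = gaps_exceed S ts z"
proof -
  have "kth_largest S x k = kth_largest S z k" for k by (rule kth_largest_cong) (rule assms)
  then show ?thesis unfolding gaps_exceed_def by (simp only:)
qed

lemma kth_largest_1_ge:
  assumes "finite S" "j \<in> S"
  shows "u j \<le> kth_largest S u 1"
proof -
  have "card S \<ge> 1" using assms by (metis One_nat_def Suc_leI card_gt_0_iff empty_iff)
  then have "\<not> 1 \<le> card {j\<in>S. u j > kth_largest S u 1}"
    using kth_largest_greater_iff[of S 1 "kth_largest S u 1" u] assms by simp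
  then have "card {j\<in>S. u j > kth_largest S u 1} = 0" by simp
  then have "{j\<in>S. u j > kth_largest S u 1} = {}" using assms(1) by simp
  then show ?thesis using assms(2) by (auto simp: not_less)
qed

lemma gaps_exceed_Cons_argmax:
  assumes "finite S" "j \<in> S" "\<And>i. i \<in> S \<Longrightarrow> x i \<le> x j" "Suc (length ts) < card S"
  shows "gaps_exceed S (t # ts) x \<longleftrightarrow> x j > kth_largest (S - {j}) x 1 + t \<and> gaps_exceed (S - {j}) ts x"
proof -
  note rem = kth_largest_remove_argmax[of S j x, OF assms(1-3)]
  have shift: "kth_largest S x (Suc k) = kth_largest (S - {j}) x k" if "1 \<le> k" "k \<le> Suc (length ts)" for k
    using rem(2)[of k] that assms(4) by simp
  have "gaps_exceed S (t # ts) x \<longleftrightarrow> kth_largest S x 1 - kth_largest S x (Suc 1) > t \<and>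
      (\<forall>l<length ts. kth_largest S x (Suc (Suc l)) - kth_largest S x (Suc (Suc (Suc l))) > ts ! l)"
    unfolding gaps_exceed_def by (simp add: All_less_Suc2)
  also have "\<dots> \<longleftrightarrow> x j - kth_largest (S - {j}) x 1 > t \<and> gaps_exceed (S - {j}) ts x"
    unfolding gaps_exceed_def using rem(1) shift by simp
  finally show ?thesis by (simp add: algebra_simps)
qed

text \<open>At most one index contributes to the sum, namely the one carrying the maximum.\<close>

lemma gaps_exceed_Cons_sum:
  fixes g :: "real \<Rightarrow> ennreal"
  assumes "finite S" "Suc (length ts) < card S" "t \<ge> 0"
  shows "g (kth_largest S x 1) * of_bool (gaps_exceed S (t # ts) x) =
    (\<Sum>j\<in>S. g (x j) * of_bool (x j > kth_largest (S - {j}) x 1 + t) * of_bool (gaps_exceed (S - {j}) ts x))"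
proof -
  have "S \<noteq> {}" using assms by auto
  then obtain j where j: "j \<in> S" "\<And>i. i \<in> S \<Longrightarrow> x i \<le> x j"
    using ex_argmax[OF assms(1)] by metis
  \<comment> \<open>Any other index \<open>i\<close> has \<open>j\<close> among its competitors, and
    \<open>x j\<close> is at least \<open>x i\<close>; as \<open>t \<ge> 0\<close>, it cannot lead
    by more than \<open>t\<close>.\<close>
  have zero: "\<not> x i > kth_largest (S - {i}) x 1 + t" if "i \<in> S - {j}" for i
    using kth_largest_1_ge[of "S - {i}" j x] j(2)[of i] j(1) that assms by auto
  have "(\<Sum>j\<in>S. g (x j) * of_bool (x j > kth_largest (S - {j}) x 1 + t) * of_bool (gaps_exceed (S - {j}) ts x))
    = g (x j) * of_bool (x j > kth_largest (S - {j}) x 1 + t) * of_bool (gaps_exceed (S - {j}) ts x)"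
    using assms(1) j(1) zero by (subst sum.remove[of _ j]) (auto intro!: sum.neutral)
  also have "\<dots> = g (kth_largest S x 1) * of_bool (gaps_exceed S (t # ts) x)"
    using gaps_exceed_Cons_argmax[of S j x ts t, OF assms(1) j assms(2)] kth_largest_remove_argmax(1)[of S j x, OF assms(1) j]
    by (simp add: of_bool_def)
  finally show ?thesis by simp
qed

lemma gaps_exceed_replicate_0:
  assumes "finite S" "inj_on x S" "d < card S"
  shows "gaps_exceed S (replicate d 0) x"
  using assms
proof (induction d arbitrary: S)
  case 0
  then show ?case by (simp add: gaps_exceed_def)
next
  case (Suc d)
  then have "S \<noteq> {}" by auto
  then obtain j where j: "j \<in> S" "\<And>i. i \<in> S \<Longrightarrow> x i \<le> x j"
    using ex_argmax[OF Suc.prems(1)] by metis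
  have "gaps_exceed (S - {j}) (replicate d 0) x"
    using Suc.prems j by (intro Suc.IH) (auto intro: inj_on_diff)
  moreover have "\<exists>i\<in>S - {j}. kth_largest (S - {j}) x 1 = x i"
    using Suc.prems j by (intro kth_largest_mem) auto
  then obtain i where i: "i \<in> S - {j}" "kth_largest (S - {j}) x 1 = x i" by blast
  have "x i \<noteq> x j" using i j Suc.prems(2) by (auto dest: inj_onD)
  then have "x j > kth_largest (S - {j}) x 1" using i j by (simp add: order_less_le)
  ultimately show ?case
    using gaps_exceed_Cons_argmax[of S j x "replicate d 0" 0, OF Suc.prems(1) j] Suc.prems by simp
qed

section \<open>Integrals over independent exponential variables\<close>

abbreviation exp_law :: "real measure" where
  "exp_law \<equiv> density lborel (exponential_density 1)"

lemma prob_space_exp_law: "prob_space exp_law"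
  by (rule prob_space_exponential_density) simp

lemma AE_exp_law_nonneg: "AE y in exp_law. y \<ge> 0"
  by (subst AE_density) (auto simp: exponential_density_def)

text \<open>Integrating out a variable forced above \<open>c\<close> raises the exponent of the
  weight from \<open>i\<close> to \<open>Suc i\<close>. Repeated for each deleted maximum, this is
  where the rates 1, 2, 3 and so on of the spacings come from.\<close>

lemma nn_integral_exp_law_tail:
  assumes "c \<ge> 0"
  shows "(\<integral>\<^sup>+y. ennreal (exp (- real i * y)) * of_bool (y > c) \<partial>exp_law) = ennreal (exp (- real (Suc i) * c) / real (Suc i))"
proof -
  have "(\<integral>\<^sup>+y. ennreal (exp (- real i * y)) * of_bool (y > c) \<partial>exp_law) =
    (\<integral>\<^sup>+y. ennreal (exponential_density 1 y) * (ennreal (exp (- real i * y)) * of_bool (y > c)) \<partial>lborel)"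
    by (subst nn_integral_density) auto
  also have "\<dots> = (\<integral>\<^sup>+y. ennreal (exp (- real (Suc i) * y)) * indicator {c..} y \<partial>lborel)"
  proof (rule nn_integral_cong_AE)
    show "AE y in lborel. ennreal (exponential_density 1 y) * (ennreal (exp (- real i * y)) * of_bool (y > c)) =
      ennreal (exp (- real (Suc i) * y)) * indicator {c..} y"
      using AE_lborel_singleton[of c]
      by eventually_elim (use assms in \<open>auto simp: exponential_density_def indicator_def algebra_simps
          simp flip: ennreal_mult exp_add\<close>)
  qed
  also have "\<dots> = ennreal (0 - (- exp (- real (Suc i) * c) / real (Suc i)))"
  proof (rule nn_integral_FTC_atLeast)
    show "((\<lambda>y. - exp (- real (Suc i) * y) / real (Suc i)) \<longlongrightarrow> 0) at_top"
    proof -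
      have "filterlim (\<lambda>y. real (Suc i) * y) at_top at_top"
        by (rule filterlim_tendsto_pos_mult_at_top[OF tendsto_const _ filterlim_ident]) simp
      then have "((\<lambda>y. exp (- (real (Suc i) * y))) \<longlongrightarrow> 0) at_top"
        by (intro filterlim_compose[OF exp_at_bot] filterlim_compose[OF filterlim_uminus_at_bot_at_top])
      then have "((\<lambda>y. - exp (- (real (Suc i) * y)) / real (Suc i)) \<longlongrightarrow> - 0 / real (Suc i)) at_top"
        by (intro tendsto_intros) auto
      then show ?thesis by (simp del: of_nat_Suc)
    qed
    show "((\<lambda>y. - exp (- real (Suc i) * y) / real (Suc i)) has_real_derivative exp (- real (Suc i) * y)) (at y)" for y
      by (auto intro!: derivative_eq_intros simp: field_simps simp del: of_nat_Suc)
  qed auto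
  finally show ?thesis by simp
qed

interpretation exp_law: product_sigma_finite "\<lambda>_. exp_law"
  by (simp add: product_sigma_finite_def prob_space_imp_sigma_finite prob_space_exp_law)

lemma measurable_kth_largest_PiM:
  assumes "finite S" "1 \<le> k" "k \<le> card S" "S \<subseteq> I"
  shows "(\<lambda>x. kth_largest S x k) \<in> borel_measurable (Pi\<^sub>M I (\<lambda>_. exp_law))"
proof (rule measurable_kth_largest[OF assms(1-3)])
  fix j assume "j \<in> S"
  then have "(\<lambda>x. x j) \<in> Pi\<^sub>M I (\<lambda>_. exp_law) \<rightarrow>\<^sub>M exp_law"
    using assms by (intro measurable_component_singleton) auto
  then show "(\<lambda>x. x j) \<in> borel_measurable (Pi\<^sub>M I (\<lambda>_. exp_law))"
    by (simp cong: measurable_cong_sets)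
qed

lemma measurable_gaps_exceed:
  assumes "finite S" "length ts < card S" "S \<subseteq> I"
  shows "Measurable.pred (Pi\<^sub>M I (\<lambda>_. exp_law)) (gaps_exceed S ts)"
proof -
  have *: "{x \<in> space (Pi\<^sub>M I (\<lambda>_. exp_law)). kth_largest S x (Suc l) - kth_largest S x (Suc (Suc l)) > ts ! l} \<in>
      sets (Pi\<^sub>M I (\<lambda>_. exp_law))" if "l < length ts" for l
  proof -
    have [measurable]: "(\<lambda>x. kth_largest S x (Suc l)) \<in> borel_measurable (Pi\<^sub>M I (\<lambda>_. exp_law))"
       "(\<lambda>x. kth_largest S x (Suc (Suc l))) \<in> borel_measurable (Pi\<^sub>M I (\<lambda>_. exp_law))"
      using assms that by (auto intro!: measurable_kth_largest_PiM)
    show ?thesis by measurable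
  qed
  have "{x \<in> space (Pi\<^sub>M I (\<lambda>_. exp_law)). \<forall>l\<in>{..<length ts}.
      kth_largest S x (Suc l) - kth_largest S x (Suc (Suc l)) > ts ! l} \<in> sets (Pi\<^sub>M I (\<lambda>_. exp_law))"
    by (intro sets.sets_Collect_finite_All *) auto
  then show ?thesis
    unfolding gaps_exceed_def[abs_def] pred_def by (simp only: lessThan_iff Ball_def)
qed

text \<open>The number \<open>i\<close> counts the maxima already integrated out, and the
  exponential factor is the weight they leave on the largest remaining value.\<close>

definition gap_integral :: "'i set \<Rightarrow> nat \<Rightarrow> real list \<Rightarrow> ennreal" where
  "gap_integral S i ts =
    (\<integral>\<^sup>+x. ennreal (exp (- real i * kth_largest S x 1)) * of_bool (gaps_exceed S ts x) \<partial>Pi\<^sub>M S (\<lambda>_. exp_law))"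

text \<open>Split according to the index \<open>j\<close> of the maximum and integrate that
  coordinate first, over the values above the largest of the others plus \<open>t\<close>. By lack
  of memory the threshold factors out, and the weight on the remaining maximum goes up by
  one.\<close>

lemma gap_integral_Cons:
  assumes S: "finite S" "Suc (length ts) < card S" and t: "t \<ge> 0"
  shows "gap_integral S i (t # ts) =
    ennreal (exp (- real (Suc i) * t) / real (Suc i)) * (\<Sum>j\<in>S. gap_integral (S - {j}) (Suc i) ts)"
proof -
  let ?P = "\<lambda>S. Pi\<^sub>M S (\<lambda>_. exp_law)"
  have comp: "(\<lambda>x. x j) \<in> borel_measurable (?P S)" if "j \<in> S" for j S
  proof -
    have "(\<lambda>x. x j) \<in> ?P S \<rightarrow>\<^sub>M exp_law"
      using that by (intro measurable_component_singleton) auto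
    then show ?thesis by (simp cong: measurable_cong_sets)
  qed
  have meas: "(\<lambda>x. ennreal (exp (- real i * x j)) * of_bool (x j > kth_largest (S - {j}) x 1 + t) *
      of_bool (gaps_exceed (S - {j}) ts x)) \<in> borel_measurable (?P S)" if j: "j \<in> S" for j
  proof -
    note comp[OF j, measurable]
    have [measurable]: "(\<lambda>x. kth_largest (S - {j}) x 1) \<in> borel_measurable (?P S)"
      using S j by (intro measurable_kth_largest_PiM) auto
    have [measurable]: "Measurable.pred (?P S) (gaps_exceed (S - {j}) ts)"
      using S j by (intro measurable_gaps_exceed) auto
    show ?thesis by measurable
  qed
  have term_j: "(\<integral>\<^sup>+x. ennreal (exp (- real i * x j)) * of_bool (x j > kth_largest (S - {j}) x 1 + t) *
      of_bool (gaps_exceed (S - {j}) ts x) \<partial>?P S) =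
      ennreal (exp (- real (Suc i) * t) / real (Suc i)) * gap_integral (S - {j}) (Suc i) ts" if j: "j \<in> S" for j
  proof -
    let ?R = "S - {j}"
    have ins: "insert j ?R = S" using j by auto
    have fin: "finite ?R" "j \<notin> ?R" using S by auto
    have cong: "kth_largest ?R (x(j := y)) 1 = kth_largest ?R x 1"
        "gaps_exceed ?R ts (x(j := y)) = gaps_exceed ?R ts x" for x and y :: real
      by (auto intro!: kth_largest_cong gaps_exceed_cong split: if_splits)
    have m1: "(\<lambda>x. kth_largest ?R x 1) \<in> borel_measurable (?P ?R)"
      using S j by (intro measurable_kth_largest_PiM) auto
    have m2: "Measurable.pred (?P ?R) (gaps_exceed ?R ts)"
      using S j by (intro measurable_gaps_exceed) auto
    have "(\<integral>\<^sup>+x. ennreal (exp (- real i * x j)) * of_bool (x j > kth_largest ?R x 1 + t) *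
        of_bool (gaps_exceed ?R ts x) \<partial>?P S) =
      (\<integral>\<^sup>+x. (\<integral>\<^sup>+y. ennreal (exp (- real i * y)) * of_bool (y > kth_largest ?R x 1 + t) *
        of_bool (gaps_exceed ?R ts x) \<partial>exp_law) \<partial>?P ?R)"
      using exp_law.product_nn_integral_insert[OF fin, of "\<lambda>x. ennreal (exp (- real i * x j)) *
          of_bool (x j > kth_largest ?R x 1 + t) * of_bool (gaps_exceed ?R ts x)"] meas[OF j]
      unfolding ins cong fun_upd_same by simp
    also have "\<dots> = (\<integral>\<^sup>+x. ennreal (exp (- real (Suc i) * t) / real (Suc i)) *
        (ennreal (exp (- real (Suc i) * kth_largest ?R x 1)) * of_bool (gaps_exceed ?R ts x)) \<partial>?P ?R)"
    proof (rule nn_integral_cong_AE)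
      \<comment> \<open>Exponential coordinates are almost surely nonnegative, so the lower limit of
        the inner integral is nonnegative, as the tail formula requires.\<close>
      have "AE x in ?P ?R. \<forall>k\<in>?R. x k \<ge> 0"
        using fin by (intro AE_finite_allI AE_PiM_component prob_space_exp_law AE_exp_law_nonneg)
      then show "AE x in ?P ?R. (\<integral>\<^sup>+y. ennreal (exp (- real i * y)) * of_bool (y > kth_largest ?R x 1 + t) *
          of_bool (gaps_exceed ?R ts x) \<partial>exp_law) =
        ennreal (exp (- real (Suc i) * t) / real (Suc i)) *
        (ennreal (exp (- real (Suc i) * kth_largest ?R x 1)) * of_bool (gaps_exceed ?R ts x))"
      proof eventually_elim
        case (elim x)
        have "\<exists>k\<in>?R. kth_largest ?R x 1 = x k"
          using S j by (intro kth_largest_mem) auto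
        then obtain k where "k \<in> ?R" "kth_largest ?R x 1 = x k" by blast
        then have nonneg: "kth_largest ?R x 1 + t \<ge> 0" using elim t by (simp del: Diff_iff)
        have "(\<integral>\<^sup>+y. ennreal (exp (- real i * y)) * of_bool (y > kth_largest ?R x 1 + t) *
            of_bool (gaps_exceed ?R ts x) \<partial>exp_law) =
          (\<integral>\<^sup>+y. ennreal (exp (- real i * y)) * of_bool (y > kth_largest ?R x 1 + t) \<partial>exp_law) *
            of_bool (gaps_exceed ?R ts x)"
          by (rule nn_integral_multc) measurable
        also have "(\<integral>\<^sup>+y. ennreal (exp (- real i * y)) * of_bool (y > kth_largest ?R x 1 + t) \<partial>exp_law) =
          ennreal (exp (- real (Suc i) * (kth_largest ?R x 1 + t)) / real (Suc i))"
          by (rule nn_integral_exp_law_tail[OF nonneg])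
        also have "exp (- real (Suc i) * (kth_largest ?R x 1 + t)) / real (Suc i) =
          exp (- real (Suc i) * t) / real (Suc i) * exp (- real (Suc i) * kth_largest ?R x 1)"
          by (simp add: exp_add[symmetric] algebra_simps)
        also have "ennreal \<dots> = ennreal (exp (- real (Suc i) * t) / real (Suc i)) * ennreal (exp (- real (Suc i) * kth_largest ?R x 1))"
          by (rule ennreal_mult) auto
        finally show ?case by (simp only: mult.assoc)
      qed
    qed
    also have "\<dots> = ennreal (exp (- real (Suc i) * t) / real (Suc i)) * gap_integral ?R (Suc i) ts"
    proof -
      note [measurable] = m1 m2
      show ?thesis unfolding gap_integral_def by (intro nn_integral_cmult) measurable
    qed
    finally show ?thesis .
  qed
  have "gap_integral S i (t # ts) = (\<integral>\<^sup>+x. (\<Sum>j\<in>S. ennreal (exp (- real i * x j)) *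
      of_bool (x j > kth_largest (S - {j}) x 1 + t) * of_bool (gaps_exceed (S - {j}) ts x)) \<partial>?P S)"
    unfolding gap_integral_def
    by (intro nn_integral_cong gaps_exceed_Cons_sum[OF S t, of "\<lambda>m. ennreal (exp (- real i * m))"])
  also have "\<dots> = (\<Sum>j\<in>S. \<integral>\<^sup>+x. ennreal (exp (- real i * x j)) *
      of_bool (x j > kth_largest (S - {j}) x 1 + t) * of_bool (gaps_exceed (S - {j}) ts x) \<partial>?P S)"
    using meas by (intro nn_integral_sum) auto
  also have "\<dots> = (\<Sum>j\<in>S. ennreal (exp (- real (Suc i) * t) / real (Suc i)) * gap_integral (S - {j}) (Suc i) ts)"
    using term_j by (intro sum.cong) auto
  finally show ?thesis by (simp only: sum_distrib_left)
qed

text \<open>Each step of the recursion contributes an exponential factor that is the same for every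
  deleted index \<open>j\<close> and so leaves the sum. What remains is the recursion with zero
  thresholds.\<close>

lemma gap_integral_exp:
  assumes "finite S" "length ts < card S" "\<And>t. t \<in> set ts \<Longrightarrow> t \<ge> 0"
  shows "gap_integral S i ts =
    ennreal (exp (- (\<Sum>l<length ts. real (i + Suc l) * ts ! l))) * gap_integral S i (replicate (length ts) 0)"
  using assms
proof (induction ts arbitrary: S i)
  case Nil
  then show ?case by simp
next
  case (Cons t ts)
  let ?e = "\<lambda>i. exp (- (\<Sum>l<length ts. real (i + Suc l) * ts ! l))"
  have IH: "gap_integral (S - {j}) (Suc i) ts = ennreal (?e (Suc i)) * gap_integral (S - {j}) (Suc i) (replicate (length ts) 0)"
    if "j \<in> S" for j
    using Cons.prems that by (intro Cons.IH) auto
  have "gap_integral S i (t # ts) =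
    ennreal (exp (- real (Suc i) * t) / real (Suc i)) * (\<Sum>j\<in>S. gap_integral (S - {j}) (Suc i) ts)"
    using Cons.prems by (intro gap_integral_Cons) auto
  also have "(\<Sum>j\<in>S. gap_integral (S - {j}) (Suc i) ts) =
    ennreal (?e (Suc i)) * (\<Sum>j\<in>S. gap_integral (S - {j}) (Suc i) (replicate (length ts) 0))"
    using IH by (simp add: sum_distrib_left)
  also have "ennreal (exp (- real (Suc i) * t) / real (Suc i)) = ennreal (exp (- real (Suc i) * t)) * ennreal (1 / real (Suc i))"
    by (simp add: ennreal_mult[symmetric] del: of_nat_Suc)
  finally have "gap_integral S i (t # ts) = (ennreal (exp (- real (Suc i) * t)) * ennreal (?e (Suc i))) *
      (ennreal (1 / real (Suc i)) * (\<Sum>j\<in>S. gap_integral (S - {j}) (Suc i) (replicate (length ts) 0)))"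
    by (simp only: mult_ac)
  also have "ennreal (1 / real (Suc i)) * (\<Sum>j\<in>S. gap_integral (S - {j}) (Suc i) (replicate (length ts) 0)) =
      gap_integral S i (replicate (length (t # ts)) 0)"
    using gap_integral_Cons[of S "replicate (length ts) 0" 0 i] Cons.prems by simp
  also have "ennreal (exp (- real (Suc i) * t)) * ennreal (?e (Suc i)) =
      ennreal (exp (- (\<Sum>l<length (t # ts). real (i + Suc l) * (t # ts) ! l)))"
    by (simp add: ennreal_mult[symmetric] exp_add[symmetric] sum.lessThan_Suc_shift del: sum.lessThan_Suc)
      (simp add: algebra_simps)
  finally show ?case .
qed

text \<open>With the other coordinates fixed, a tie confines coordinate \<open>i\<close> to a single
  point, which is null for a law with a density. Fubini and finiteness of \<open>S\<close> do the
  rest.\<close>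

lemma AE_PiM_exp_law_inj_on:
  assumes "finite S"
  shows "AE x in Pi\<^sub>M S (\<lambda>_. exp_law). inj_on x S"
proof -
  let ?P = "\<lambda>S. Pi\<^sub>M S (\<lambda>_. exp_law)"
  have "AE x in ?P S. x i \<noteq> x j" if "i \<in> S" "j \<in> S" "i \<noteq> j" for i j
  proof -
    let ?R = "S - {i}"
    have ins: "insert i ?R = S" using that by auto
    have comp: "(\<lambda>x. x k) \<in> borel_measurable (?P S)" if "k \<in> S" for k S
    proof -
      have "(\<lambda>x. x k) \<in> ?P S \<rightarrow>\<^sub>M exp_law"
        using that by (intro measurable_component_singleton) auto
      then show ?thesis by (simp cong: measurable_cong_sets)
    qed
    note comp[OF that(1), measurable] comp[OF that(2), measurable]
    have [measurable]: "{x \<in> space (?P S). x i = x j} \<in> sets (?P S)" by measurable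
    have null: "(\<integral>\<^sup>+y. of_bool (y = c) \<partial>exp_law) = (0::ennreal)" for c :: real
    proof -
      have "AE y in exp_law. y \<noteq> c"
        using AE_lborel_singleton[of c] by (subst AE_density) auto
      then have "(\<integral>\<^sup>+y. of_bool (y = c) \<partial>exp_law) = (\<integral>\<^sup>+y. 0 \<partial>exp_law :: ennreal)"
        by (intro nn_integral_cong_AE) auto
      then show ?thesis by simp
    qed
    have "emeasure (?P S) {x \<in> space (?P S). x i = x j} =
        (\<integral>\<^sup>+x. indicator {x \<in> space (?P S). x i = x j} x \<partial>?P S)" by simp
    also have "\<dots> = (\<integral>\<^sup>+x. of_bool (x i = x j) \<partial>?P S)"
      by (intro nn_integral_cong) (simp add: indicator_def)
    also have "\<dots> = (\<integral>\<^sup>+x. (\<integral>\<^sup>+y. of_bool ((x(i := y)) i = (x(i := y)) j) \<partial>exp_law) \<partial>?P ?R)"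
      using exp_law.product_nn_integral_insert[of ?R i "\<lambda>x. of_bool (x i = x j)"] assms
      unfolding ins by simp
    also have "\<dots> = 0" using that null by simp
    finally show ?thesis by (subst AE_iff_measurable[OF _ refl]) auto
  qed
  then have "AE x in ?P S. \<forall>i\<in>S. \<forall>j\<in>S. i \<noteq> j \<longrightarrow> x i \<noteq> x j"
    using assms by (intro AE_finite_allI AE_impI) auto
  then show ?thesis by eventually_elim (auto simp: inj_on_def)
qed

text \<open>The normalising constant need not be computed: for zero thresholds the event has probability 1.\<close>

lemma emeasure_gaps_exceed:
  assumes "finite S" "length ts < card S" "\<And>t. t \<in> set ts \<Longrightarrow> t \<ge> 0"
  shows "emeasure (Pi\<^sub>M S (\<lambda>_. exp_law)) {x \<in> space (Pi\<^sub>M S (\<lambda>_. exp_law)). gaps_exceed S ts x} =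
    ennreal (exp (- (\<Sum>l<length ts. real (Suc l) * ts ! l)))"
proof -
  let ?P = "Pi\<^sub>M S (\<lambda>_. exp_law)"
  interpret P: prob_space ?P by (intro prob_space_PiM prob_space_exp_law)
  have eq: "gap_integral S 0 ts = emeasure ?P {x \<in> space ?P. gaps_exceed S ts x}" if "length ts < card S" for ts
  proof -
    have [measurable]: "Measurable.pred ?P (gaps_exceed S ts)"
      using assms that by (intro measurable_gaps_exceed) auto
    have "gap_integral S 0 ts = (\<integral>\<^sup>+x. indicator {x \<in> space ?P. gaps_exceed S ts x} x \<partial>?P)"
      unfolding gap_integral_def by (intro nn_integral_cong) (simp add: indicator_def)
    also have "\<dots> = emeasure ?P {x \<in> space ?P. gaps_exceed S ts x}" by (rule nn_integral_indicator) measurable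
    finally show ?thesis .
  qed
  have "AE x in ?P. gaps_exceed S (replicate (length ts) 0) x"
    using AE_PiM_exp_law_inj_on[OF assms(1)] assms(1,2)
    by (auto elim!: eventually_mono intro!: gaps_exceed_replicate_0)
  then have "gap_integral S 0 (replicate (length ts) 0) = 1"
    unfolding gap_integral_def
    by (subst nn_integral_cong_AE[where v="\<lambda>_. 1"]) (auto simp: P.emeasure_space_1)
  then show ?thesis using gap_integral_exp[OF assms, of 0] eq[OF assms(2)] by simp
qed


section \<open>The joint law of the spacings\<close>

definition spacing :: "'i set \<Rightarrow> ('i \<Rightarrow> real) \<Rightarrow> nat \<Rightarrow> real" where
  "spacing S x i = kth_largest S x i - kth_largest S x (Suc i)"

lemma measurable_spacing:
  assumes "finite S" "1 \<le> i" "i < card S" "\<And>j. j \<in> S \<Longrightarrow> (\<lambda>\<omega>. u \<omega> j) \<in> borel_measurable M"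
  shows "(\<lambda>\<omega>. spacing S (u \<omega>) i) \<in> borel_measurable M"
  unfolding spacing_def using assms by (intro borel_measurable_diff measurable_kth_largest) auto

lemma (in prob_space) prob_spacings_exceed:
  fixes x :: "'i \<Rightarrow> 'a \<Rightarrow> real"
  assumes S: "finite S" "d < card S"
    and indep: "indep_vars (\<lambda>_. borel) x S"
    and distr: "\<And>j. j \<in> S \<Longrightarrow> distributed M lborel (x j) (exponential_density 1)"
    and t: "\<And>i. t i \<ge> 0"
  shows "\<P>(\<omega> in M. \<forall>i\<in>{1..d}. spacing S (\<lambda>j. x j \<omega>) i > t i) = exp (- (\<Sum>i=1..d. real i * t i))"
proof -
  let ?P = "Pi\<^sub>M S (\<lambda>_. exp_law)" and ?B = "Pi\<^sub>M S (\<lambda>_. borel :: real measure)"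
    and ?X = "\<lambda>\<omega>. \<lambda>j\<in>S. x j \<omega>" and ?ts = "map (\<lambda>l. t (Suc l)) [0..<d]"
  have "S \<noteq> {}" using S by auto
  have rv: "x j \<in> borel_measurable M" if "j \<in> S" for j
    using distr[OF that] by (simp add: distributed_def)
  have "distr M borel (x j) = exp_law" if "j \<in> S" for j
  proof -
    have "distr M lborel (x j) = exp_law" using distr[OF that] by (simp add: distributed_def)
    then show ?thesis by (metis distr_cong sets_lborel)
  qed
  then have law: "distr M ?B ?X = ?P"
    using indep indep_vars_iff_distr_eq_PiM'[OF \<open>S \<noteq> {}\<close> rv] by (auto cong: PiM_cong)
  have [measurable]: "?X \<in> M \<rightarrow>\<^sub>M ?B" using rv by (intro measurable_restrict) auto
  have space: "space ?P = space ?B" by (simp add: space_PiM)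
  have sets: "sets ?P = sets ?B" by (intro sets_PiM_cong) auto
  have meas: "{z \<in> space ?P. gaps_exceed S ?ts z} \<in> sets ?P"
    using measurable_gaps_exceed[of S ?ts S] S by (simp add: pred_def)
  \<comment> \<open>Index shift: list position \<open>l\<close> carries the threshold of the spacing
    with number \<open>Suc l\<close>.\<close>
  have iff: "gaps_exceed S ?ts (?X \<omega>) \<longleftrightarrow> (\<forall>i\<in>{1..d}. spacing S (\<lambda>j. x j \<omega>) i > t i)" for \<omega>
  proof -
    have "gaps_exceed S ?ts (?X \<omega>) = gaps_exceed S ?ts (\<lambda>j. x j \<omega>)"
      by (rule gaps_exceed_cong) simp
    also have "\<dots> \<longleftrightarrow> (\<forall>l<d. spacing S (\<lambda>j. x j \<omega>) (Suc l) > t (Suc l))"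
      by (simp add: gaps_exceed_def spacing_def)
    also have "\<dots> \<longleftrightarrow> (\<forall>i\<in>Suc ` {..<d}. spacing S (\<lambda>j. x j \<omega>) i > t i)" by auto
    finally show ?thesis by (simp only: image_Suc_lessThan)
  qed
  have "emeasure M {\<omega> \<in> space M. \<forall>i\<in>{1..d}. spacing S (\<lambda>j. x j \<omega>) i > t i} =
      emeasure M (?X -` {z \<in> space ?P. gaps_exceed S ?ts z} \<inter> space M)"
  proof -
    have "?X \<omega> \<in> space ?P" for \<omega> by (simp add: space_PiM)
    then have "{\<omega> \<in> space M. gaps_exceed S ?ts (?X \<omega>)} = ?X -` {z \<in> space ?P. gaps_exceed S ?ts z} \<inter> space M"
      by blast
    then show ?thesis by (simp only: iff)
  qed
  also have "\<dots> = emeasure ?P {z \<in> space ?P. gaps_exceed S ?ts z}"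
    using meas by (subst law[symmetric], subst emeasure_distr) (auto simp: sets)
  also have "\<dots> = ennreal (exp (- (\<Sum>l<length ?ts. real (Suc l) * ?ts ! l)))"
    using S t by (intro emeasure_gaps_exceed) auto
  also have "(\<Sum>l<length ?ts. real (Suc l) * ?ts ! l) = (\<Sum>l<d. real (Suc l) * t (Suc l))"
    by (intro sum.cong) auto
  also have "\<dots> = (\<Sum>i\<in>Suc ` {..<d}. real i * t i)" by (simp add: sum.reindex)
  also have "\<dots> = (\<Sum>i=1..d. real i * t i)" by (simp only: image_Suc_lessThan)
  finally show ?thesis by (simp add: measure_def)
qed

text \<open>A generator closed under intersection, for the independence criterion;
  \<open>UNIV\<close> is adjoined because the criterion wants the whole space among the generating
  sets.\<close>

lemma sets_borel_eq_sigma_sets_greaterThan: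
  "sets (borel :: real measure) = sigma_sets UNIV (insert UNIV (range greaterThan))"
proof
  have "sets (borel :: real measure) = sigma_sets UNIV (range greaterThan)"
    by (subst borel_Ioi) simp
  then show "sets (borel :: real measure) \<subseteq> sigma_sets UNIV (insert UNIV (range greaterThan))"
    by (simp add: sigma_sets_mono' subset_insertI)
  show "sigma_sets UNIV (insert UNIV (range greaterThan)) \<subseteq> sets (borel :: real measure)"
  proof -
    have "insert UNIV (range greaterThan) \<subseteq> sets (borel :: real measure)" by auto
    from sets.sigma_sets_subset[OF this] show ?thesis by simp
  qed
qed

text \<open>The joint survival function is a product, which gives independence because half-lines
  generate the Borel sets. It is available for nonnegative thresholds; negative ones reduce to 0
  since the spacings are almost surely positive.\<close>

theorem (in prob_space) renyi_spacings:
  fixes x :: "'i \<Rightarrow> 'a \<Rightarrow> real"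
  assumes S: "finite S" "d < card S"
    and indep: "indep_vars (\<lambda>_. borel) x S"
    and distr: "\<And>j. j \<in> S \<Longrightarrow> distributed M lborel (x j) (exponential_density 1)"
  defines "D \<equiv> \<lambda>i \<omega>. spacing S (\<lambda>j. x j \<omega>) i"
  shows "distr M (Pi\<^sub>M {1..d} (\<lambda>_. borel)) (\<lambda>\<omega>. \<lambda>i\<in>{1..d}. D i \<omega>) = Pi\<^sub>M {1..d} (\<lambda>i. Exp_dist (1 / real i))"
    and "\<And>i t. i \<in> {1..d} \<Longrightarrow> t \<ge> 0 \<Longrightarrow> \<P>(\<omega> in M. D i \<omega> > t) = exp (- real i * t)"
    and "AE \<omega> in M. \<forall>i\<in>{1..d}. D i \<omega> > 0"
proof -
  have rv: "x j \<in> borel_measurable M" if "j \<in> S" for j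
    using distr[OF that] by (simp add: distributed_def)
  have D[measurable]: "D i \<in> borel_measurable M" if "i \<in> {1..d}" for i
    unfolding D_def using that S rv by (intro measurable_spacing) auto
  have joint: "\<P>(\<omega> in M. \<forall>i\<in>{1..d}. D i \<omega> > t i) = exp (- (\<Sum>i=1..d. real i * t i))" if "\<And>i. t i \<ge> 0" for t
    unfolding D_def by (rule prob_spacings_exceed[OF S indep distr that])
  have meas: "{\<omega> \<in> space M. \<forall>i\<in>{1..d}. D i \<omega> > t i} \<in> events" for t
    by (intro sets.sets_Collect_finite_All) auto
  show pos: "AE \<omega> in M. \<forall>i\<in>{1..d}. D i \<omega> > 0"
    using joint[of "\<lambda>_. 0"] meas[of "\<lambda>_. 0"] AE_in_set_eq_1[of "{\<omega> \<in> space M. \<forall>i\<in>{1..d}. D i \<omega> > 0}"]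
    by auto
  show tail: "\<P>(\<omega> in M. D i \<omega> > t) = exp (- real i * t)" if i: "i \<in> {1..d}" and t: "t \<ge> 0" for i t
  proof -
    \<comment> \<open>Zero thresholds impose almost surely nothing on the other spacings.\<close>
    have "\<P>(\<omega> in M. D i \<omega> > t) = \<P>(\<omega> in M. \<forall>k\<in>{1..d}. D k \<omega> > (if k = i then t else 0))"
    proof (rule measure_eq_AE)
      show "AE \<omega> in M. \<omega> \<in> {\<omega> \<in> space M. t < D i \<omega>} \<longleftrightarrow>
          \<omega> \<in> {\<omega> \<in> space M. \<forall>k\<in>{1..d}. (if k = i then t else 0) < D k \<omega>}"
        using pos by eventually_elim (use i in auto)
    qed (use i meas[of "\<lambda>k. if k = i then t else 0"] in auto)
    also have "\<dots> = exp (- (\<Sum>k=1..d. real k * (if k = i then t else 0)))"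
      using t by (intro joint) auto
    also have "(\<Sum>k=1..d. real k * (if k = i then t else 0)) = real i * t"
      using i by (simp add: if_distrib[of "\<lambda>z. _ * z"] cong: if_cong)
    finally show ?thesis by simp
  qed
  have marginal: "distr M borel (D i) = Exp_dist (1 / real i)" if i: "i \<in> {1..d}" for i
  proof -
    have "distributed M lborel (D i) (exponential_density (real i))"
    proof (subst exponential_distributed_iff)
      show "D i \<in> borel_measurable M \<and> (\<forall>a\<ge>0. \<P>(\<omega> in M. D i \<omega> \<le> a) = 1 - exp (- a * real i))"
      proof (intro conjI allI impI)
        fix a :: real assume "0 \<le> a"
        then have "\<P>(\<omega> in M. \<not> D i \<omega> > a) = 1 - exp (- real i * a)"
          using i by (subst prob_neg) (auto simp: tail)
        then show "\<P>(\<omega> in M. D i \<omega> \<le> a) = 1 - exp (- a * real i)"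
          by (simp add: not_less mult.commute)
      qed (use i in auto)
    qed (use i in auto)
    then have "distr M lborel (D i) = Exp_dist (1 / real i)" by (simp add: distributed_def Exp_dist_def)
    then show ?thesis by (metis distr_cong sets_lborel)
  qed
  show "distr M (Pi\<^sub>M {1..d} (\<lambda>_. borel)) (\<lambda>\<omega>. \<lambda>i\<in>{1..d}. D i \<omega>) = Pi\<^sub>M {1..d} (\<lambda>i. Exp_dist (1 / real i))"
  proof (cases "d = 0")
    \<comment> \<open>For \<open>d = 0\<close> both measures are the point mass on the empty family;
      the independence criterion of the other case needs a nonempty index set.\<close>
    case True
    have "distr M (Pi\<^sub>M {} (\<lambda>_. borel)) (\<lambda>\<omega>. \<lambda>i\<in>{}. D i \<omega>) = Pi\<^sub>M {} (\<lambda>i. Exp_dist (1 / real i))"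
    proof (rule measure_eqI)
      fix A assume "A \<in> sets (distr M (Pi\<^sub>M {} (\<lambda>_. borel)) (\<lambda>\<omega>. \<lambda>i\<in>{}. D i \<omega>))"
      then have "A = {} \<or> A = {\<lambda>_. undefined}" by (auto simp: PiM_empty)
      then show "emeasure (distr M (Pi\<^sub>M {} (\<lambda>_. borel)) (\<lambda>\<omega>. \<lambda>i\<in>{}. D i \<omega>)) A =
          emeasure (Pi\<^sub>M {} (\<lambda>i. Exp_dist (1 / real i))) A"
        by (auto simp: emeasure_distr PiM_empty emeasure_space_1 restrict_def)
    qed (simp add: PiM_empty)
    then show ?thesis using True by simp
  next
    case False
    have "indep_vars (\<lambda>_. borel) D {1..d}"
    proof (subst indep_vars_finite[where E="\<lambda>_. insert UNIV (range greaterThan)"])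
      show "\<forall>A\<in>{1..d} \<rightarrow> insert UNIV (range greaterThan).
          prob (\<Inter>j\<in>{1..d}. D j -` A j \<inter> space M) = (\<Prod>j\<in>{1..d}. prob (D j -` A j \<inter> space M))"
      proof
        fix A :: "nat \<Rightarrow> real set" assume A: "A \<in> {1..d} \<rightarrow> insert UNIV (range greaterThan)"
        have cases_A: "A i = UNIV \<or> (\<exists>a. A i = {a<..})" if "i \<in> {1..d}" for i
        proof -
          have "A i \<in> insert UNIV (range greaterThan)" using A that by (rule Pi_mem)
          then show ?thesis by blast
        qed
        \<comment> \<open>On positive arguments \<open>UNIV\<close> acts as the threshold 0 and
          \<open>{a<..}\<close> as the threshold \<open>max 0 a\<close>.\<close>
        have "\<exists>t\<ge>0. \<forall>z>0. z \<in> A i \<longleftrightarrow> z > t" if i: "i \<in> {1..d}" for i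
        proof -
          show ?thesis using cases_A[OF i]
          proof
            assume "\<exists>a. A i = {a<..}"
            then obtain a where "A i = {a<..}" by auto
            then show ?thesis by (intro exI[of _ "max 0 a"]) auto
          qed auto
        qed
        then obtain t0 where t0: "\<And>i. i \<in> {1..d} \<Longrightarrow> t0 i \<ge> 0 \<and> (\<forall>z>0. z \<in> A i \<longleftrightarrow> z > t0 i)" by metis
        define t where "t i = (if i \<in> {1..d} then t0 i else 0)" for i
        have t: "t i \<ge> 0" for i using t0 by (simp add: t_def)
        have tA: "z \<in> A i \<longleftrightarrow> z > t i" if "i \<in> {1..d}" "z > 0" for i z
          using t0 that by (simp add: t_def)
        have [measurable]: "A i \<in> sets borel" if "i \<in> {1..d}" for i
          using cases_A[OF that] by (elim disjE exE) simp_all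
        have "prob (\<Inter>j\<in>{1..d}. D j -` A j \<inter> space M) = \<P>(\<omega> in M. \<forall>i\<in>{1..d}. D i \<omega> > t i)"
        proof (rule measure_eq_AE)
          show "AE \<omega> in M. \<omega> \<in> (\<Inter>j\<in>{1..d}. D j -` A j \<inter> space M) \<longleftrightarrow>
              \<omega> \<in> {\<omega> \<in> space M. \<forall>i\<in>{1..d}. D i \<omega> > t i}"
            using pos AE_space
          proof eventually_elim
            case (elim \<omega>)
            then have "D i \<omega> \<in> A i \<longleftrightarrow> D i \<omega> > t i" if "i \<in> {1..d}" for i using tA that by blast
            then show ?case using elim(2) False by auto
          qed
          show "(\<Inter>j\<in>{1..d}. D j -` A j \<inter> space M) \<in> events"
            using False by (intro sets.finite_INT) (auto intro: measurable_sets)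
        qed (rule meas)
        also have "\<dots> = (\<Prod>i\<in>{1..d}. exp (- real i * t i))"
          unfolding joint[OF t] sum_negf[symmetric] by (subst exp_sum) auto
        also have "\<dots> = (\<Prod>j\<in>{1..d}. prob (D j -` A j \<inter> space M))"
        proof (intro prod.cong refl)
          fix i assume i: "i \<in> {1..d}"
          have "prob (D i -` A i \<inter> space M) = \<P>(\<omega> in M. D i \<omega> > t i)"
          proof (rule measure_eq_AE)
            show "AE \<omega> in M. \<omega> \<in> D i -` A i \<inter> space M \<longleftrightarrow> \<omega> \<in> {\<omega> \<in> space M. D i \<omega> > t i}"
              using pos by eventually_elim (use tA[OF i] i in blast)
          qed (use i in \<open>auto intro: measurable_sets\<close>)
          then show "exp (- real i * t i) = prob (D i -` A i \<inter> space M)" using tail[OF i t] by simp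
        qed
        finally show "prob (\<Inter>j\<in>{1..d}. D j -` A j \<inter> space M) = (\<Prod>j\<in>{1..d}. prob (D j -` A j \<inter> space M))" .
      qed
      show "Int_stable (insert UNIV (range greaterThan) :: real set set)"
      proof -
        have "{a<..} \<inter> {b<..} = {max a b<..}" for a b :: real by auto
        then show ?thesis by (auto simp: Int_stable_def)
      qed
    qed (use False in \<open>auto simp: sets_borel_eq_sigma_sets_greaterThan\<close>)
    then have "distr M (Pi\<^sub>M {1..d} (\<lambda>_. borel)) (\<lambda>\<omega>. \<lambda>i\<in>{1..d}. D i \<omega>) = Pi\<^sub>M {1..d} (\<lambda>i. distr M borel (D i))"
      using False by (subst (asm) indep_vars_iff_distr_eq_PiM') auto
    also have "\<dots> = Pi\<^sub>M {1..d} (\<lambda>i. Exp_dist (1 / real i))"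
      by (intro PiM_cong refl marginal)
    finally show ?thesis .
  qed
qed

section \<open>Exceedances and separation\<close>

text \<open>Markov's inequality for \<open>2 ^ (- N)\<close>, where \<open>N\<close> is the number of exceedances of \<open>L\<close>.\<close>

lemma (in prob_space) prob_kth_largest_le:
  fixes Y :: "'i \<Rightarrow> 'a \<Rightarrow> real"
  assumes S: "finite S" "d < card S"
    and indep: "indep_vars (\<lambda>_. borel) Y S"
    and tail: "\<And>j. j \<in> S \<Longrightarrow> \<P>(\<omega> in M. Y j \<omega> > L) = q"
  shows "\<P>(\<omega> in M. kth_largest S (\<lambda>j. Y j \<omega>) (Suc d) \<le> L) \<le> 2 ^ d * (1 - q / 2) ^ card S"
proof -
  have rv[measurable]: "Y j \<in> borel_measurable M" if "j \<in> S" for j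
    using indep that by (auto simp: indep_vars_def)
  define h where "h x = (if x > L then 1 / 2 else 1 :: real)" for x
  have h[measurable]: "h \<in> borel_measurable borel" unfolding h_def by measurable
  \<comment> \<open>A product of independent factors, one half for each exceedance, each factor
    having mean \<open>1 - q / 2\<close>. At most \<open>d\<close> exceedances force
    \<open>W\<close> to be at least \<open>(1 / 2) ^ d\<close>.\<close>
  define W where "W \<omega> = (\<Prod>j\<in>S. h (Y j \<omega>))" for \<omega>
  have intg: "integrable M (\<lambda>\<omega>. h (Y j \<omega>))" if "j \<in> S" for j
    using that by (intro integrable_const_bound[of _ 1]) (auto simp: h_def)
  have ind: "indep_vars (\<lambda>_. borel) (\<lambda>j \<omega>. h (Y j \<omega>)) S"
    by (rule indep_vars_compose2[OF indep, where Y="\<lambda>_. h"]) (rule h)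
  have EW: "expectation W = (1 - q / 2) ^ card S"
  proof -
    have "expectation (\<lambda>\<omega>. h (Y j \<omega>)) = 1 - q / 2" if j: "j \<in> S" for j
    proof -
      have "expectation (\<lambda>\<omega>. h (Y j \<omega>)) = expectation (\<lambda>\<omega>. 1 - indicator {\<omega> \<in> space M. Y j \<omega> > L} \<omega> / 2)"
        by (intro Bochner_Integration.integral_cong) (auto simp: h_def indicator_def)
      also have "\<dots> = 1 - q / 2"
      proof -
        have "{\<omega> \<in> space M. Y j \<omega> > L} \<in> events" using j by measurable
        then have "integrable M (indicat_real {\<omega> \<in> space M. Y j \<omega> > L})"
          by (simp add: integrable_indicator_iff emeasure_eq_measure)
        moreover have "{\<omega> \<in> space M. Y j \<omega> > L} \<inter> space M = {\<omega> \<in> space M. Y j \<omega> > L}" by auto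
        ultimately show ?thesis by (simp add: prob_space tail[OF j])
      qed
      finally show ?thesis .
    qed
    then show ?thesis
      unfolding W_def by (subst indep_vars_lebesgue_integral[OF S(1) ind intg]) auto
  qed
  have intW: "integrable M W"
    unfolding W_def by (rule indep_vars_integrable[OF S(1) ind intg])
  have Wcard: "W \<omega> = (1 / 2) ^ card {j\<in>S. Y j \<omega> > L}" for \<omega>
    unfolding W_def h_def using S(1) by (simp add: prod.If_cases Int_def)
  let ?E = "{\<omega> \<in> space M. kth_largest S (\<lambda>j. Y j \<omega>) (Suc d) \<le> L}"
  have [measurable]: "(\<lambda>\<omega>. kth_largest S (\<lambda>j. Y j \<omega>) (Suc d)) \<in> borel_measurable M"
    using S by (intro measurable_kth_largest rv) auto
  have E: "?E \<in> events" by measurable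
  have "prob ?E = expectation (indicator ?E)"
  proof -
    have "?E \<inter> space M = ?E" by auto
    then show ?thesis by simp
  qed
  also have "\<dots> \<le> expectation (\<lambda>\<omega>. 2 ^ d * W \<omega>)"
  proof (rule integral_mono)
    show "indicator ?E \<omega> \<le> 2 ^ d * W \<omega>" for \<omega>
    proof (cases "\<omega> \<in> ?E")
      case True
      then have "\<not> Suc d \<le> card {j\<in>S. Y j \<omega> > L}"
        using kth_largest_greater_iff[of S "Suc d" L "\<lambda>j. Y j \<omega>"] S by auto
      then have "card {j\<in>S. Y j \<omega> > L} \<le> d" by simp
      then have "(1 / 2 :: real) ^ d \<le> W \<omega>"
        unfolding Wcard by (intro power_decreasing) auto
      then have "2 ^ d * (1 / 2 :: real) ^ d \<le> 2 ^ d * W \<omega>" by (intro mult_left_mono) auto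
      then show ?thesis using True by (simp add: power_one_over)
    qed (simp add: Wcard)
  qed (use E intW in \<open>auto simp: integrable_indicator_iff emeasure_eq_measure\<close>)
  finally show ?thesis using EW by simp
qed

text \<open>Finiteness of both index sets lets strict inequalities between all pairs pass to infimum
  and supremum. If one of the sets is empty, its extremum is infinite and both conditions
  hold.\<close>

lemma separation_event_iff:
  assumes "finite C"
  shows "separation_event M p C U = {\<omega> \<in> space M. \<forall>i\<in>C. \<forall>j\<in>{..<p} - C. \<bar>U \<omega> i\<bar> > \<bar>U \<omega> j\<bar>}"
proof -
  have "(INF i\<in>C. ereal \<bar>u i\<bar>) > (SUP j\<in>{..<p} - C. ereal \<bar>u j\<bar>) \<longleftrightarrow>
      (\<forall>i\<in>C. \<forall>j\<in>{..<p} - C. \<bar>u i\<bar> > \<bar>u j\<bar>)" for u :: "nat \<Rightarrow> real"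
  proof
    assume *: "(INF i\<in>C. ereal \<bar>u i\<bar>) > (SUP j\<in>{..<p} - C. ereal \<bar>u j\<bar>)"
    show "\<forall>i\<in>C. \<forall>j\<in>{..<p} - C. \<bar>u i\<bar> > \<bar>u j\<bar>"
    proof (intro ballI)
      fix i j assume "i \<in> C" "j \<in> {..<p} - C"
      then have "ereal \<bar>u j\<bar> \<le> (SUP j\<in>{..<p} - C. ereal \<bar>u j\<bar>)" "(INF i\<in>C. ereal \<bar>u i\<bar>) \<le> ereal \<bar>u i\<bar>"
        by (auto intro: SUP_upper INF_lower)
      then have "ereal \<bar>u j\<bar> < ereal \<bar>u i\<bar>" using * by (metis le_less_trans less_le_trans)
      then show "\<bar>u i\<bar> > \<bar>u j\<bar>" by simp
    qed
  next
    assume *: "\<forall>i\<in>C. \<forall>j\<in>{..<p} - C. \<bar>u i\<bar> > \<bar>u j\<bar>"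
    have sup: "(SUP j\<in>{..<p} - C. ereal \<bar>u j\<bar>) < z" if "z > - \<infinity>" "\<And>j. j \<in> {..<p} - C \<Longrightarrow> ereal \<bar>u j\<bar> < z" for z
    proof (cases "{..<p} - C = {}")
      case True
      show ?thesis unfolding True using that(1) by (simp add: bot_ereal_def)
    next
      case False
      then obtain j where "j \<in> {..<p} - C" by blast
      then show ?thesis using that(2) by (intro finite_imp_Sup_less[of _ "ereal \<bar>u j\<bar>"]) auto
    qed
    show "(INF i\<in>C. ereal \<bar>u i\<bar>) > (SUP j\<in>{..<p} - C. ereal \<bar>u j\<bar>)"
    proof (cases "C = {}")
      case True
      show ?thesis using sup[of "\<infinity>"] unfolding True by (simp add: top_ereal_def)
    next
      case False
      have "(SUP j\<in>{..<p} - C. ereal \<bar>u j\<bar>) < ereal \<bar>u i\<bar>" if "i \<in> C" for i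
        using * that by (intro sup) auto
      moreover obtain i where "i \<in> C" using False by blast
      ultimately show ?thesis using assms by (intro finite_imp_less_Inf[of _ "ereal \<bar>u i\<bar>"]) auto
    qed
  qed
  then show ?thesis by (simp add: separation_event_def)
qed

text \<open>At this level the density is exactly \<open>1 / (p * sqrt (2 * pi))\<close>, which
  compensates the factor \<open>p\<close>; the decay left over is the factor
  \<open>1 / sqrt (2 * ln p)\<close> from Mills' ratio. This explains the level in the signal
  assumption.\<close>

lemma tail_at_sqrt_log_tendsto_0: "(\<lambda>p. real p * normal_tail (sqrt (2 * ln (real p)))) \<longlonglongrightarrow> 0"
proof (rule tendsto_sandwich[where f="\<lambda>_. 0"])
  show "\<forall>\<^sub>F p in sequentially. real p * normal_tail (sqrt (2 * ln (real p))) \<le> 2 / sqrt (2 * pi) / sqrt (2 * ln (real p))"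
    using eventually_ge_at_top[of 2]
  proof eventually_elim
    case (elim p)
    let ?x = "sqrt (2 * ln (real p))"
    have x: "?x > 0" "?x\<^sup>2 = 2 * ln (real p)" using elim by auto
    have "std_normal_density ?x = 1 / sqrt (2 * pi) * (1 / real p)"
      using x elim by (simp add: normal_density_def exp_minus inverse_eq_divide)
    then have "normal_tail ?x \<le> 2 * (1 / sqrt (2 * pi) * (1 / real p)) / ?x"
      using mills_upper[OF x(1)] by simp
    then have "real p * normal_tail ?x \<le> real p * (2 * (1 / sqrt (2 * pi) * (1 / real p)) / ?x)"
      by (intro mult_left_mono) auto
    then show ?case using elim by simp
  qed
  show "(\<lambda>p. 2 / sqrt (2 * pi) / sqrt (2 * ln (real p))) \<longlonglongrightarrow> 0" by real_asymp
qed (auto simp: normal_tail_def)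

section \<open>The model for fixed p\<close>

text \<open>Estimates for a single \<open>p\<close> are proved here with explicit error bounds, so
  that the passage to the limit is confined to the final theorem.\<close>

locale orthogonal_lasso_model = prob_space M for M :: "'a measure" +
  fixes n p :: nat and X :: "nat \<Rightarrow> nat \<Rightarrow> real" and \<beta> :: "nat \<Rightarrow> real"
    and e y :: "'a \<Rightarrow> nat \<Rightarrow> real" and \<sigma> :: real and k0 :: nat
  assumes sigma_pos: "\<sigma> > 0"
    and orth: "orthogonal_design n p X"
    and noise: "gaussian_noise M n \<sigma> e"
    and response: "\<And>\<omega> i. \<omega> \<in> space M \<Longrightarrow> i < n \<Longrightarrow> y \<omega> i = mat_vec X {..<p} \<beta> i + e \<omega> i"
    and card_supp: "card (supp p \<beta>) = k0"
    and p_pos: "p > 0"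
begin

definition A :: "nat set" where "A = supp p \<beta>"
definition S :: "nat set" where "S = {..<p} - A"
definition U :: "'a \<Rightarrow> nat \<Rightarrow> real" where "U \<omega> j = dotp n (mat_col X j) (y \<omega>)"
definition Y :: "nat \<Rightarrow> 'a \<Rightarrow> real" where "Y j \<omega> = dotp n (mat_col X j) (e \<omega>) / \<sigma>"
definition B :: "'a set" where "B = separation_event M p A U"
definition T :: "nat \<Rightarrow> 'a \<Rightarrow> real" where "T k \<omega> = covariance_test n p X (y \<omega>) \<sigma> k"
text \<open>\<open>Q\<close> and \<open>D\<close> use the noise of the null variables only, on the
  whole space and not just on \<open>B\<close>. Their laws are therefore exact and unconditional;
  \<open>B\<close> serves to relate \<open>T\<close> to them.\<close>

definition Q :: "nat \<Rightarrow> 'a \<Rightarrow> real" where "Q i \<omega> = kth_largest S (\<lambda>j. \<bar>Y j \<omega>\<bar>) i"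
definition D :: "nat \<Rightarrow> 'a \<Rightarrow> real" where "D i \<omega> = spacing S (\<lambda>j. cum_hazard \<bar>Y j \<omega>\<bar>) i"

section \<open>Law of the marginal coefficients and probability of separation\<close>

lemma A_subset: "A \<subseteq> {..<p}" by (auto simp: A_def supp_def)

lemma finite_A: "finite A" using A_subset finite_subset by blast

lemma card_A: "card A = k0" using card_supp by (simp add: A_def)

lemma finite_S: "finite S" by (simp add: S_def)

lemma A_Un_S: "A \<union> S = {..<p}" "A \<inter> S = {}" using A_subset by (auto simp: S_def)

lemma card_S: "card S = p - k0"
  using A_subset finite_A by (simp add: S_def card_Diff_subset card_A)

lemma U_eq:
  assumes "\<omega> \<in> space M" "j < p"
  shows "U \<omega> j = \<beta> j + \<sigma> * Y j \<omega>"
proof -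
  have "U \<omega> j = dotp n (mat_col X j) (\<lambda>i. mat_vec X {..<p} \<beta> i + e \<omega> i)"
    unfolding U_def dotp_def using response assms by (intro sum.cong) auto
  also have "\<dots> = dotp n (mat_col X j) (mat_vec X {..<p} \<beta>) + dotp n (mat_col X j) (e \<omega>)"
    by (simp add: dotp_def distrib_left sum.distrib)
  also have "\<dots> = \<beta> j + \<sigma> * Y j \<omega>"
    using dotp_mat_col_mat_vec[OF orth order_refl assms(2), of \<beta>] assms sigma_pos by (simp add: Y_def)
  finally show ?thesis .
qed

lemma abs_U_eq:
  assumes "\<omega> \<in> space M" "j \<in> S"
  shows "\<bar>U \<omega> j\<bar> = \<sigma> * \<bar>Y j \<omega>\<bar>"
proof -
  have "\<beta> j = 0" "j < p" using assms(2) by (auto simp: S_def A_def supp_def)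
  then show ?thesis using U_eq[OF assms(1), of j] sigma_pos by (simp add: abs_mult)
qed

lemma indep_Y: "indep_vars (\<lambda>_. borel) Y {..<p}"
  and distr_Y: "j < p \<Longrightarrow> distr M borel (Y j) = std_normal_distribution"
  using orthogonal_transform_std_normal[OF orth p_pos sigma_pos noise] by (auto simp: Y_def[abs_def])

lemma measurable_Y[measurable]: "j < p \<Longrightarrow> Y j \<in> borel_measurable M"
  using indep_Y by (auto simp: indep_vars_def)

lemma measurable_U: "j < p \<Longrightarrow> (\<lambda>\<omega>. U \<omega> j) \<in> borel_measurable M"
  by (subst measurable_cong[OF U_eq]) auto

lemma measurable_T:
  assumes "1 \<le> k" "k < p"
  shows "T k \<in> borel_measurable M"
proof -
  let ?u = "\<lambda>\<omega> j. \<bar>U \<omega> j\<bar>"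
  have eq: "T k = (\<lambda>\<omega>. (\<Sum>j<p. of_bool (?u \<omega> j \<le> kth_largest {..<p} (?u \<omega>) k) *
      (?u \<omega> j * max 0 (?u \<omega> j - kth_largest {..<p} (?u \<omega>) (Suc k)))) / \<sigma>\<^sup>2)"
    unfolding T_def[abs_def] U_def by (intro ext covariance_test_orthogonal[OF orth refl assms])
  have u[measurable]: "(\<lambda>\<omega>. ?u \<omega> j) \<in> borel_measurable M" if "j \<in> {..<p}" for j
    using that measurable_U by auto
  have [measurable]: "(\<lambda>\<omega>. kth_largest {..<p} (?u \<omega>) k) \<in> borel_measurable M"
      "(\<lambda>\<omega>. kth_largest {..<p} (?u \<omega>) (Suc k)) \<in> borel_measurable M"
    using assms by (auto intro!: measurable_kth_largest u)
  show ?thesis unfolding eq by measurable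
qed

lemma B_eq: "B = {\<omega> \<in> space M. \<forall>i\<in>A. \<forall>j\<in>S. \<bar>U \<omega> i\<bar> > \<bar>U \<omega> j\<bar>}"
  unfolding B_def S_def by (rule separation_event_iff[OF finite_A])

lemma B_events: "B \<in> events"
proof -
  have "{\<omega> \<in> space M. \<bar>U \<omega> i\<bar> > \<bar>U \<omega> j\<bar>} \<in> events" if "i \<in> A" "j \<in> S" for i j
  proof -
    have "i < p" "j < p" using that A_subset by (auto simp: S_def)
    note [measurable] = measurable_U[OF this(1)] measurable_U[OF this(2)]
    show ?thesis by measurable
  qed
  then show ?thesis
    unfolding B_eq by (intro sets.sets_Collect_finite_All finite_A finite_S)
qed

lemma prob_abs_Y: "j < p \<Longrightarrow> \<P>(\<omega> in M. \<bar>Y j \<omega>\<bar> > x) = normal_tail x"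
  unfolding normal_tail_def distr_Y[symmetric]
  by (subst measure_distr) (auto intro!: arg_cong[where f=prob])

text \<open>The two groups get separate levels: the \<open>k0\<close> true variables can afford a
  fixed \<open>r\<close>, whereas the union bound over the null variables needs \<open>s\<close> to
  grow with \<open>p\<close>. If no level is exceeded, true coefficients stay above
  \<open>\<sigma> * s\<close> in absolute value and null ones do not exceed it.\<close>

lemma prob_not_B:
  assumes gap: "\<And>j. j \<in> A \<Longrightarrow> \<bar>\<beta> j\<bar> > \<sigma> * r + \<sigma> * s"
  shows "prob (space M - B) \<le> real k0 * normal_tail r + real p * normal_tail s"
proof -
  let ?E = "\<lambda>j x. {\<omega> \<in> space M. \<bar>Y j \<omega>\<bar> > x}"
  have ev: "?E j x \<in> events" if "j < p" for j x using that by measurable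
  have sub: "space M - B \<subseteq> (\<Union>j\<in>A. ?E j r) \<union> (\<Union>j\<in>S. ?E j s)"
  proof (rule ccontr)
    assume "\<not> ?thesis"
    then obtain \<omega> where \<omega>: "\<omega> \<in> space M" "\<omega> \<notin> B"
      and rs: "\<forall>j\<in>A. \<not> \<bar>Y j \<omega>\<bar> > r" "\<forall>j\<in>S. \<not> \<bar>Y j \<omega>\<bar> > s"
      by blast
    have r: "\<bar>Y j \<omega>\<bar> \<le> r" if "j \<in> A" for j using rs that by (simp add: not_less)
    have s: "\<bar>Y j \<omega>\<bar> \<le> s" if "j \<in> S" for j using rs that by (simp add: not_less)
    have "\<bar>U \<omega> i\<bar> > \<bar>U \<omega> j\<bar>" if i: "i \<in> A" and j: "j \<in> S" for i j
    proof -
      have "\<bar>U \<omega> i\<bar> \<ge> \<bar>\<beta> i\<bar> - \<sigma> * \<bar>Y i \<omega>\<bar>"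
        using U_eq[OF \<omega>(1), of i] i A_subset sigma_pos abs_triangle_ineq2[of "\<beta> i" "- \<sigma> * Y i \<omega>"]
        by (auto simp: abs_mult)
      moreover have "\<sigma> * \<bar>Y i \<omega>\<bar> \<le> \<sigma> * r" using r[OF i] sigma_pos by (intro mult_left_mono) auto
      moreover have "\<bar>U \<omega> j\<bar> \<le> \<sigma> * s"
        unfolding abs_U_eq[OF \<omega>(1) j] using s[OF j] sigma_pos by (intro mult_left_mono) auto
      ultimately show ?thesis using gap[OF i] by linarith
    qed
    then show False using \<omega> by (auto simp: B_eq)
  qed
  have un: "prob (\<Union>j\<in>J. ?E j x) \<le> real (card J) * normal_tail x" if J: "J \<subseteq> {..<p}" for J x
  proof -
    have "finite J" using J finite_subset by blast
    then have "prob (\<Union>j\<in>J. ?E j x) \<le> (\<Sum>j\<in>J. prob (?E j x))"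
      using J ev by (intro measure_UNION_le) auto
    also have "\<dots> = (\<Sum>j\<in>J. normal_tail x)" using J by (intro sum.cong prob_abs_Y) auto
    finally show ?thesis by simp
  qed
  have "finite S" "S \<subseteq> {..<p}" by (auto simp: S_def)
  have "prob (space M - B) \<le> prob ((\<Union>j\<in>A. ?E j r) \<union> (\<Union>j\<in>S. ?E j s))"
    using ev A_subset finite_A \<open>S \<subseteq> {..<p}\<close> \<open>finite S\<close>
    by (intro finite_measure_mono sub sets.Un sets.finite_UN) auto
  also have "\<dots> \<le> prob (\<Union>j\<in>A. ?E j r) + prob (\<Union>j\<in>S. ?E j s)"
    using ev A_subset finite_A \<open>S \<subseteq> {..<p}\<close> \<open>finite S\<close>
    by (intro measure_Un_le sets.finite_UN) auto
  also have "\<dots> \<le> real k0 * normal_tail r + real (card S) * normal_tail s"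
    using un[OF A_subset, of r] un[OF \<open>S \<subseteq> {..<p}\<close>, of s] by (simp add: card_A)
  also have "\<dots> \<le> real k0 * normal_tail r + real p * normal_tail s"
    by (intro add_left_mono mult_right_mono) (auto simp: card_S normal_tail_def)
  finally show ?thesis .
qed

section \<open>Comparison of the statistics with the spacings\<close>

lemma Q_nonneg: "1 \<le> i \<Longrightarrow> i \<le> card S \<Longrightarrow> Q i \<omega> \<ge> 0"
  using kth_largest_mem[OF finite_S, of i "\<lambda>j. \<bar>Y j \<omega>\<bar>"] by (auto simp: Q_def)

lemma D_eq: "1 \<le> i \<Longrightarrow> i < card S \<Longrightarrow> D i \<omega> = cum_hazard (Q i \<omega>) - cum_hazard (Q (Suc i) \<omega>)"
  unfolding D_def spacing_def Q_def
  by (subst (1 2) kth_largest_strict_mono_on[OF finite_S _ _ cum_hazard_strict_mono]) auto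

lemma Q_less_iff: "1 \<le> i \<Longrightarrow> i < card S \<Longrightarrow> Q (Suc i) \<omega> < Q i \<omega> \<longleftrightarrow> D i \<omega> > 0"
  using D_eq[of i \<omega>] Q_nonneg[of i \<omega>] Q_nonneg[of "Suc i" \<omega>]
    strict_mono_on_less[OF cum_hazard_strict_mono, of "Q (Suc i) \<omega>" "Q i \<omega>"] by auto

lemma T_eq:
  assumes \<omega>: "\<omega> \<in> B" and d: "d < card S" and pos: "\<forall>i\<in>{1..d}. D i \<omega> > 0" and i: "i \<in> {1..d}"
  shows "T (k0 + i) \<omega> = Q i \<omega> * (Q i \<omega> - Q (Suc i) \<omega>)"
proof -
  let ?u = "\<lambda>j. \<bar>dotp n (mat_col X j) (y \<omega>)\<bar>"
  have sp: "\<omega> \<in> space M" using \<omega> by (simp add: B_eq)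
  have u: "?u j = \<bar>U \<omega> j\<bar>" for j by (simp add: U_def)
  have sep: "?u a > ?u b" if "a \<in> A" "b \<in> S" for a b
    using \<omega> that unfolding u by (auto simp: B_eq)
  have V: "kth_largest {..<p} ?u (k0 + i) = \<sigma> * Q i \<omega>" if "1 \<le> i" "i \<le> card S" for i
  proof -
    have "kth_largest {..<p} ?u (k0 + i) = kth_largest S ?u i"
      using kth_largest_union[OF finite_A finite_S A_Un_S(2), of ?u i, OF sep that] by (simp add: A_Un_S card_A)
    also have "\<dots> = kth_largest S (\<lambda>j. \<sigma> * \<bar>Y j \<omega>\<bar>) i"
      by (rule kth_largest_cong) (simp only: u abs_U_eq[OF sp])
    also have "\<dots> = \<sigma> * Q i \<omega>"
      unfolding Q_def using sigma_pos
      by (intro kth_largest_strict_mono_on[OF finite_S that, of UNIV]) (auto simp: strict_mono_on_def)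
    finally show ?thesis .
  qed
  have dec: "\<sigma> * Q (Suc i) \<omega> < \<sigma> * Q i \<omega>" if "i \<in> {1..d}" for i
    using Q_less_iff[of i \<omega>] pos that d sigma_pos by auto
  \<comment> \<open>For \<open>i = 1\<close> the \<open>k0\<close> larger values are those of the
    true variables, by separation; for larger \<open>i\<close> the strict drop from the preceding
    knot supplies all \<open>k0 + i - 1\<close> of them.\<close>
  have count: "k0 + i - 1 \<le> card {j. j < p \<and> ?u j > kth_largest {..<p} ?u (k0 + i)}"
  proof (cases "i = 1")
    case True
    have "\<exists>j\<in>S. kth_largest S ?u 1 = ?u j" using d by (intro kth_largest_mem[OF finite_S]) auto
    moreover have "kth_largest {..<p} ?u (k0 + 1) = kth_largest S ?u 1"
      using kth_largest_union[OF finite_A finite_S A_Un_S(2), of ?u 1, OF sep] d by (simp add: A_Un_S card_A)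
    ultimately have "A \<subseteq> {j. j < p \<and> ?u j > kth_largest {..<p} ?u (k0 + i)}"
      using sep A_subset True by auto
    then have "card A \<le> card {j. j < p \<and> ?u j > kth_largest {..<p} ?u (k0 + i)}"
      by (intro card_mono) auto
    then show ?thesis using True by (simp add: card_A)
  next
    case False
    then have i': "i - 1 \<in> {1..d}" "Suc (i - 1) = i" using i by auto
    have "kth_largest {..<p} ?u (k0 + (i - 1)) > kth_largest {..<p} ?u (k0 + i)"
      using V[of "i - 1"] V[of i] dec[OF i'(1)] i i' d by auto
    then show ?thesis
      using kth_largest_greater_iff[of "{..<p}" "k0 + (i - 1)" "kth_largest {..<p} ?u (k0 + i)" ?u] i' i d card_S
      by auto
  qed
  have "T (k0 + i) \<omega> = kth_largest {..<p} ?u (k0 + i) *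
      (kth_largest {..<p} ?u (k0 + i) - kth_largest {..<p} ?u (Suc (k0 + i))) / \<sigma>\<^sup>2"
    unfolding T_def
  proof (rule covariance_test_no_ties[OF orth refl])
    show "kth_largest {..<p} ?u (k0 + i) > kth_largest {..<p} ?u (Suc (k0 + i))"
      using V[of i] V[of "Suc i"] dec[OF i] i d by auto
  qed (use i d card_S count in auto)
  also have "\<dots> = Q i \<omega> * (Q i \<omega> - Q (Suc i) \<omega>)"
    using V[of i] V[of "Suc i"] i d sigma_pos by (simp add: field_simps power2_eq_square)
  finally show ?thesis .
qed

text \<open>Order statistics decrease with the rank, so one lower bound \<open>L\<close> on the last
  one involved, number \<open>Suc d\<close>, controls all \<open>d\<close> errors.\<close>

lemma T_approx:
  assumes \<omega>: "\<omega> \<in> B" and d: "d < card S" and pos: "\<forall>i\<in>{1..d}. D i \<omega> > 0" and i: "i \<in> {1..d}"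
    and K: "D i \<omega> \<le> K" and L: "L > 0" "Q (Suc d) \<omega> > L"
  shows "\<bar>T (k0 + i) \<omega> - D i \<omega>\<bar> \<le> (K + K\<^sup>2) / L\<^sup>2"
proof -
  have "Q (Suc d) \<omega> \<le> Q (Suc i) \<omega>"
    unfolding Q_def using i d by (intro kth_largest_antimono[OF finite_S]) auto
  then have Q: "Q (Suc i) \<omega> \<ge> L" "Q (Suc i) \<omega> > 0" using L by auto
  have "Q (Suc i) \<omega> < Q i \<omega>" using Q_less_iff[of i \<omega>] pos i d by auto
  then have "\<bar>Q i \<omega> * (Q i \<omega> - Q (Suc i) \<omega>) - D i \<omega>\<bar> \<le> (D i \<omega> + (D i \<omega>)\<^sup>2) / (Q (Suc i) \<omega>)\<^sup>2"
    using spacing_approx[OF Q(2)] D_eq[of i \<omega>] i d by auto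
  also have "\<dots> \<le> (K + K\<^sup>2) / L\<^sup>2"
  proof -
    have "0 < D i \<omega>" using pos i by blast
    then show ?thesis using K Q L by (intro frac_le add_mono power_mono) auto
  qed
  finally show ?thesis using T_eq[OF \<omega> d pos i] by simp
qed

lemma indep_hazard: "indep_vars (\<lambda>_. borel) (\<lambda>j \<omega>. cum_hazard \<bar>Y j \<omega>\<bar>) S"
proof -
  \<comment> \<open>Measurability of the transform on the whole line is read off from its law under
    the standard normal distribution.\<close>
  have m: "(\<lambda>z. cum_hazard \<bar>z\<bar>) \<in> borel_measurable borel"
  proof -
    have "real_distribution std_normal_distribution" by (rule real_dist_normal_dist)
    then interpret N: real_distribution std_normal_distribution .
    have "distr std_normal_distribution borel (\<lambda>z. z) = std_normal_distribution"
      by (rule distr_id2) simp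
    then have "distributed std_normal_distribution lborel (\<lambda>z. cum_hazard \<bar>z\<bar>) (exponential_density 1)"
      by (intro N.distributed_cum_hazard) auto
    then show ?thesis by (simp add: distributed_def)
  qed
  have "indep_vars (\<lambda>_. borel) Y S"
    by (rule indep_vars_subset[OF indep_Y]) (auto simp: S_def)
  then show ?thesis by (rule indep_vars_compose2[where Y="\<lambda>_ z. cum_hazard \<bar>z\<bar>"]) (rule m)
qed

lemma distributed_hazard: "j \<in> S \<Longrightarrow> distributed M lborel (\<lambda>\<omega>. cum_hazard \<bar>Y j \<omega>\<bar>) (exponential_density 1)"
  by (intro distributed_cum_hazard distr_Y measurable_Y) (auto simp: S_def)

lemma spacings_law:
  assumes "d < card S"
  shows "distr M (Pi\<^sub>M {1..d} (\<lambda>_. borel)) (\<lambda>\<omega>. \<lambda>i\<in>{1..d}. D i \<omega>) = Pi\<^sub>M {1..d} (\<lambda>i. Exp_dist (1 / real i))"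
    and "\<And>i t. i \<in> {1..d} \<Longrightarrow> t \<ge> 0 \<Longrightarrow> \<P>(\<omega> in M. D i \<omega> > t) = exp (- real i * t)"
    and "AE \<omega> in M. \<forall>i\<in>{1..d}. D i \<omega> > 0"
  using renyi_spacings[OF finite_S assms indep_hazard distributed_hazard] by (simp_all add: D_def)

lemma measurable_D: "1 \<le> i \<Longrightarrow> i < card S \<Longrightarrow> D i \<in> borel_measurable M"
  unfolding D_def
  by (intro measurable_spacing finite_S) (auto dest!: distributed_hazard simp: distributed_def)

lemma measurable_Q: "1 \<le> i \<Longrightarrow> i \<le> card S \<Longrightarrow> Q i \<in> borel_measurable M"
  unfolding Q_def
  by (intro measurable_kth_largest finite_S borel_measurable_abs measurable_Y) (auto simp: S_def)

lemma prob_Q_le: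
  assumes "d < card S"
  shows "\<P>(\<omega> in M. Q (Suc d) \<omega> \<le> L) \<le> 2 ^ d * (1 - normal_tail L / 2) ^ (p - k0)"
proof -
  have "indep_vars (\<lambda>_. borel) Y S"
    by (rule indep_vars_subset[OF indep_Y]) (auto simp: S_def)
  then have "indep_vars (\<lambda>_. borel) (\<lambda>j \<omega>. \<bar>Y j \<omega>\<bar>) S"
    by (rule indep_vars_compose2[where Y="\<lambda>_. abs"]) measurable
  then show ?thesis
    unfolding Q_def card_S[symmetric]
    by (rule prob_kth_largest_le[OF finite_S assms]) (rule prob_abs_Y, simp add: S_def)
qed

text \<open>Coupling bound: off a small exceptional event the test statistics are close to the spacings.\<close>

lemma expectation_test_statistics_approx:
  fixes f :: "(nat \<Rightarrow> real) \<Rightarrow> real"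
  assumes d: "d < card S"
    and f: "f \<in> borel_measurable (Pi\<^sub>M {1..d} (\<lambda>_. borel))"
    and C: "\<And>v. v \<in> {1..d} \<rightarrow>\<^sub>E UNIV \<Longrightarrow> \<bar>f v\<bar> \<le> C"
    and K: "K \<ge> 0" and L: "L > 0" and \<epsilon>: "\<epsilon> \<ge> 0"
    and cont: "\<And>u v. u \<in> {1..d} \<rightarrow>\<^sub>E UNIV \<Longrightarrow> v \<in> {1..d} \<rightarrow>\<^sub>E UNIV \<Longrightarrow>
      (\<And>i. i \<in> {1..d} \<Longrightarrow> 0 \<le> u i \<and> u i \<le> K \<and> \<bar>v i - u i\<bar> \<le> (K + K\<^sup>2) / L\<^sup>2) \<Longrightarrow> \<bar>f v - f u\<bar> \<le> \<epsilon>"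
  shows "\<bar>(\<integral>v. f v \<partial>distr M (Pi\<^sub>M {1..d} (\<lambda>_. borel)) (\<lambda>\<omega>. \<lambda>i\<in>{1..d}. T (k0 + i) \<omega>)) -
      (\<integral>v. f v \<partial>Pi\<^sub>M {1..d} (\<lambda>i. Exp_dist (1 / real i)))\<bar>
    \<le> \<epsilon> + 2 * C * (prob (space M - B) + real d * exp (- K) + 2 ^ d * (1 - normal_tail L / 2) ^ (p - k0))"
proof -
  let ?P = "Pi\<^sub>M {1..d} (\<lambda>_. borel :: real measure)"
  let ?T = "\<lambda>\<omega>. \<lambda>i\<in>{1..d}. T (k0 + i) \<omega>" and ?D = "\<lambda>\<omega>. \<lambda>i\<in>{1..d}. D i \<omega>"
  have C0: "C \<ge> 0" using C[of "\<lambda>i\<in>{1..d}. 0"] by auto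
  have Tm: "?T \<in> M \<rightarrow>\<^sub>M ?P" using d card_S by (intro measurable_restrict measurable_T) auto
  have Dm: "?D \<in> M \<rightarrow>\<^sub>M ?P" using d by (intro measurable_restrict measurable_D) auto
  have fT: "(\<lambda>\<omega>. f (?T \<omega>)) \<in> borel_measurable M" by (rule measurable_compose[OF Tm f])
  have fD: "(\<lambda>\<omega>. f (?D \<omega>)) \<in> borel_measurable M" by (rule measurable_compose[OF Dm f])
  have intT: "integrable M (\<lambda>\<omega>. f (?T \<omega>))"
    using C by (intro integrable_const_bound[of _ C] fT) auto
  have intD: "integrable M (\<lambda>\<omega>. f (?D \<omega>))"
    using C by (intro integrable_const_bound[of _ C] fD) auto
  \<comment> \<open>The exceptional events: a spacing too large for the error bound, the lowest
    order statistic involved too small, or failure of separation.\<close>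
  define E1 where "E1 = (\<Union>i\<in>{1..d}. {\<omega> \<in> space M. D i \<omega> > K})"
  define E2 where "E2 = {\<omega> \<in> space M. Q (Suc d) \<omega> \<le> L}"
  define E where "E = (space M - B) \<union> E1 \<union> E2"
  have Dev: "{\<omega> \<in> space M. D i \<omega> > K} \<in> events" if "i \<in> {1..d}" for i
  proof -
    have [measurable]: "D i \<in> borel_measurable M" using that d by (intro measurable_D) auto
    show ?thesis by measurable
  qed
  have E1: "E1 \<in> events" unfolding E1_def using Dev by (intro sets.finite_UN) auto
  have E2: "E2 \<in> events"
  proof -
    have [measurable]: "Q (Suc d) \<in> borel_measurable M" using d by (intro measurable_Q) auto
    show ?thesis unfolding E2_def by measurable
  qed
  have E: "E \<in> events" unfolding E_def using E1 E2 B_events by auto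
  have "prob E1 \<le> (\<Sum>i\<in>{1..d}. prob {\<omega> \<in> space M. D i \<omega> > K})"
    unfolding E1_def using Dev by (intro measure_UNION_le) auto
  also have "\<dots> \<le> (\<Sum>i\<in>{1..d}. exp (- K))"
  proof (intro sum_mono)
    fix i assume i: "i \<in> {1..d}"
    \<comment> \<open>As \<open>i \<ge> 1\<close>, every tail \<open>exp (- real i * K)\<close> is
      at most \<open>exp (- K)\<close>; this common bound produces the factor
      \<open>d\<close>.\<close>
    then have "1 * K \<le> real i * K" using K by (intro mult_right_mono) auto
    then show "prob {\<omega> \<in> space M. D i \<omega> > K} \<le> exp (- K)"
      using spacings_law(2)[OF d i K] by simp
  qed
  finally have "prob E1 \<le> real d * exp (- K)" by simp
  moreover have "prob E2 \<le> 2 ^ d * (1 - normal_tail L / 2) ^ (p - k0)"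
    unfolding E2_def by (rule prob_Q_le[OF d])
  moreover have "prob E \<le> prob (space M - B) + prob E1 + prob E2"
    unfolding E_def using E1 E2 B_events
    by (intro order_trans[OF measure_Un_le] add_mono order_refl) auto
  ultimately have PE: "prob E \<le> prob (space M - B) + real d * exp (- K) + 2 ^ d * (1 - normal_tail L / 2) ^ (p - k0)"
    by linarith
  have pt: "AE \<omega> in M. \<bar>f (?T \<omega>) - f (?D \<omega>)\<bar> \<le> \<epsilon> + 2 * C * indicator E \<omega>"
    using spacings_law(3)[OF d] AE_space
  proof eventually_elim
    case (elim \<omega>)
    show ?case
    proof (cases "\<omega> \<in> E")
      case True
      have "\<bar>f (?T \<omega>)\<bar> \<le> C" "\<bar>f (?D \<omega>)\<bar> \<le> C" by (auto intro: C)
      then show ?thesis using True \<epsilon> by simp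
    next
      case False
      then have "\<omega> \<in> B" "\<forall>i\<in>{1..d}. \<not> D i \<omega> > K" "\<not> Q (Suc d) \<omega> \<le> L"
        using elim(2) unfolding E_def E1_def E2_def by blast+
      then have \<omega>: "\<omega> \<in> B" "\<And>i. i \<in> {1..d} \<Longrightarrow> D i \<omega> \<le> K" "Q (Suc d) \<omega> > L"
        by (simp_all add: not_less not_le)
      have "\<bar>f (?T \<omega>) - f (?D \<omega>)\<bar> \<le> \<epsilon>"
      proof (rule cont)
        fix i assume i: "i \<in> {1..d}"
        show "0 \<le> ?D \<omega> i \<and> ?D \<omega> i \<le> K \<and> \<bar>?T \<omega> i - ?D \<omega> i\<bar> \<le> (K + K\<^sup>2) / L\<^sup>2"
        proof -
          have "0 < D i \<omega>" using elim(1) i by blast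
          then show ?thesis
            using T_approx[OF \<omega>(1) d elim(1) i \<omega>(2)[OF i] L \<omega>(3)] \<omega>(2)[OF i] i
            by (simp del: atLeastAtMost_iff)
        qed
      qed auto
      then show ?thesis using False by simp
    qed
  qed
  have intE: "integrable M (\<lambda>\<omega>. \<epsilon> + 2 * C * indicator E \<omega>)"
    using E by (intro Bochner_Integration.integrable_add integrable_mult_right) (auto simp: emeasure_eq_measure)
  have "(\<integral>v. f v \<partial>distr M ?P ?T) = expectation (\<lambda>\<omega>. f (?T \<omega>))" by (rule integral_distr[OF Tm f])
  moreover have "(\<integral>v. f v \<partial>Pi\<^sub>M {1..d} (\<lambda>i. Exp_dist (1 / real i))) = expectation (\<lambda>\<omega>. f (?D \<omega>))"
    unfolding spacings_law(1)[OF d, symmetric] by (rule integral_distr[OF Dm f])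
  moreover have "\<bar>expectation (\<lambda>\<omega>. f (?T \<omega>)) - expectation (\<lambda>\<omega>. f (?D \<omega>))\<bar> \<le>
      expectation (\<lambda>\<omega>. \<bar>f (?T \<omega>) - f (?D \<omega>)\<bar>)"
    using integral_abs_bound[of M "\<lambda>\<omega>. f (?T \<omega>) - f (?D \<omega>)"]
    unfolding Bochner_Integration.integral_diff[OF intT intD] .
  moreover have "expectation (\<lambda>\<omega>. \<bar>f (?T \<omega>) - f (?D \<omega>)\<bar>) \<le> expectation (\<lambda>\<omega>. \<epsilon> + 2 * C * indicator E \<omega>)"
    using intT intD intE pt by (intro integral_mono_AE) auto
  moreover have "expectation (\<lambda>\<omega>. \<epsilon> + 2 * C * indicator E \<omega>) = \<epsilon> + 2 * C * prob E"
    using E sets.sets_into_space[OF E] by (simp add: prob_space emeasure_eq_measure Int_absorb2)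
  moreover have "2 * C * prob E \<le> 2 * C * (prob (space M - B) + real d * exp (- K) + 2 ^ d * (1 - normal_tail L / 2) ^ (p - k0))"
    using PE C0 by (intro mult_left_mono) auto
  ultimately show ?thesis by linarith
qed

text \<open>Multiplying by \<open>prob B\<close> turns the conditional expectation into an integral
  over \<open>B\<close>, which misses only the part off \<open>B\<close>, of size at most
  \<open>C * (1 - prob B)\<close>. The division is postponed to the limit.\<close>

lemma uniform_measure_test_statistics_approx:
  fixes f :: "(nat \<Rightarrow> real) \<Rightarrow> real"
  assumes d: "d < card S"
    and f: "f \<in> borel_measurable (Pi\<^sub>M {1..d} (\<lambda>_. borel))"
    and C: "\<And>v. v \<in> {1..d} \<rightarrow>\<^sub>E UNIV \<Longrightarrow> \<bar>f v\<bar> \<le> C"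
    and B: "prob B > 0"
  shows "\<bar>prob B * (\<integral>v. f v \<partial>distr (uniform_measure M B) (Pi\<^sub>M {1..d} (\<lambda>_. borel)) (\<lambda>\<omega>. \<lambda>i\<in>{1..d}. T (k0 + i) \<omega>)) -
      (\<integral>v. f v \<partial>distr M (Pi\<^sub>M {1..d} (\<lambda>_. borel)) (\<lambda>\<omega>. \<lambda>i\<in>{1..d}. T (k0 + i) \<omega>))\<bar> \<le> C * (1 - prob B)"
proof -
  let ?P = "Pi\<^sub>M {1..d} (\<lambda>_. borel :: real measure)" and ?T = "\<lambda>\<omega>. \<lambda>i\<in>{1..d}. T (k0 + i) \<omega>"
  have Tm: "?T \<in> M \<rightarrow>\<^sub>M ?P" using d card_S by (intro measurable_restrict measurable_T) auto
  have Tm': "?T \<in> uniform_measure M B \<rightarrow>\<^sub>M ?P" using Tm by simp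
  have fT: "(\<lambda>\<omega>. f (?T \<omega>)) \<in> borel_measurable M" by (rule measurable_compose[OF Tm f])
  have intT: "integrable M (\<lambda>\<omega>. f (?T \<omega>))"
    using C by (intro integrable_const_bound[of _ C] fT) auto
  have intBT: "integrable M (\<lambda>\<omega>. indicator B \<omega> * f (?T \<omega>))"
    using integrable_mult_indicator[OF B_events intT] by simp
  \<comment> \<open>The extended-real density is replaced by a real-valued one, the form to which
    \<open>integral_density\<close> applies.\<close>
  have dens: "uniform_measure M B = density M (\<lambda>\<omega>. ennreal (indicator B \<omega> / prob B))"
    unfolding uniform_measure_def
  proof (rule density_cong)
    note [measurable] = B_events
    show "(\<lambda>\<omega>. indicator B \<omega> / emeasure M B) \<in> borel_measurable M" by measurable
    show "(\<lambda>\<omega>. ennreal (indicator B \<omega> / prob B)) \<in> borel_measurable M" by measurable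
    show "AE \<omega> in M. indicator B \<omega> / emeasure M B = ennreal (indicator B \<omega> / prob B)"
      using B by (auto simp: emeasure_eq_measure indicator_def divide_ennreal ennreal_1[symmetric] simp del: ennreal_1)
  qed
  have "(\<integral>v. f v \<partial>distr (uniform_measure M B) ?P ?T) = (\<integral>\<omega>. f (?T \<omega>) \<partial>uniform_measure M B)"
    by (rule integral_distr[OF Tm' f])
  also have "\<dots> = (\<integral>\<omega>. (indicator B \<omega> / prob B) *\<^sub>R f (?T \<omega>) \<partial>M)"
    unfolding dens using B_events by (intro integral_density fT) auto
  also have "\<dots> = (\<integral>\<omega>. indicator B \<omega> * f (?T \<omega>) \<partial>M) / prob B"
    by simp
  finally have "prob B * (\<integral>v. f v \<partial>distr (uniform_measure M B) ?P ?T) = (\<integral>\<omega>. indicator B \<omega> * f (?T \<omega>) \<partial>M)"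
    using B by simp
  moreover have "(\<integral>v. f v \<partial>distr M ?P ?T) = (\<integral>\<omega>. f (?T \<omega>) \<partial>M)"
    by (rule integral_distr[OF Tm f])
  moreover have "\<bar>(\<integral>\<omega>. indicator B \<omega> * f (?T \<omega>) \<partial>M) - (\<integral>\<omega>. f (?T \<omega>) \<partial>M)\<bar> \<le>
      (\<integral>\<omega>. \<bar>indicator B \<omega> * f (?T \<omega>) - f (?T \<omega>)\<bar> \<partial>M)"
    using integral_abs_bound[of M "\<lambda>\<omega>. indicator B \<omega> * f (?T \<omega>) - f (?T \<omega>)"]
    unfolding Bochner_Integration.integral_diff[OF intBT intT] .
  moreover have "(\<integral>\<omega>. \<bar>indicator B \<omega> * f (?T \<omega>) - f (?T \<omega>)\<bar> \<partial>M) \<le> (\<integral>\<omega>. C * indicator (space M - B) \<omega> \<partial>M)"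
  proof (rule integral_mono)
    fix \<omega> assume "\<omega> \<in> space M"
    moreover have "\<bar>f (?T \<omega>)\<bar> \<le> C" by (rule C) auto
    ultimately show "\<bar>indicator B \<omega> * f (?T \<omega>) - f (?T \<omega>)\<bar> \<le> C * indicator (space M - B) \<omega>"
      by (auto simp: indicator_def)
  qed (use intT intBT B_events in \<open>auto simp: emeasure_eq_measure\<close>)
  moreover have "(\<integral>\<omega>. C * indicator (space M - B) \<omega> \<partial>M) = C * (1 - prob B)"
    using B_events by (simp add: prob_compl Diff_Int_distrib2)
  ultimately show ?thesis by linarith
qed

end

section \<open>Convergence in distribution\<close>

text \<open>Test functions are continuous for the product topology on extensional functions.
  Composing with \<open>restrict\<close> makes them continuous on the type of all functions, where
  topology and metric come from the type classes.\<close>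

lemma continuous_on_restrict_powertop:
  fixes f :: "('i::countable \<Rightarrow> real) \<Rightarrow> real"
  assumes "continuous_map (powertop_real I) euclideanreal f"
  shows "continuous_on UNIV (\<lambda>x. f (restrict x I))"
proof -
  have "continuous_map euclidean (powertop_real I) (\<lambda>x. restrict x I)"
    unfolding continuous_map_componentwise
  proof (intro conjI ballI)
    fix k assume "k \<in> I"
    then have "(\<lambda>x :: 'i \<Rightarrow> real. restrict x I k) = (\<lambda>x. x k)" by auto
    then show "continuous_map euclidean euclideanreal (\<lambda>x. restrict x I k)"
      by (simp add: continuous_on_product_coordinates)
  qed auto
  from continuous_map_compose[OF this assms] show ?thesis by (simp add: o_def)
qed

lemma restrict_extend:
  assumes "x \<in> I \<rightarrow>\<^sub>E UNIV"
  shows "restrict (\<lambda>i. if i \<in> I then x i else 0) I = x"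
  using assms by (auto simp: fun_eq_iff PiE_def extensional_def)

text \<open>On the full countable product the Borel sets are the product sigma-algebra. Padding with
  0 carries measurability over to the index set \<open>I\<close>, since \<open>restrict\<close>
  undoes the padding.\<close>

lemma continuous_map_powertop_measurable:
  fixes f :: "('i::countable \<Rightarrow> real) \<Rightarrow> real"
  assumes "continuous_map (powertop_real I) euclideanreal f"
  shows "f \<in> borel_measurable (Pi\<^sub>M I (\<lambda>_. borel))"
proof -
  have "(\<lambda>x. f (restrict x I)) \<in> borel_measurable borel"
    by (intro borel_measurable_continuous_onI continuous_on_restrict_powertop assms)
  then have g: "(\<lambda>x. f (restrict x I)) \<in> borel_measurable (Pi\<^sub>M UNIV (\<lambda>_. borel))"
    by (simp add: measurable_cong_sets[OF sets_PiM_equal_borel refl])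
  have "(\<lambda>x i. if i \<in> I then x i else 0) \<in> Pi\<^sub>M I (\<lambda>_. borel) \<rightarrow>\<^sub>M Pi\<^sub>M UNIV (\<lambda>_. borel :: real measure)"
  proof (rule measurable_PiM_single')
    fix i :: 'i
    show "(\<lambda>x. if i \<in> I then x i else 0 :: real) \<in> borel_measurable (Pi\<^sub>M I (\<lambda>_. borel))"
      by (cases "i \<in> I") auto
  qed (auto simp: space_PiM)
  from measurable_compose[OF this g] show ?thesis
    by (subst measurable_cong) (auto simp: space_PiM restrict_extend)
qed

text \<open>The metric sums the coordinate distances, truncated at 1, with weights
  \<open>(1 / 2) ^ n\<close> of total 2.\<close>

lemma dist_fun_le:
  fixes u v :: "'i::countable \<Rightarrow> real"
  assumes "\<And>i. \<bar>u i - v i\<bar> \<le> \<delta>"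
  shows "dist u v \<le> 2 * \<delta>"
proof -
  have geo: "(\<lambda>n. (1 / 2 :: real) ^ n * \<delta>) sums (2 * \<delta>)"
    using sums_mult2[OF geometric_sums[of "1 / 2 :: real"], of \<delta>] by simp
  have le: "(1 / 2) ^ n * min (dist (u (from_nat n)) (v (from_nat n))) 1 \<le> (1 / 2) ^ n * \<delta>" for n
    using assms[of "from_nat n"] by (intro mult_left_mono) (auto simp: dist_real_def min_le_iff_disj)
  have "summable (\<lambda>n. (1 / 2) ^ n * min (dist (u (from_nat n)) (v (from_nat n))) 1)"
    by (rule summable_comparison_test'[OF sums_summable[OF geo], of 0]) (use le in \<open>auto simp: abs_mult\<close>)
  then show ?thesis
    unfolding dist_fun_def sums_unique[OF geo] by (intro suminf_le le sums_summable[OF geo])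
qed

text \<open>A bounded continuous function need not be uniformly continuous, so \<open>u\<close> is
  confined to a compact box. This is why large spacings are treated as exceptional in the
  coupling.\<close>

lemma continuous_map_powertop_uniform:
  fixes f :: "('i::countable \<Rightarrow> real) \<Rightarrow> real"
  assumes f: "continuous_map (powertop_real I) euclideanreal f" and "\<epsilon> > 0"
  obtains \<delta> where "\<delta> > 0"
    and "\<And>u v. u \<in> I \<rightarrow>\<^sub>E UNIV \<Longrightarrow> v \<in> I \<rightarrow>\<^sub>E UNIV \<Longrightarrow>
      (\<And>i. i \<in> I \<Longrightarrow> 0 \<le> u i \<and> u i \<le> K \<and> \<bar>v i - u i\<bar> \<le> \<delta>) \<Longrightarrow> \<bar>f v - f u\<bar> \<le> \<epsilon>"
proof -
  let ?g = "\<lambda>x. f (restrict x I)" and ?ext = "\<lambda>x i. if i \<in> I then x i else (0::real)"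
  \<comment> \<open>The margin 1 leaves room for \<open>v\<close>, which may leave the range of
    \<open>u\<close> by \<open>\<delta> \<le> 1\<close>; the absolute value keeps the padding value
    0 in the box for every \<open>K\<close>.\<close>
  let ?K = "{- 1 .. \<bar>K\<bar> + 1}"
  have "compactin (product_topology (\<lambda>_. euclideanreal) UNIV) (\<Pi>\<^sub>E i\<in>(UNIV :: 'i set). ?K)"
    by (simp add: compactin_PiE)
  then have "compact (\<Pi>\<^sub>E i\<in>(UNIV :: 'i set). ?K)"
    by (simp add: euclidean_product_topology)
  then have "uniformly_continuous_on (\<Pi>\<^sub>E i\<in>(UNIV :: 'i set). ?K) ?g"
    using continuous_on_restrict_powertop[OF f] continuous_on_subset
    by (intro compact_uniformly_continuous) blast+
  then obtain \<delta>0 where "\<delta>0 > 0" and \<delta>0: "\<And>x x'. x \<in> (\<Pi>\<^sub>E i\<in>UNIV. ?K) \<Longrightarrow> x' \<in> (\<Pi>\<^sub>E i\<in>UNIV. ?K) \<Longrightarrow>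
      dist x' x < \<delta>0 \<Longrightarrow> dist (?g x') (?g x) < \<epsilon>"
    using \<open>\<epsilon> > 0\<close> unfolding uniformly_continuous_on_def by metis
  \<comment> \<open>Coordinatewise distance \<open>\<delta>\<close> costs
    \<open>2 * \<delta>\<close> in the metric, which has to stay strictly below
    \<open>\<delta>0\<close>.\<close>
  define \<delta> where "\<delta> = min 1 (\<delta>0 / 3)"
  have \<delta>: "\<delta> > 0" "\<delta> \<le> 1" "2 * \<delta> < \<delta>0" using \<open>\<delta>0 > 0\<close> by (auto simp: \<delta>_def min_def)
  show ?thesis
  proof (rule that[OF \<delta>(1)])
    fix u v assume uv: "u \<in> I \<rightarrow>\<^sub>E UNIV" "v \<in> I \<rightarrow>\<^sub>E UNIV"
      and close: "\<And>i. i \<in> I \<Longrightarrow> 0 \<le> u i \<and> u i \<le> K \<and> \<bar>v i - u i\<bar> \<le> \<delta>"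
    have "?ext u i \<in> ?K \<and> ?ext v i \<in> ?K \<and> \<bar>?ext v i - ?ext u i\<bar> \<le> \<delta>" for i
      using close[of i] \<delta> by (cases "i \<in> I") auto
    then have "?ext u \<in> (\<Pi>\<^sub>E i\<in>UNIV. ?K)" "?ext v \<in> (\<Pi>\<^sub>E i\<in>UNIV. ?K)" "dist (?ext v) (?ext u) \<le> 2 * \<delta>"
      by (auto intro!: dist_fun_le simp del: atLeastAtMost_iff)
    then have "dist (?g (?ext v)) (?g (?ext u)) < \<epsilon>" using \<delta> by (intro \<delta>0) auto
    then show "\<bar>f v - f u\<bar> \<le> \<epsilon>"
      by (simp add: restrict_extend uv dist_real_def)
  qed
qed

section \<open>Passage to the limit in \<open>p\<close>\<close>

theorem theorem1:
  fixes M :: "nat \<Rightarrow> 'a measure"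
    and n :: "nat \<Rightarrow> nat"
    and X :: "nat \<Rightarrow> nat \<Rightarrow> nat \<Rightarrow> real"
    and \<beta> :: "nat \<Rightarrow> nat \<Rightarrow> real"
    and \<epsilon> y U :: "nat \<Rightarrow> 'a \<Rightarrow> nat \<Rightarrow> real"
    and \<sigma> :: real
    and k0 :: nat
    and A :: "nat \<Rightarrow> nat set"
    and B :: "nat \<Rightarrow> 'a set"
    and T :: "nat \<Rightarrow> nat \<Rightarrow> 'a \<Rightarrow> real"
  assumes "\<sigma> > 0"
    and "\<And>p. p \<ge> k0 \<Longrightarrow> prob_space (M p)"
    and "\<And>p. p \<ge> k0 \<Longrightarrow> n p \<ge> p"
    and "\<And>p. p \<ge> k0 \<Longrightarrow> orthogonal_design (n p) p (X p)"
    and "\<And>p. p \<ge> k0 \<Longrightarrow> gaussian_noise (M p) (n p) \<sigma> (\<epsilon> p)"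
    and "\<And>p \<omega> i. p \<ge> k0 \<Longrightarrow> \<omega> \<in> space (M p) \<Longrightarrow> i < n p \<Longrightarrow>
           y p \<omega> i = mat_vec (X p) {..<p} (\<beta> p) i + \<epsilon> p \<omega> i"
    and A_def: "\<And>p. A p = supp p (\<beta> p)"
    and "\<And>p. p \<ge> k0 \<Longrightarrow> card (A p) = k0"
    and "(\<lambda>p. (INF j\<in>A p. ereal \<bar>\<beta> p j\<bar>) - ereal (\<sigma> * sqrt (2 * ln (real p)))) \<longlonglongrightarrow> \<infinity>"
    and U_def: "\<And>p \<omega> j. U p \<omega> j = dotp (n p) (mat_col (X p) j) (y p \<omega>)"
    and B_def: "\<And>p. B p = separation_event (M p) p (A p) (U p)"
    and T_def: "\<And>p k \<omega>. T p k \<omega> = covariance_test (n p) p (X p) (y p \<omega>) \<sigma> k"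
  shows "((\<lambda>p. measure (M p) (B p)) \<longlonglongrightarrow> 1) \<and>
         (\<forall>d. weak_conv_vec {1..d}
           (\<lambda>p. distr (M p) (PiM {1..d} (\<lambda>_. borel)) (\<lambda>\<omega>. \<lambda>i\<in>{1..d}. T p (k0 + i) \<omega>))
           (PiM {1..d} (\<lambda>i. Exp_dist (1 / real i)))) \<and>
         (\<forall>d. weak_conv_vec {1..d}
           (\<lambda>p. distr (uniform_measure (M p) (B p)) (PiM {1..d} (\<lambda>_. borel))
                  (\<lambda>\<omega>. \<lambda>i\<in>{1..d}. T p (k0 + i) \<omega>))
           (PiM {1..d} (\<lambda>i. Exp_dist (1 / real i))))"
proof -
  \<comment> \<open>Only large \<open>p\<close> matter for the limits; \<open>p > k0\<close> also
    makes \<open>p\<close> positive, as the locale demands.\<close>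
  have model: "orthogonal_lasso_model (M p) (n p) p (X p) (\<beta> p) (\<epsilon> p) (y p) \<sigma> k0" if "p > k0" for p
    using assms that
    by (intro orthogonal_lasso_model.intro orthogonal_lasso_model_axioms.intro) auto
  have A_eq: "orthogonal_lasso_model.A p (\<beta> p) = A p" if "p > k0" for p
    using orthogonal_lasso_model.A_def[OF model[OF that]] A_def by simp
  have U_eq: "orthogonal_lasso_model.U (n p) (X p) (y p) = U p" if "p > k0" for p
    using orthogonal_lasso_model.U_def[OF model[OF that]] U_def by (intro ext) simp
  have B_eq: "orthogonal_lasso_model.B (M p) (n p) p (X p) (\<beta> p) (y p) = B p" if "p > k0" for p
    using orthogonal_lasso_model.B_def[OF model[OF that]] B_def A_eq[OF that] U_eq[OF that] by simp
  have T_eq: "orthogonal_lasso_model.T (n p) p (X p) (y p) \<sigma> = T p" if "p > k0" for p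
    using orthogonal_lasso_model.T_def[OF model[OF that]] T_def by (intro ext) simp
  have card_S: "d < card (orthogonal_lasso_model.S p (\<beta> p))" if "p > k0 + d" for p d
    using orthogonal_lasso_model.card_S[OF model, of p] that by simp
  let ?not_B = "\<lambda>p. measure (M p) (space (M p) - B p)"
  have not_B: "?not_B \<longlonglongrightarrow> 0"
  proof (rule tendstoI)
    fix e :: real assume "e > 0"
    have "((\<lambda>r. real k0 * normal_tail r) \<longlongrightarrow> real k0 * 0) at_top"
      by (intro tendsto_intros normal_tail_tendsto_0)
    then have "\<forall>\<^sub>F r in at_top. real k0 * normal_tail r < e / 2"
      using \<open>e > 0\<close> by (intro order_tendstoD(2)) auto
    \<comment> \<open>\<open>r\<close> is fixed before \<open>p\<close> grows: the divergent margin
      eventually exceeds \<open>\<sigma> * r\<close>, however large \<open>r\<close> is.\<close>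
    then obtain r where r: "real k0 * normal_tail r < e / 2"
      using eventually_happens by fastforce
    have "\<forall>\<^sub>F p in sequentially. ereal (\<sigma> * r) < (INF j\<in>A p. ereal \<bar>\<beta> p j\<bar>) - ereal (\<sigma> * sqrt (2 * ln (real p)))"
      using assms(9) by (simp add: tendsto_PInfty)
    moreover have "\<forall>\<^sub>F p in sequentially. real p * normal_tail (sqrt (2 * ln (real p))) < e / 2"
      using tail_at_sqrt_log_tendsto_0 \<open>e > 0\<close> by (intro order_tendstoD(2)) auto
    ultimately show "\<forall>\<^sub>F p in sequentially. dist (?not_B p) 0 < e"
      using eventually_gt_at_top[of k0]
    proof eventually_elim
      case (elim p)
      have gap: "\<bar>\<beta> p j\<bar> > \<sigma> * r + \<sigma> * sqrt (2 * ln (real p))" if "j \<in> A p" for j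
      proof -
        have "ereal (\<sigma> * r) < (INF j\<in>A p. ereal \<bar>\<beta> p j\<bar>) - ereal (\<sigma> * sqrt (2 * ln (real p)))" by (fact elim(1))
        also have "\<dots> \<le> ereal \<bar>\<beta> p j\<bar> - ereal (\<sigma> * sqrt (2 * ln (real p)))"
          using that by (intro ereal_minus_mono INF_lower order_refl)
        finally show ?thesis by simp
      qed
      have "?not_B p \<le> real k0 * normal_tail r + real p * normal_tail (sqrt (2 * ln (real p)))"
        using orthogonal_lasso_model.prob_not_B[OF model[OF elim(3)], unfolded A_eq[OF elim(3)] B_eq[OF elim(3)], OF gap]
        by simp
      then show ?case using r elim(2) by (simp add: dist_real_def)
    qed
  qed
  have prob_B: "measure (M p) (B p) = 1 - ?not_B p" if "p > k0" for p
  proof -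
    have "B p \<in> sets (M p)"
      using orthogonal_lasso_model.B_events[OF model[OF that]] B_eq[OF that] by simp
    then show ?thesis using prob_space.prob_compl[OF assms(2), of p "B p"] that by simp
  qed
  have lim_B: "(\<lambda>p. measure (M p) (B p)) \<longlonglongrightarrow> 1"
  proof (rule Lim_transform_eventually)
    show "(\<lambda>p. 1 - ?not_B p) \<longlonglongrightarrow> 1" using tendsto_diff[OF tendsto_const not_B, of 1] by simp
    show "\<forall>\<^sub>F p in sequentially. 1 - ?not_B p = measure (M p) (B p)"
      using eventually_gt_at_top[of k0] by eventually_elim (simp add: prob_B)
  qed
  let ?P = "\<lambda>d. Pi\<^sub>M {1..d} (\<lambda>_. borel :: real measure)" and ?T = "\<lambda>d p \<omega>. \<lambda>i\<in>{1..d}. T p (k0 + i) \<omega>"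
    and ?\<nu> = "\<lambda>d. Pi\<^sub>M {1..d} (\<lambda>i. Exp_dist (1 / real i))"
  have bounded: "\<exists>C\<ge>0. \<forall>v \<in> {1..d} \<rightarrow>\<^sub>E UNIV. \<bar>f v\<bar> \<le> C"
    if "bounded (f ` ({1..d} \<rightarrow>\<^sub>E UNIV))" for f :: "(nat \<Rightarrow> real) \<Rightarrow> real" and d :: nat
    using that by (auto simp: bounded_pos intro: less_imp_le)
  have weak: "(\<lambda>p. \<integral>v. f v \<partial>distr (M p) (?P d) (?T d p)) \<longlonglongrightarrow> (\<integral>v. f v \<partial>?\<nu> d)"
    if f: "continuous_map (powertop_real {1..d}) euclideanreal f" "bounded (f ` ({1..d} \<rightarrow>\<^sub>E UNIV))" for f d
  proof (rule tendstoI)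
    fix e :: real assume e: "e > 0"
    obtain C where C: "C \<ge> 0" "\<And>v. v \<in> {1..d} \<rightarrow>\<^sub>E UNIV \<Longrightarrow> \<bar>f v\<bar> \<le> C" using bounded[OF f(2)] by blast
    \<comment> \<open>Order of choices: \<open>K\<close> bounds the spacings,
      \<open>\<delta>\<close> comes from uniform continuity for this \<open>K\<close>,
      \<open>L\<close> from both, and \<open>p\<close> is last. Each of the four error terms is
      allotted \<open>e / 4\<close>.\<close>
    have "((\<lambda>K. 2 * C * (real d * exp (- K))) \<longlongrightarrow> 2 * C * (real d * 0)) at_top"
      by (intro tendsto_intros filterlim_compose[OF exp_at_bot filterlim_uminus_at_bot_at_top])
    then have "\<forall>\<^sub>F K in at_top. 2 * C * (real d * exp (- K)) < e / 4"
      using e by (intro order_tendstoD(2)) auto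
    then have "\<forall>\<^sub>F K in at_top. 2 * C * (real d * exp (- K)) < e / 4 \<and> K \<ge> 0"
      by (intro eventually_conj eventually_ge_at_top)
    then obtain K where K: "2 * C * (real d * exp (- K)) < e / 4" "K \<ge> 0"
      using eventually_happens by fastforce
    have "e / 4 > 0" using e by simp
    then obtain \<delta> where \<delta>: "\<delta> > 0" and unif: "\<And>u v. u \<in> {1..d} \<rightarrow>\<^sub>E UNIV \<Longrightarrow> v \<in> {1..d} \<rightarrow>\<^sub>E UNIV \<Longrightarrow>
      (\<And>i. i \<in> {1..d} \<Longrightarrow> 0 \<le> u i \<and> u i \<le> K \<and> \<bar>v i - u i\<bar> \<le> \<delta>) \<Longrightarrow> \<bar>f v - f u\<bar> \<le> e / 4"
      by (rule continuous_map_powertop_uniform[OF f(1), of "e / 4" K]) blast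
    \<comment> \<open>With \<open>L \<ge> 1\<close> one has \<open>L \<le> L\<^sup>2\<close>, so the
      quotient in the maximum makes the error at most \<open>\<delta>\<close>.\<close>
    define L where "L = max 1 ((K + K\<^sup>2) / \<delta>)"
    have L: "L \<ge> 1" "(K + K\<^sup>2) / \<delta> \<le> L" by (auto simp: L_def)
    have "(K + K\<^sup>2) / L\<^sup>2 \<le> \<delta>"
    proof -
      have "L * 1 \<le> L * L" using L by (intro mult_left_mono) auto
      then have "(K + K\<^sup>2) / \<delta> \<le> L\<^sup>2" using L(2) unfolding power2_eq_square[of L] by linarith
      then show ?thesis using \<delta> L by (simp add: field_simps)
    qed
    then have cont: "\<bar>f v - f u\<bar> \<le> e / 4" if "u \<in> {1..d} \<rightarrow>\<^sub>E UNIV" "v \<in> {1..d} \<rightarrow>\<^sub>E UNIV"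
      "\<And>i. i \<in> {1..d} \<Longrightarrow> 0 \<le> u i \<and> u i \<le> K \<and> \<bar>v i - u i\<bar> \<le> (K + K\<^sup>2) / L\<^sup>2" for u v
      using that by (intro unif) (auto intro: order_trans)
    define q where "q = normal_tail L"
    have q: "0 < q" "q \<le> 1"
      using normal_tail_pos[of L] normal_tail_strict_antimono[of 0 L] L normal_tail_0 by (auto simp: q_def)
    \<comment> \<open>For fixed \<open>L\<close> the tail \<open>q\<close> is a positive constant,
      so the bound decays geometrically in the number of null variables.\<close>
    have "(\<lambda>p. (1 - q / 2) ^ (p - k0)) \<longlonglongrightarrow> 0"
      using q by (intro filterlim_compose[OF LIMSEQ_realpow_zero filterlim_minus_const_nat_at_top]) auto
    then have "(\<lambda>p. 2 * C * (2 ^ d * (1 - q / 2) ^ (p - k0))) \<longlonglongrightarrow> 2 * C * (2 ^ d * 0)"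
      by (intro tendsto_intros)
    then have "\<forall>\<^sub>F p in sequentially. 2 * C * (2 ^ d * (1 - q / 2) ^ (p - k0)) < e / 4"
      using e by (intro order_tendstoD(2)) auto
    moreover have "(\<lambda>p. 2 * C * ?not_B p) \<longlonglongrightarrow> 2 * C * 0" by (intro tendsto_intros not_B)
    then have "\<forall>\<^sub>F p in sequentially. 2 * C * ?not_B p < e / 4"
      using e by (intro order_tendstoD(2)) auto
    ultimately show "\<forall>\<^sub>F p in sequentially. dist (\<integral>v. f v \<partial>distr (M p) (?P d) (?T d p)) (\<integral>v. f v \<partial>?\<nu> d) < e"
      using eventually_gt_at_top[of "k0 + d"]
    proof eventually_elim
      case (elim p)
      then have p: "p > k0" by simp
      have "\<bar>(\<integral>v. f v \<partial>distr (M p) (?P d) (?T d p)) - (\<integral>v. f v \<partial>?\<nu> d)\<bar>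
        \<le> e / 4 + 2 * C * (?not_B p + real d * exp (- K) + 2 ^ d * (1 - normal_tail L / 2) ^ (p - k0))"
      proof (rule orthogonal_lasso_model.expectation_test_statistics_approx[OF model[OF p] card_S[OF elim(3)],
          unfolded B_eq[OF p] T_eq[OF p]])
        show "f \<in> borel_measurable (?P d)" by (rule continuous_map_powertop_measurable[OF f(1)])
      qed (use C K L e cont in auto)
      then show ?case using K(1) elim(1,2) by (simp add: dist_real_def q_def algebra_simps)
    qed
  qed
  have weak_cond: "(\<lambda>p. \<integral>v. f v \<partial>distr (uniform_measure (M p) (B p)) (?P d) (?T d p)) \<longlonglongrightarrow> (\<integral>v. f v \<partial>?\<nu> d)"
    if f: "continuous_map (powertop_real {1..d}) euclideanreal f" "bounded (f ` ({1..d} \<rightarrow>\<^sub>E UNIV))" for f d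
  proof -
    let ?a = "\<lambda>p. \<integral>v. f v \<partial>distr (uniform_measure (M p) (B p)) (?P d) (?T d p)"
      and ?b = "\<lambda>p. \<integral>v. f v \<partial>distr (M p) (?P d) (?T d p)" and ?\<pi> = "\<lambda>p. measure (M p) (B p)"
    obtain C where C: "C \<ge> 0" "\<And>v. v \<in> {1..d} \<rightarrow>\<^sub>E UNIV \<Longrightarrow> \<bar>f v\<bar> \<le> C" using bounded[OF f(2)] by blast
    \<comment> \<open>The conditional law is meaningful once \<open>B p\<close> has positive
      probability, which holds for large \<open>p\<close> because the limit is 1.\<close>
    have pos: "\<forall>\<^sub>F p in sequentially. ?\<pi> p > 0" using lim_B by (intro order_tendstoD(1)) auto
    have "(\<lambda>p. ?\<pi> p * ?a p - ?b p) \<longlonglongrightarrow> 0"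
    proof (rule Lim_null_comparison)
      show "\<forall>\<^sub>F p in sequentially. norm (?\<pi> p * ?a p - ?b p) \<le> C * (1 - ?\<pi> p)"
        using pos eventually_gt_at_top[of "k0 + d"]
      proof eventually_elim
        case (elim p)
        then have p: "p > k0" by simp
        have "\<bar>?\<pi> p * ?a p - ?b p\<bar> \<le> C * (1 - ?\<pi> p)"
        proof (rule orthogonal_lasso_model.uniform_measure_test_statistics_approx[OF model[OF p] card_S[OF elim(2)],
            unfolded B_eq[OF p] T_eq[OF p]])
          show "f \<in> borel_measurable (?P d)" by (rule continuous_map_powertop_measurable[OF f(1)])
        qed (use C elim(1) in auto)
        then show ?case by simp
      qed
      show "(\<lambda>p. C * (1 - ?\<pi> p)) \<longlonglongrightarrow> 0"
        using tendsto_mult[OF tendsto_const tendsto_diff[OF tendsto_const lim_B], of C 1] by simp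
    qed
    from tendsto_add[OF this weak[OF f]] have "(\<lambda>p. ?\<pi> p * ?a p) \<longlonglongrightarrow> (\<integral>v. f v \<partial>?\<nu> d)" by simp
    from tendsto_divide[OF this lim_B] have "(\<lambda>p. ?\<pi> p * ?a p / ?\<pi> p) \<longlonglongrightarrow> (\<integral>v. f v \<partial>?\<nu> d)" by simp
    then show ?thesis
    proof (rule Lim_transform_eventually)
      show "\<forall>\<^sub>F p in sequentially. ?\<pi> p * ?a p / ?\<pi> p = ?a p" using pos by eventually_elim simp
    qed
  qed
  show ?thesis unfolding weak_conv_vec_def using lim_B weak weak_cond by blast
qed

end
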